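(* Let $s\ge 2$, let $\mathcal{O}\subset\mathbb{R}^s$ be open, let $F(\vec u)=f_1(u_1)+\dots+f_s(u_s)$ be a smooth function on $\mathcal{O}$, and let $(M_F,g_F)$, $\alpha_F$ and the model space $\mathcal{V}_{3s}=(\mathbb{R}^{3s},g_{3s},R_{3s})$ be as defined in the context. Then $(M_F,g_F)$ is a pseudo-Riemannian manifold of signature $(2s,s)$ which is Ricci flat. Moreover: (1) $(M_F,g_F)$ is curvature homogeneous with model $\mathcal{V}_{3s}$; that is, for every $P\in M_F$ there is a linear isomorphism $\Psi:T_PM_F\to\mathbb{R}^{3s}$ such that $\Psi^*g_{3s}=(g_F)_P$ and $\Psi^*R_{3s}=(R_F)_P$. (2) $(M_F,g_F)$ is spacelike Jordan Osserman but not timelike Jordan Osserman. (3) $(M_F,g_F)$ is $k$-spacelike higher order Jordan Osserman for every $2\le k\le s$; and for $2\le k\le 2s$, $(M_F,g_F)$ is $k$-timelike higher order Jordan Osserman if and only if $s+2\le k\le 2s$. (4) If there exists a local isometry $\psi$ of $(M_F,g_F)$ with $\psi(P)=Q$, then $\alpha_F(P)=\alpha_F(Q)$. Thus $(M_F,g_F)$ is not locally homogeneous for generic $F$, i.e. $(M_F,g_F)$ is not locally homogeneous whenever $\alpha_F$ is not constant.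
   Context: Signature $(p,q)$ means $p$ timelike (negative) and $q$ spacelike (positive) directions. The manifold: let $(\vec u,\vec t,\vec v)$ with $\vec u=(u_1,\dots,u_s)$, $\vec t=(t_1,\dots,t_s)$, $\vec v=(v_1,\dots,v_s)$ be coordinates on $\mathbb{R}^{3s}$, with coordinate fields $\partial_i^u,\partial_i^t,\partial_i^v$. Put $u\cdot t=\sum_{i}u_it_i$. On $M_F:=\mathcal{O}\times\mathbb{R}^{2s}$ (with $\vec u\in\mathcal{O}$) the metric $g_F$ has as its only non-zero components, for $1\le i\le s$, $$g_F(\partial_i^u,\partial_i^u)=-2F(\vec u)-2u\cdot t,\quad g_F(\partial_i^u,\partial_i^v)=g_F(\partial_i^v,\partial_i^u)=1,\quad g_F(\partial_i^t,\partial_i^t)=-1.$$ Set $F_{/iii}:=(\partial_i^u)^3F$ and $\alpha_F:=\sum_{1\le i\le s}\{F_{/iii}+4u_i\}^2$, regarded as a function on $M_F$ depending only on $\vec u$. The model space: $\mathbb{R}^{3s}$ has basis $\{U_1,\dots,U_s,T_1,\dots,T_s,V_1,\dots,V_s\}$. The non-zero entries of the inner product $g_{3s}$ and of the algebraic curvature tensor $R_{3s}$ are, up to the symmetries $R(x,y,z,w)=R(z,w,x,y)=-R(y,x,z,w)$, $$g_{3s}(U_i,V_i)=g_{3s}(V_i,U_i)=1,\quad g_{3s}(T_i,T_i)=-1,\quad R_{3s}(U_i,U_j,U_j,T_i)=1\ \text{ for } i\ne j.$$ Curvature conventions: with $\nabla$ the Levi-Civita connection, $R(x,y)=\nabla_x\nabla_y-\nabla_y\nabla_x-\nabla_{[x,y]}$,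 $R(x,y,z,w)=g(R(x,y)z,w)$; $R_F$ is the curvature tensor of $g_F$. The Jacobi operator of a tangent vector $x$ is $J(x):y\mapsto R(y,x)x$. The Ricci tensor is determined by $\rho(x,x)=\operatorname{Tr}J(x)$. A pseudo-Riemannian manifold is spacelike (resp. timelike) Jordan Osserman if the Jordan normal form of $J(x)$ is constant as $x$ ranges over all unit spacelike (resp. unit timelike) tangent vectors at all points. For a spacelike (resp. timelike) $k$-plane $\pi$ in a tangent space, with orthonormal basis $\{e_1,\dots,e_k\}$, the higher order Jacobi operator is $J(\pi)=J(e_1)+\dots+J(e_k)$ (independent of the basis). For $k\ge2$, the manifold is $k$-spacelike (resp. $k$-timelike) higher order Jordan Osserman if the Jordan normal form of $J(\pi)$ is constant as $\pi$ ranges over all spacelike (resp. timelike) $k$-planes in all tangent spaces. A local isometry $\psi$ with $\psi(P)=Q$ is an isometry from a neighborhood of $P$ onto a neighborhood of $Q$ taking $P$ to $Q$. The manifold is locally homogeneous if for any two points $P,Q$ such a local isometry exists. *)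

theory Defs
  imports "HOL-Analysis.Analysis" "Jordan_Normal_Form.Jordan_Normal_Form"
begin

no_notation vec_index (infixl \<open>$\<close> 100)
no_notation scalar_prod (infix \<open>\<bullet>\<close> 70)

section \<open>Smooth maps on open sets\<close>

primrec times_differentiable_on ::
  "nat \<Rightarrow> 'a::real_normed_vector set \<Rightarrow> ('a \<Rightarrow> 'b::real_normed_vector) \<Rightarrow> bool" where
  "times_differentiable_on 0 S f \<longleftrightarrow> continuous_on S f"
| "times_differentiable_on (Suc n) S f \<longleftrightarrow>
     (\<forall>x\<in>S. f differentiable (at x)) \<and>
     (\<forall>v. times_differentiable_on n S (\<lambda>x. frechet_derivative f (at x) v))"

text \<open>Only used for open \<open>S\<close>.\<close>

definition smooth_on :: "'a::real_normed_vector set \<Rightarrow> ('a \<Rightarrow> 'b::real_normed_vector) \<Rightarrow> bool" where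
  "smooth_on S f \<longleftrightarrow> (\<forall>n. times_differentiable_on n S f)"


section \<open>Pseudo-Riemannian geometry on open subsets of a Euclidean space\<close>

text \<open>
  A manifold is an open subset \<open>M\<close> of a Euclidean space \<open>'a\<close> (a single global chart), so every
  tangent space is \<open>'a\<close>, a vector field is a map \<open>'a \<Rightarrow> 'a\<close> of which only the values on \<open>M\<close>
  matter, and a metric \<open>g\<close> assigns to each point a bilinear form.  The Euclidean inner product
  of \<open>'a\<close> plays no geometric role.
\<close>

definition pseudo_riemannian :: "'a::euclidean_space set \<Rightarrow> ('a \<Rightarrow> 'a \<Rightarrow> 'a \<Rightarrow> real) \<Rightarrow> bool" where
  "pseudo_riemannian M g \<longleftrightarrow>
     open M \<and>
     (\<forall>p\<in>M. bilinear (g p) \<and> (\<forall>x y. g p x y = g p y x) \<and>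
            (\<forall>x. (\<forall>y. g p x y = 0) \<longrightarrow> x = 0)) \<and>
     (\<forall>x y. smooth_on M (\<lambda>p. g p x y))"

text \<open>Signature \<open>(p, q)\<close>: an orthonormal basis has \<open>p\<close> timelike and \<open>q\<close> spacelike members.\<close>

definition has_signature :: "('a::euclidean_space \<Rightarrow> 'a \<Rightarrow> real) \<Rightarrow> nat \<Rightarrow> nat \<Rightarrow> bool" where
  "has_signature b p q \<longleftrightarrow>
     (\<exists>N P. finite N \<and> finite P \<and> card N = p \<and> card P = q \<and>
        independent (N \<union> P) \<and> span (N \<union> P) = UNIV \<and>
        (\<forall>x\<in>N. b x x = -1) \<and> (\<forall>x\<in>P. b x x = 1) \<and>
        (\<forall>x\<in>N \<union> P. \<forall>y\<in>N \<union> P. x \<noteq> y \<longrightarrow> b x y = 0))"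

definition lie_bracket :: "('a::real_normed_vector \<Rightarrow> 'a) \<Rightarrow> ('a \<Rightarrow> 'a) \<Rightarrow> 'a \<Rightarrow> 'a" where
  "lie_bracket X Y p = frechet_derivative Y (at p) (X p) - frechet_derivative X (at p) (Y p)"

definition affine_connection ::
  "'a::euclidean_space set \<Rightarrow> (('a \<Rightarrow> 'a) \<Rightarrow> ('a \<Rightarrow> 'a) \<Rightarrow> 'a \<Rightarrow> 'a) \<Rightarrow> bool" where
  "affine_connection M nabla \<longleftrightarrow>
     (\<forall>X Y. smooth_on M X \<longrightarrow> smooth_on M Y \<longrightarrow> smooth_on M (nabla X Y)) \<and>
     (\<forall>X X' Y. smooth_on M X \<longrightarrow> smooth_on M X' \<longrightarrow> smooth_on M Y \<longrightarrow>
        (\<forall>p\<in>M. nabla (\<lambda>q. X q + X' q) Y p = nabla X Y p + nabla X' Y p)) \<and>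
     (\<forall>\<phi> X Y. smooth_on M \<phi> \<longrightarrow> smooth_on M X \<longrightarrow> smooth_on M Y \<longrightarrow>
        (\<forall>p\<in>M. nabla (\<lambda>q. \<phi> q *\<^sub>R X q) Y p = \<phi> p *\<^sub>R nabla X Y p)) \<and>
     (\<forall>X Y Y'. smooth_on M X \<longrightarrow> smooth_on M Y \<longrightarrow> smooth_on M Y' \<longrightarrow>
        (\<forall>p\<in>M. nabla X (\<lambda>q. Y q + Y' q) p = nabla X Y p + nabla X Y' p)) \<and>
     (\<forall>\<phi> X Y. smooth_on M \<phi> \<longrightarrow> smooth_on M X \<longrightarrow> smooth_on M Y \<longrightarrow>
        (\<forall>p\<in>M. nabla X (\<lambda>q. \<phi> q *\<^sub>R Y q) p =
          frechet_derivative \<phi> (at p) (X p) *\<^sub>R Y p + \<phi> p *\<^sub>R nabla X Y p))"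

definition is_levi_civita ::
  "'a::euclidean_space set \<Rightarrow> ('a \<Rightarrow> 'a \<Rightarrow> 'a \<Rightarrow> real) \<Rightarrow>
   (('a \<Rightarrow> 'a) \<Rightarrow> ('a \<Rightarrow> 'a) \<Rightarrow> 'a \<Rightarrow> 'a) \<Rightarrow> bool" where
  "is_levi_civita M g nabla \<longleftrightarrow>
     affine_connection M nabla \<and>
     (\<forall>X Y. smooth_on M X \<longrightarrow> smooth_on M Y \<longrightarrow>
        (\<forall>p\<in>M. nabla X Y p - nabla Y X p = lie_bracket X Y p)) \<and>
     (\<forall>X Y Z. smooth_on M X \<longrightarrow> smooth_on M Y \<longrightarrow> smooth_on M Z \<longrightarrow>
        (\<forall>p\<in>M. frechet_derivative (\<lambda>q. g q (Y q) (Z q)) (at p) (X p) =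
          g p (nabla X Y p) (Z p) + g p (Y p) (nabla X Z p)))"

text \<open>
  The defining properties determine \<open>nabla X Y\<close> on \<open>M\<close> for \<open>X\<close>, \<open>Y\<close> smooth on \<open>M\<close>
  (Koszul formula), so the choice below only concerns irrelevant values (off \<open>M\<close>, or at
  non-smooth fields).
\<close>

definition levi_civita ::
  "'a::euclidean_space set \<Rightarrow> ('a \<Rightarrow> 'a \<Rightarrow> 'a \<Rightarrow> real) \<Rightarrow> ('a \<Rightarrow> 'a) \<Rightarrow> ('a \<Rightarrow> 'a) \<Rightarrow> 'a \<Rightarrow> 'a" where
  "levi_civita M g = (SOME nabla. is_levi_civita M g nabla)"

definition curvature_field ::
  "(('a \<Rightarrow> 'a) \<Rightarrow> ('a \<Rightarrow> 'a) \<Rightarrow> 'a \<Rightarrow> 'a) \<Rightarrow>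
   ('a::real_normed_vector \<Rightarrow> 'a) \<Rightarrow> ('a \<Rightarrow> 'a) \<Rightarrow> ('a \<Rightarrow> 'a) \<Rightarrow> 'a \<Rightarrow> 'a" where
  "curvature_field nabla X Y Z p =
     nabla X (nabla Y Z) p - nabla Y (nabla X Z) p - nabla (lie_bracket X Y) Z p"

text \<open>
  The curvature operator \<open>R(x,y)z\<close> of tangent vectors at \<open>p\<close>.  Curvature is tensorial, so the
  vectors may be extended to any smooth vector fields; we take constant ones.
\<close>

definition curvature ::
  "'a::euclidean_space set \<Rightarrow> ('a \<Rightarrow> 'a \<Rightarrow> 'a \<Rightarrow> real) \<Rightarrow> 'a \<Rightarrow> 'a \<Rightarrow> 'a \<Rightarrow> 'a \<Rightarrow> 'a" where
  "curvature M g p x y z = curvature_field (levi_civita M g) (\<lambda>_. x) (\<lambda>_. y) (\<lambda>_. z) p"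

definition curvature_tensor ::
  "'a::euclidean_space set \<Rightarrow> ('a \<Rightarrow> 'a \<Rightarrow> 'a \<Rightarrow> real) \<Rightarrow> 'a \<Rightarrow> 'a \<Rightarrow> 'a \<Rightarrow> 'a \<Rightarrow> 'a \<Rightarrow> real" where
  "curvature_tensor M g p x y z w = g p (curvature M g p x y z) w"

definition jacobi ::
  "'a::euclidean_space set \<Rightarrow> ('a \<Rightarrow> 'a \<Rightarrow> 'a \<Rightarrow> real) \<Rightarrow> 'a \<Rightarrow> 'a \<Rightarrow> 'a \<Rightarrow> 'a" where
  "jacobi M g p x y = curvature M g p y x x"

definition operator_trace :: "('a::euclidean_space \<Rightarrow> 'a) \<Rightarrow> real" where
  "operator_trace A = (\<Sum>b\<in>Basis. A b \<bullet> b)"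

text \<open>
  The symmetric bilinear form determined by \<open>ricci x x = Tr (J x)\<close>, by polarization.
\<close>

definition ricci ::
  "'a::euclidean_space set \<Rightarrow> ('a \<Rightarrow> 'a \<Rightarrow> 'a \<Rightarrow> real) \<Rightarrow> 'a \<Rightarrow> 'a \<Rightarrow> 'a \<Rightarrow> real" where
  "ricci M g p x y =
     (operator_trace (jacobi M g p (x + y)) - operator_trace (jacobi M g p x)
        - operator_trace (jacobi M g p y)) / 2"

definition ricci_flat :: "'a::euclidean_space set \<Rightarrow> ('a \<Rightarrow> 'a \<Rightarrow> 'a \<Rightarrow> real) \<Rightarrow> bool" where
  "ricci_flat M g \<longleftrightarrow> (\<forall>p\<in>M. \<forall>x y. ricci M g p x y = 0)"


section \<open>Curvature homogeneity and local isometries\<close>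

definition curvature_homogeneous_with_model ::
  "'a::euclidean_space set \<Rightarrow> ('a \<Rightarrow> 'a \<Rightarrow> 'a \<Rightarrow> real) \<Rightarrow>
   ('b::euclidean_space \<Rightarrow> 'b \<Rightarrow> real) \<Rightarrow> ('b \<Rightarrow> 'b \<Rightarrow> 'b \<Rightarrow> 'b \<Rightarrow> real) \<Rightarrow> bool" where
  "curvature_homogeneous_with_model M g g0 R0 \<longleftrightarrow>
     (\<forall>p\<in>M. \<exists>\<Psi>. linear \<Psi> \<and> bij \<Psi> \<and>
        (\<forall>x y. g0 (\<Psi> x) (\<Psi> y) = g p x y) \<and>
        (\<forall>x y z w. R0 (\<Psi> x) (\<Psi> y) (\<Psi> z) (\<Psi> w) = curvature_tensor M g p x y z w))"

definition local_isometry ::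
  "'a::euclidean_space set \<Rightarrow> ('a \<Rightarrow> 'a \<Rightarrow> 'a \<Rightarrow> real) \<Rightarrow> ('a \<Rightarrow> 'a) \<Rightarrow> 'a \<Rightarrow> 'a \<Rightarrow> bool" where
  "local_isometry M g \<psi> P Q \<longleftrightarrow>
     \<psi> P = Q \<and>
     (\<exists>A B \<phi>. open A \<and> open B \<and> A \<subseteq> M \<and> B \<subseteq> M \<and> P \<in> A \<and> Q \<in> B \<and>
        homeomorphism A B \<psi> \<phi> \<and> smooth_on A \<psi> \<and> smooth_on B \<phi> \<and>
        (\<forall>p\<in>A. \<forall>x y. g (\<psi> p) (frechet_derivative \<psi> (at p) x) (frechet_derivative \<psi> (at p) y)
                       = g p x y))"

definition locally_homogeneous ::
  "'a::euclidean_space set \<Rightarrow> ('a \<Rightarrow> 'a \<Rightarrow> 'a \<Rightarrow> real) \<Rightarrow> bool" where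
  "locally_homogeneous M g \<longleftrightarrow> (\<forall>P\<in>M. \<forall>Q\<in>M. \<exists>\<psi>. local_isometry M g \<psi> P Q)"


section \<open>Jordan Osserman conditions\<close>

text \<open>
  The matrix of a linear operator, with complex entries so that a Jordan normal form always
  exists.  The choice of an enumeration of the basis does not affect the Jordan normal form.
\<close>

definition basis_list :: "'a::euclidean_space list" where
  "basis_list = (SOME bs. distinct bs \<and> set bs = Basis)"

definition operator_matrix :: "('a::euclidean_space \<Rightarrow> 'a) \<Rightarrow> complex mat" where
  "operator_matrix A =
     Matrix.mat DIM('a) DIM('a)
       (\<lambda>(i, j). complex_of_real (A (basis_list ! j) \<bullet> basis_list ! i))"

text \<open>
  Below, \<open>\<epsilon> = 1\<close> is the spacelike and \<open>\<epsilon> = -1\<close> the timelike case.  The list \<open>blocks\<close> gives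
  sizes and eigenvalues of the Jordan blocks; it is the same for all points and vectors (planes).
\<close>

definition jordan_osserman ::
  "real \<Rightarrow> 'a::euclidean_space set \<Rightarrow> ('a \<Rightarrow> 'a \<Rightarrow> 'a \<Rightarrow> real) \<Rightarrow> bool" where
  "jordan_osserman \<epsilon> M g \<longleftrightarrow>
     (\<exists>blocks. \<forall>p\<in>M. \<forall>x. g p x x = \<epsilon> \<longrightarrow> jordan_nf (operator_matrix (jacobi M g p x)) blocks)"

abbreviation "spacelike_jordan_osserman \<equiv> jordan_osserman 1"
abbreviation "timelike_jordan_osserman \<equiv> jordan_osserman (-1)"

definition definite_plane ::
  "real \<Rightarrow> nat \<Rightarrow> ('a::euclidean_space \<Rightarrow> 'a \<Rightarrow> real) \<Rightarrow> 'a set \<Rightarrow> bool" where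
  "definite_plane \<epsilon> k b \<pi> \<longleftrightarrow>
     subspace \<pi> \<and> dim \<pi> = k \<and> (\<forall>x\<in>\<pi>. x \<noteq> 0 \<longrightarrow> \<epsilon> * b x x > 0)"

definition orthonormal_basis_of ::
  "real \<Rightarrow> ('a::euclidean_space \<Rightarrow> 'a \<Rightarrow> real) \<Rightarrow> 'a set \<Rightarrow> 'a set \<Rightarrow> bool" where
  "orthonormal_basis_of \<epsilon> b \<pi> E \<longleftrightarrow>
     finite E \<and> independent E \<and> span E = \<pi> \<and>
     (\<forall>e\<in>E. b e e = \<epsilon>) \<and> (\<forall>e\<in>E. \<forall>e'\<in>E. e \<noteq> e' \<longrightarrow> b e e' = 0)"

text \<open>
  The operator \<open>J(\<pi>) = \<Sum>e\<in>E. J(e)\<close> does not depend on the orthonormal basis \<open>E\<close> of \<open>\<pi>\<close>,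
  so we quantify over all such bases instead of selecting one.
\<close>

definition higher_jordan_osserman ::
  "real \<Rightarrow> nat \<Rightarrow> 'a::euclidean_space set \<Rightarrow> ('a \<Rightarrow> 'a \<Rightarrow> 'a \<Rightarrow> real) \<Rightarrow> bool" where
  "higher_jordan_osserman \<epsilon> k M g \<longleftrightarrow>
     (\<exists>blocks. \<forall>p\<in>M. \<forall>\<pi> E.
        definite_plane \<epsilon> k (g p) \<pi> \<longrightarrow> orthonormal_basis_of \<epsilon> (g p) \<pi> E \<longrightarrow>
        jordan_nf (operator_matrix (\<lambda>y. \<Sum>e\<in>E. jacobi M g p e y)) blocks)"

abbreviation "spacelike_higher_jordan_osserman \<equiv> higher_jordan_osserman 1"
abbreviation "timelike_higher_jordan_osserman \<equiv> higher_jordan_osserman (-1)"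


section \<open>The manifold and the model space\<close>

text \<open>
  \<open>\<real>\<^bsup>3s\<^esup>\<close> is \<open>\<real>\<^sup>s \<times> \<real>\<^sup>s \<times> \<real>\<^sup>s\<close> with \<open>s = CARD('s)\<close>; the three components are the
  coordinates \<open>u, t, v\<close>, for points as well as for tangent vectors.
\<close>

type_synonym 's space3 = "(real^'s) \<times> (real^'s) \<times> (real^'s)"

abbreviation U_vec :: "'s::finite \<Rightarrow> 's space3" where "U_vec i \<equiv> (axis i 1, 0, 0)"
abbreviation T_vec :: "'s::finite \<Rightarrow> 's space3" where "T_vec i \<equiv> (0, axis i 1, 0)"
abbreviation V_vec :: "'s::finite \<Rightarrow> 's space3" where "V_vec i \<equiv> (0, 0, axis i 1)"

definition M_F :: "(real^'s) set \<Rightarrow> ('s::finite) space3 set" where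
  "M_F \<O> = \<O> \<times> UNIV"

definition g_F :: "(real^'s \<Rightarrow> real) \<Rightarrow> ('s::finite) space3 \<Rightarrow> 's space3 \<Rightarrow> 's space3 \<Rightarrow> real" where
  "g_F F = (\<lambda>(u, t, v) (xu, xt, xv) (yu, yt, yv).
     (- 2 * F u - 2 * (u \<bullet> t)) * (xu \<bullet> yu) + xu \<bullet> yv + xv \<bullet> yu - xt \<bullet> yt)"

lemma g_F_components:
  "g_F F (u, t, v) (U_vec i) (U_vec j) = (if i = j then - 2 * F u - 2 * (\<Sum>k\<in>UNIV. u $ k * t $ k) else 0)"
  "g_F F (u, t, v) (U_vec i) (V_vec j) = (if i = j then 1 else 0)"
  "g_F F (u, t, v) (V_vec i) (U_vec j) = (if i = j then 1 else 0)"
  "g_F F (u, t, v) (T_vec i) (T_vec j) = (if i = j then -1 else 0)"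
  "g_F F (u, t, v) (U_vec i) (T_vec j) = 0" "g_F F (u, t, v) (T_vec i) (U_vec j) = 0"
  "g_F F (u, t, v) (T_vec i) (V_vec j) = 0" "g_F F (u, t, v) (V_vec i) (T_vec j) = 0"
  "g_F F (u, t, v) (V_vec i) (V_vec j) = 0"
  by (auto simp: g_F_def inner_axis_axis inner_vec_def[of u t])

definition partial_deriv :: "'s::finite \<Rightarrow> (real^'s \<Rightarrow> real) \<Rightarrow> real^'s \<Rightarrow> real" where
  "partial_deriv i F u = frechet_derivative F (at u) (axis i 1)"

definition alpha_F :: "(real^'s \<Rightarrow> real) \<Rightarrow> ('s::finite) space3 \<Rightarrow> real" where
  "alpha_F F = (\<lambda>(u, t, v). \<Sum>i\<in>UNIV. ((partial_deriv i ^^ 3) F u + 4 * u $ i)\<^sup>2)"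

definition g_model :: "('s::finite) space3 \<Rightarrow> 's space3 \<Rightarrow> real" where
  "g_model = (\<lambda>(xu, xt, xv) (yu, yt, yv). xu \<bullet> yv + xv \<bullet> yu - xt \<bullet> yt)"

text \<open>
  With \<open>uu i j\<close> and \<open>ut j i\<close> the 2-forms dual to \<open>U\<^sub>i \<and> U\<^sub>j\<close> and \<open>U\<^sub>j \<and> T\<^sub>i\<close>, the model curvature
  tensor is the sum over \<open>i \<noteq> j\<close> of \<open>uu i j \<otimes> ut j i + ut j i \<otimes> uu i j\<close>.
\<close>

definition R_model ::
  "('s::finite) space3 \<Rightarrow> 's space3 \<Rightarrow> 's space3 \<Rightarrow> 's space3 \<Rightarrow> real" where
  "R_model x y z w =
     (let uu = (\<lambda>i j (xu, xt, xv) (yu, yt, yv). xu $ i * yu $ j - yu $ i * xu $ j);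
          ut = (\<lambda>j i (xu, xt, xv) (yu, yt, yv). xu $ j * yt $ i - yu $ j * xt $ i)
      in \<Sum>i\<in>UNIV. \<Sum>j\<in>UNIV - {i}. uu i j x y * ut j i z w + ut j i x y * uu i j z w)"

lemma R_model_symmetries:
  "R_model x y z w = R_model z w x y" "R_model x y z w = - R_model y x z w"
  by (auto simp: R_model_def Let_def case_prod_beta sum_negf[symmetric] algebra_simps
        intro!: sum.cong)

lemma R_model_components:
  "R_model (U_vec a) (U_vec b) (U_vec c) (T_vec d) =
     (if a = d \<and> b = c then 1 else 0) - (if a = c \<and> b = d then 1 else 0)"
  "R_model (U_vec a) (U_vec b) (U_vec c) (U_vec d) = 0"
  "R_model (U_vec a) (T_vec b) (U_vec c) (T_vec d) = 0"
  "R_model (T_vec a) (T_vec b) z w = 0"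
  "R_model (V_vec a) y z w = 0"
proof -
  have "R_model (U_vec a) (U_vec b) (U_vec c) (T_vec d) =
      (\<Sum>i\<in>UNIV. \<Sum>j\<in>UNIV - {i}. if j = c then if i = d then
         axis a 1 $ i * axis b 1 $ j - axis b 1 $ i * axis a 1 $ j else 0 else 0)"
    unfolding R_model_def Let_def
    by (intro sum.cong refl) (simp add: axis_def)
  also have "\<dots> = (\<Sum>i\<in>UNIV. if i = d then if c \<noteq> i then
         axis a 1 $ i * axis b 1 $ c - axis b 1 $ i * axis a 1 $ c else 0 else 0)"
    by (intro sum.cong refl) simp
  also have "\<dots> = (if c \<noteq> d then
         axis a 1 $ d * axis b 1 $ c - axis b 1 $ d * axis a 1 $ c else 0)"
    by simp
  also have "\<dots> = (if a = d \<and> b = c then 1 else 0) - (if a = c \<and> b = d then 1 else 0)"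
    by (cases "a = d"; cases "b = c"; cases "a = c"; cases "b = d"; simp add: axis_def)
  finally show "R_model (U_vec a) (U_vec b) (U_vec c) (T_vec d) =
     (if a = d \<and> b = c then 1 else 0) - (if a = c \<and> b = d then 1 else 0)" .
qed (simp_all add: R_model_def Let_def case_prod_beta)

end

theory Submission
  imports Defs "Jordan_Normal_Form.Jordan_Normal_Form_Existence"
begin

text \<open>
  In the coordinates \<open>(u, t, v)\<close> the curvature is the Kulkarni-Nomizu product of the parallel form
  \<open>|du|\<^sup>2\<close> with a symmetric form \<open>B\<close>, which is the model form \<open>2 du dt\<close> plus a quadratic form in
  \<open>du\<close>; a linear change of frame absorbs the latter.  Hence
  \<open>J(\<pi>) (a, b, c) = (0, - G a, C a + G b)\<close> with \<open>G = \<Sum> (|x|\<^sup>2 - x \<otimes> x)\<close>, summed over the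
  \<open>u\<close>-parts \<open>x\<close> of an orthonormal basis of \<open>\<pi>\<close>, and the Jordan form depends only on whether
  these parts span \<open>0\<close>, a line, or more.

  The differential of a local isometry preserves the filtration \<open>V \<subseteq> T \<oplus> V\<close> given by the kernel of
  the curvature and its orthogonal complement, and acts by one orthogonal map \<open>Q\<close> on the \<open>u\<close>- and
  \<open>t\<close>-parts.  Differentiating the invariance of the curvature shows that \<open>Q\<close> matches the cubic
  forms \<open>F''' + 3 (u \<bullet> du) |du|\<^sup>2\<close> at the two points when \<open>s \<ge> 3\<close>, and their traces when \<open>s = 2\<close>.
  For \<open>s = 2\<close> the squared length of the trace is \<open>\<alpha>\<close>; for \<open>s \<ge> 3\<close> associativity of componentwise
  multiplication forces \<open>Q\<close> to match \<open>F'''\<close> and \<open>u\<close> separately.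
\<close>

text \<open>Where the bound \<open>s + 2\<close> comes from: a timelike subspace of
  \<open>T \<oplus> V\<close> has dimension at most \<open>s\<close>, so a timelike plane whose
  \<open>u\<close>-projection lies in a line has dimension at most \<open>s + 1\<close>. Up to that
  dimension such planes coexist with planes whose projection is larger, and their Jordan forms
  differ. A spacelike plane meets \<open>T \<oplus> V\<close> only in 0, so its projection is
  injective and no degeneracy survives for k at least 2.

  Where the cubic form and the 4 in \<alpha> come from: differentiating \<open>B\<close> along
  \<open>z\<close> yields F''' and \<open>(u . z) |a|^2\<close>, while the second derivative of the
  isometry, whose \<open>t\<close>-part is \<open>(x . y) (u' - Q u)\<close>, yields
  \<open>2 (z . a) (u . a)\<close>. Together they polarize \<open>3 (u . du) |du|^2\<close>, whose
  trace over \<open>a\<close> is \<open>(s + 2) (u . z)\<close>, and s + 2 = 4 for s = 2.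

  The case distinction is forced: on the \<open>u\<close>-directions the product with
  \<open>|du|^2\<close> determines a symmetric form only if s is at least 3, and for s = 2 it sees
  only the trace.\<close>

no_notation vec_index (infixl \<open>$\<close> 100)
no_notation scalar_prod (infix \<open>\<bullet>\<close> 70)

section \<open>Smooth maps\<close>

lemma times_differentiable_on_cong:
  assumes "open S" "\<And>x. x \<in> S \<Longrightarrow> f x = g x"
  shows "times_differentiable_on n S f \<longleftrightarrow> times_differentiable_on n S g"
proof -
  have "times_differentiable_on n S g"
    if "times_differentiable_on n S f" "\<And>x. x \<in> S \<Longrightarrow> f x = g x" for f g :: "'a \<Rightarrow> 'b"
    using that
  proof (induction n arbitrary: f g)
    case 0
    then show ?case by (simp cong: continuous_on_cong)
  next
    case (Suc n)
    have d: "(g has_derivative frechet_derivative f (at x)) (at x)" if "x \<in> S" for x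
      using Suc.prems that assms(1)
      by (auto intro: has_derivative_transform_within_open[of f _ x UNIV S] simp: frechet_derivative_works[symmetric])
    have "times_differentiable_on n S (\<lambda>x. frechet_derivative g (at x) v)" for v
    proof (rule Suc.IH)
      show "times_differentiable_on n S (\<lambda>x. frechet_derivative f (at x) v)"
        using Suc.prems(1) by simp
      show "frechet_derivative f (at x) v = frechet_derivative g (at x) v" if "x \<in> S" for x
        using frechet_derivative_at[OF d[OF that]] by simp
    qed
    moreover have "g differentiable at x" if "x \<in> S" for x
      using d[OF that] by (auto simp: differentiable_def)
    ultimately show ?case by simp
  qed
  from this[of f g] this[of g f] show ?thesis using assms by auto
qed

lemma times_differentiable_on_SucI:
  assumes "open S" "\<And>x. x \<in> S \<Longrightarrow> (f has_derivative f' x) (at x)"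
    and "\<And>v. times_differentiable_on n S (\<lambda>x. f' x v)"
  shows "times_differentiable_on (Suc n) S f"
proof -
  have "frechet_derivative f (at x) = f' x" if "x \<in> S" for x
    using frechet_derivative_at[OF assms(2)[OF that]] by simp
  then show ?thesis
    using assms times_differentiable_on_cong
        [of S "\<lambda>x. frechet_derivative f (at x) v" "\<lambda>x. f' x v" n for v]
    unfolding times_differentiable_on.simps differentiable_def by (metis (no_types, lifting))
qed

lemma times_differentiable_on_has_derivative:
  assumes "times_differentiable_on (Suc n) S f" "x \<in> S"
  shows "(f has_derivative frechet_derivative f (at x)) (at x)"
  using assms by (simp add: frechet_derivative_works[symmetric])

lemma times_differentiable_on_mono_Suc:
  "times_differentiable_on (Suc n) S f \<Longrightarrow> times_differentiable_on n S f"
proof (induction n arbitrary: f)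
  case 0
  then show ?case
    by (simp add: continuous_at_imp_continuous_on differentiable_imp_continuous_within)
qed auto

lemma times_differentiable_on_const: "times_differentiable_on n S (\<lambda>_. c)"
  by (induction n arbitrary: c) auto

lemma times_differentiable_on_add:
  assumes "open S"
  shows "times_differentiable_on n S f \<Longrightarrow> times_differentiable_on n S g
    \<Longrightarrow> times_differentiable_on n S (\<lambda>x. f x + g x)"
proof (induction n arbitrary: f g)
  case 0
  then show ?case by (simp add: continuous_on_add)
next
  case (Suc n)
  show ?case
    using Suc.prems
    by (intro times_differentiable_on_SucI[OF assms, of _ "\<lambda>x v. frechet_derivative f (at x) v + frechet_derivative g (at x) v"]
        has_derivative_add Suc.IH) (auto simp: frechet_derivative_works[symmetric])
qed

lemma times_differentiable_on_bilinear:
  assumes "open S" "bounded_bilinear B"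
  shows "times_differentiable_on n S f \<Longrightarrow> times_differentiable_on n S g
    \<Longrightarrow> times_differentiable_on n S (\<lambda>x. B (f x) (g x))"
proof (induction n arbitrary: f g)
  case 0
  then show ?case by (auto intro: bounded_bilinear.continuous_on[OF assms(2)])
next
  case (Suc n)
  \<comment> \<open>The product rule leaves \<open>f\<close> and \<open>g\<close> themselves beside
    their derivatives, so the induction hypothesis is also applied to them at the lower
    order.\<close>
  have "times_differentiable_on n S f" "times_differentiable_on n S g"
    using Suc.prems times_differentiable_on_mono_Suc by blast+
  then show ?case
    using Suc.prems
    by (intro times_differentiable_on_SucI[OF assms(1),
          of _ "\<lambda>x v. B (f x) (frechet_derivative g (at x) v) + B (frechet_derivative f (at x) v) (g x)"]
        bounded_bilinear.FDERIV[OF assms(2)] times_differentiable_on_add[OF assms(1)] Suc.IH)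
      (auto simp: frechet_derivative_works[symmetric])
qed

lemma times_differentiable_on_compose_linear:
  assumes "open S" "bounded_linear L" "open T" "L ` T \<subseteq> S"
  shows "times_differentiable_on n S f \<Longrightarrow> times_differentiable_on n T (\<lambda>x. f (L x))"
proof (induction n arbitrary: f)
  case 0
  have "continuous_on T L"
    by (rule linear_continuous_on[OF assms(2)])
  then show ?case
    using continuous_on_compose2[of S f T L] 0 assms(4) by simp
next
  case (Suc n)
  have "(f has_derivative frechet_derivative f (at (L x))) (at (L x))" if "x \<in> T" for x
    using Suc.prems assms(4) that by (auto simp: frechet_derivative_works[symmetric])
  then have "((\<lambda>x. f (L x)) has_derivative (\<lambda>v. frechet_derivative f (at (L x)) (L v))) (at x)"
    if "x \<in> T" for x
    by (rule has_derivative_compose[OF bounded_linear.has_derivative[OF assms(2) has_derivative_ident]])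
      (rule that)
  then show ?case
    using Suc by (intro times_differentiable_on_SucI[OF assms(3)]) auto
qed

lemma smooth_on_has_derivative:
  "smooth_on S f \<Longrightarrow> x \<in> S \<Longrightarrow> (f has_derivative frechet_derivative f (at x)) (at x)"
  using times_differentiable_on_has_derivative[of 0 S f x] unfolding smooth_on_def by blast

lemma smooth_on_frechet_derivative:
  "smooth_on S f \<Longrightarrow> smooth_on S (\<lambda>x. frechet_derivative f (at x) v)"
  unfolding smooth_on_def using times_differentiable_on.simps(2) by blast

lemma smooth_on_cong:
  "open S \<Longrightarrow> (\<And>x. x \<in> S \<Longrightarrow> f x = g x) \<Longrightarrow> smooth_on S f \<longleftrightarrow> smooth_on S g"
  unfolding smooth_on_def using times_differentiable_on_cong by blast

lemma smooth_on_const: "smooth_on S (\<lambda>_. c)"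
  by (simp add: smooth_on_def times_differentiable_on_const)

lemma smooth_on_add:
  "open S \<Longrightarrow> smooth_on S f \<Longrightarrow> smooth_on S g \<Longrightarrow> smooth_on S (\<lambda>x. f x + g x)"
  by (simp add: smooth_on_def times_differentiable_on_add)

lemma smooth_on_bilinear:
  "open S \<Longrightarrow> bounded_bilinear B \<Longrightarrow> smooth_on S f \<Longrightarrow> smooth_on S g
    \<Longrightarrow> smooth_on S (\<lambda>x. B (f x) (g x))"
  by (simp add: smooth_on_def times_differentiable_on_bilinear)

lemmas smooth_on_scaleR = smooth_on_bilinear[OF _ bounded_bilinear_scaleR]
lemmas smooth_on_mult = smooth_on_bilinear[OF _ bounded_bilinear_mult]
lemmas smooth_on_inner = smooth_on_bilinear[OF _ bounded_bilinear_inner]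

lemma smooth_on_compose_linear:
  "open S \<Longrightarrow> bounded_linear L \<Longrightarrow> open T \<Longrightarrow> L ` T \<subseteq> S \<Longrightarrow> smooth_on S f
    \<Longrightarrow> smooth_on T (\<lambda>x. f (L x))"
  by (simp add: smooth_on_def times_differentiable_on_compose_linear)

lemma smooth_on_sum:
  assumes "open S" "\<And>i. i \<in> I \<Longrightarrow> smooth_on S (f i)"
  shows "smooth_on S (\<lambda>x. \<Sum>i\<in>I. f i x)"
  using assms(2)
  by (induction I rule: infinite_finite_induct) (auto intro: smooth_on_const smooth_on_add[OF assms(1)])

lemma smooth_on_linear:
  assumes "open S" "bounded_linear L"
  shows "smooth_on S L"
  unfolding smooth_on_def
proof
  fix n
  show "times_differentiable_on n S L"
  proof (cases n)
    case 0
    then show ?thesis by (simp add: linear_continuous_on[OF assms(2)])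
  next
    case (Suc k)
    have "times_differentiable_on (Suc k) S L"
      by (rule times_differentiable_on_SucI[OF assms(1), of _ "\<lambda>_. L"])
        (auto intro: bounded_linear.has_derivative[OF assms(2) has_derivative_ident] times_differentiable_on_const)
    then show ?thesis using Suc by simp
  qed
qed

lemma smooth_on_linear_compose:
  assumes "open S" "bounded_linear L" "smooth_on S f"
  shows "smooth_on S (\<lambda>x. L (f x))"
proof -
  \<comment> \<open>\<open>L\<close> is treated as the bilinear map \<open>c *\<^sub>R L y\<close>,
    to be applied with the constant function 1.\<close>
  have "bounded_bilinear (\<lambda>(c::real) y. c *\<^sub>R L y)"
    using bounded_bilinear.comp[OF bounded_bilinear_scaleR bounded_linear_ident assms(2)] by simp
  from smooth_on_bilinear[OF assms(1) this smooth_on_const[of S 1] assms(3)] show ?thesis by simp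
qed

lemma smooth_on_Pair:
  assumes "open S" "smooth_on S f" "smooth_on S g"
  shows "smooth_on S (\<lambda>x. (f x, g x))"
proof -
  have "bounded_linear (\<lambda>x. (x, 0 :: 'c))" "bounded_linear (\<lambda>x. (0 :: 'b, x))"
    by (auto intro: bounded_linear_Pair bounded_linear_ident bounded_linear_zero)
  then have "smooth_on S (\<lambda>x. (f x, 0) + (0, g x))"
    by (intro smooth_on_add assms smooth_on_linear_compose[OF _ _ assms(2)] smooth_on_linear_compose[OF _ _ assms(3)])
  then show ?thesis by simp
qed

text \<open>Product rule for a field of linear maps that is differentiable for each fixed argument.
  Finite dimension makes this enough: expanding the argument in \<open>Basis\<close> leaves finitely
  many products of differentiable functions.\<close>

lemma linear_field_has_derivative:
  fixes \<beta> :: "'p::real_normed_vector \<Rightarrow> 'a::euclidean_space \<Rightarrow> 'b::real_normed_vector"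
  assumes S: "open S" "p \<in> S" and lin: "\<And>q. q \<in> S \<Longrightarrow> linear (\<beta> q)"
    and \<beta>: "\<And>x. ((\<lambda>q. \<beta> q x) has_derivative (\<lambda>z. \<beta>' z x)) (at p)"
    and X: "(X has_derivative X') (at p)"
  shows "((\<lambda>q. \<beta> q (X q)) has_derivative (\<lambda>z. \<beta>' z (X p) + \<beta> p (X' z))) (at p)"
proof -
  have expand: "\<beta> q x = (\<Sum>b\<in>Basis. (x \<bullet> b) *\<^sub>R \<beta> q b)" if "q \<in> S" for q x
  proof -
    have "\<beta> q x = \<beta> q (\<Sum>b\<in>Basis. (x \<bullet> b) *\<^sub>R b)"
      by (simp add: euclidean_representation)
    also have "\<dots> = (\<Sum>b\<in>Basis. (x \<bullet> b) *\<^sub>R \<beta> q b)"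
      using lin[OF that] by (simp only: linear_sum linear_cmul)
    finally show ?thesis .
  qed
  have "((\<lambda>q. \<Sum>b\<in>Basis. (x \<bullet> b) *\<^sub>R \<beta> q b) has_derivative
      (\<lambda>z. \<Sum>b\<in>Basis. (x \<bullet> b) *\<^sub>R \<beta>' z b)) (at p)" for x
    by (intro has_derivative_sum has_derivative_scaleR_right \<beta>)
  then have "((\<lambda>q. \<beta> q x) has_derivative (\<lambda>z. \<Sum>b\<in>Basis. (x \<bullet> b) *\<^sub>R \<beta>' z b)) (at p)" for x
    by (rule has_derivative_transform_within_open[OF _ S]) (simp add: expand)
  \<comment> \<open>Linearity of \<beta>' in its second argument follows from that of \<beta> by
    uniqueness of the derivative.\<close>
  then have \<beta>'_expand: "\<beta>' z x = (\<Sum>b\<in>Basis. (x \<bullet> b) *\<^sub>R \<beta>' z b)" for z x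
    using has_derivative_unique[OF \<beta>] by metis
  have "((\<lambda>q. \<Sum>b\<in>Basis. (X q \<bullet> b) *\<^sub>R \<beta> q b) has_derivative
      (\<lambda>z. \<Sum>b\<in>Basis. (X p \<bullet> b) *\<^sub>R \<beta>' z b + (X' z \<bullet> b) *\<^sub>R \<beta> p b)) (at p)"
    by (intro has_derivative_sum has_derivative_scaleR \<beta> has_derivative_inner_left X)
  then have "((\<lambda>q. \<Sum>b\<in>Basis. (X q \<bullet> b) *\<^sub>R \<beta> q b) has_derivative
      (\<lambda>z. \<beta>' z (X p) + \<beta> p (X' z))) (at p)"
    by (simp add: sum.distrib expand[OF S(2), symmetric] \<beta>'_expand[symmetric])
  then show ?thesis
    by (rule has_derivative_transform_within_open[OF _ S]) (simp add: expand)
qed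

lemma bilinear_field_has_derivative:
  fixes \<beta> :: "'p::real_normed_vector \<Rightarrow> 'a::euclidean_space \<Rightarrow> 'c::euclidean_space \<Rightarrow> 'b::real_normed_vector"
  assumes S: "open S" "p \<in> S" and bil: "\<And>q. q \<in> S \<Longrightarrow> bilinear (\<beta> q)"
    and \<beta>: "\<And>x y. ((\<lambda>q. \<beta> q x y) has_derivative (\<lambda>z. \<beta>' z x y)) (at p)"
    and X: "(X has_derivative X') (at p)" and Y: "(Y has_derivative Y') (at p)"
  shows "((\<lambda>q. \<beta> q (X q) (Y q)) has_derivative
    (\<lambda>z. \<beta>' z (X p) (Y p) + \<beta> p (X' z) (Y p) + \<beta> p (X p) (Y' z))) (at p)"
proof -
  have "((\<lambda>q. \<beta> q (X q) y) has_derivative (\<lambda>z. \<beta>' z (X p) y + \<beta> p (X' z) y)) (at p)" for y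
    by (rule linear_field_has_derivative[OF S _ \<beta> X]) (use bil in \<open>auto simp: bilinear_def\<close>)
  from linear_field_has_derivative[where \<beta> = "\<lambda>q. \<beta> q (X q)", OF S _ this Y]
  show ?thesis
    using bil by (simp add: bilinear_def)
qed

lemma linear_field_smooth:
  fixes \<beta> :: "'p::real_normed_vector \<Rightarrow> 'a::euclidean_space \<Rightarrow> 'b::real_normed_vector"
  assumes "open S" and lin: "\<And>q. q \<in> S \<Longrightarrow> linear (\<beta> q)"
    and \<beta>: "\<And>x. smooth_on S (\<lambda>q. \<beta> q x)" and X: "smooth_on S X"
  shows "smooth_on S (\<lambda>q. \<beta> q (X q))"
proof -
  have "smooth_on S (\<lambda>q. \<Sum>b\<in>Basis. (X q \<bullet> b) *\<^sub>R \<beta> q b)"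
    by (intro smooth_on_sum smooth_on_scaleR smooth_on_inner smooth_on_const assms)
  moreover have "(\<Sum>b\<in>Basis. (X q \<bullet> b) *\<^sub>R \<beta> q b) = \<beta> q (X q)" if "q \<in> S" for q
  proof -
    have "(\<Sum>b\<in>Basis. (X q \<bullet> b) *\<^sub>R \<beta> q b) = \<beta> q (\<Sum>b\<in>Basis. (X q \<bullet> b) *\<^sub>R b)"
      using lin[OF that] by (simp only: linear_sum linear_cmul)
    then show ?thesis by (simp add: euclidean_representation)
  qed
  ultimately show ?thesis
    using smooth_on_cong[OF assms(1), of "\<lambda>q. \<Sum>b\<in>Basis. (X q \<bullet> b) *\<^sub>R \<beta> q b" "\<lambda>q. \<beta> q (X q)"]
    by simp
qed

lemma bilinear_field_smooth:
  fixes \<beta> :: "'p::real_normed_vector \<Rightarrow> 'a::euclidean_space \<Rightarrow> 'c::euclidean_space \<Rightarrow> 'b::real_normed_vector"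
  assumes "open S" and bil: "\<And>q. q \<in> S \<Longrightarrow> bilinear (\<beta> q)"
    and \<beta>: "\<And>x y. smooth_on S (\<lambda>q. \<beta> q x y)" and XY: "smooth_on S X" "smooth_on S Y"
  shows "smooth_on S (\<lambda>q. \<beta> q (X q) (Y q))"
proof -
  have "smooth_on S (\<lambda>q. \<beta> q (X q) y)" for y
    by (rule linear_field_smooth[OF assms(1) _ _ XY(1)]) (use bil \<beta> in \<open>auto simp: bilinear_def\<close>)
  from linear_field_smooth[where \<beta> = "\<lambda>q. \<beta> q (X q)", OF assms(1) _ this XY(2)]
  show ?thesis
    using bil by (simp add: bilinear_def)
qed

section \<open>Symmetry of second derivatives\<close>

text \<open>The mean value theorem in direction \<open>v\<close> turns the second difference into
  \<open>t\<close> times an increment of \<open>f' q v\<close> between two points at distance O(t)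
  from \<open>p\<close>, and \<open>D\<close> evaluates this increment up to o(t). The quotient is
  symmetric in \<open>v\<close> and \<open>w\<close>, so comparing its two limits gives the symmetry
  of second derivatives.\<close>

lemma second_difference_quotient:
  fixes f :: "'a::real_normed_vector \<Rightarrow> real"
  assumes S: "open S" "p \<in> S"
    and f: "\<And>q. q \<in> S \<Longrightarrow> (f has_derivative f' q) (at q)"
    and D: "((\<lambda>q. f' q v) has_derivative D) (at p)"
  shows "((\<lambda>t. (f (p + t *\<^sub>R v + t *\<^sub>R w) - f (p + t *\<^sub>R v) - f (p + t *\<^sub>R w) + f p) / t\<^sup>2)
    \<longlongrightarrow> D w) (at_right 0)"
proof (rule tendstoI)
  fix e :: real
  assume "e > 0"
  define C where "C = 2 * (norm v + norm w) + 1"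
  have "C > 0" unfolding C_def by (intro add_nonneg_pos) auto
  have linD: "linear D" using D has_derivative_linear by blast
  \<comment> \<open>Each of the two endpoints contributes an error of at most
    \<open>e' * C * t = e * t / 4\<close>; after division by \<open>t\<close> the total
    \<open>e / 2\<close> stays strictly below \<open>e\<close>.\<close>
  define e' where "e' = e / (4 * C)"
  have "e' > 0" using \<open>e > 0\<close> \<open>C > 0\<close> by (simp add: e'_def)
  obtain d1 where d1: "d1 > 0" "\<And>q. norm (q - p) < d1 \<Longrightarrow> \<bar>f' q v - f' p v - D (q - p)\<bar> \<le> e' * norm (q - p)"
    using D \<open>e' > 0\<close> unfolding has_derivative_at_alt by (auto simp: real_norm_def)
  obtain d2 where d2: "d2 > 0" "ball p d2 \<subseteq> S"
    using S openE by blast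
  define d where "d = min d1 d2 / C"
  have "d > 0" using d1 d2 \<open>C > 0\<close> by (simp add: d_def)
  have small: "norm (\<xi> *\<^sub>R v + \<tau> *\<^sub>R w) \<le> C * t" "C * t < min d1 d2"
    if "0 \<le> \<xi>" "\<xi> \<le> t" "0 \<le> \<tau>" "\<tau> \<le> t" "t < d" for \<xi> \<tau> t
  proof -
    have "norm (\<xi> *\<^sub>R v + \<tau> *\<^sub>R w) \<le> \<xi> * norm v + \<tau> * norm w"
      using that norm_triangle_ineq[of "\<xi> *\<^sub>R v" "\<tau> *\<^sub>R w"] by simp
    also have "\<dots> \<le> t * norm v + t * norm w"
      using that by (intro add_mono mult_right_mono) auto
    also have "\<dots> \<le> C * t"
      using that by (simp add: C_def algebra_simps)
    finally show "norm (\<xi> *\<^sub>R v + \<tau> *\<^sub>R w) \<le> C * t" .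
    show "C * t < min d1 d2"
      using \<open>t < d\<close> \<open>C > 0\<close> by (simp add: d_def field_simps)
  qed
  have "dist ((f (p + t *\<^sub>R v + t *\<^sub>R w) - f (p + t *\<^sub>R v) - f (p + t *\<^sub>R w) + f p) / t\<^sup>2) (D w) < e"
    if t: "0 < t" "t < d" for t
  proof -
    have inS: "p + (\<xi> *\<^sub>R v + \<tau> *\<^sub>R w) \<in> S" if "0 \<le> \<xi>" "\<xi> \<le> t" "0 \<le> \<tau>" "\<tau> \<le> t" for \<xi> \<tau>
      using small[OF that t(2)] d2(2) by (auto simp: subset_iff dist_norm norm_minus_commute)
    define \<phi> where "\<phi> r = f (p + (r *\<^sub>R v + t *\<^sub>R w)) - f (p + (r *\<^sub>R v + 0 *\<^sub>R w))" for r
    have line: "((\<lambda>r. f (p + (r *\<^sub>R v + \<tau> *\<^sub>R w))) has_real_derivative f' (p + (r *\<^sub>R v + \<tau> *\<^sub>R w)) v) (at r)"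
      if "0 \<le> r" "r \<le> t" "0 \<le> \<tau>" "\<tau> \<le> t" for r \<tau>
    proof -
      have "((\<lambda>r. p + (r *\<^sub>R v + \<tau> *\<^sub>R w)) has_derivative (\<lambda>h. h *\<^sub>R v)) (at r)"
        by (auto intro!: derivative_eq_intros)
      from has_derivative_compose[OF this f[OF inS[OF that]]]
      have "((\<lambda>r. f (p + (r *\<^sub>R v + \<tau> *\<^sub>R w))) has_derivative (\<lambda>h. f' (p + (r *\<^sub>R v + \<tau> *\<^sub>R w)) (h *\<^sub>R v))) (at r)" .
      moreover have "linear (f' (p + (r *\<^sub>R v + \<tau> *\<^sub>R w)))"
        using f[OF inS[OF that]] has_derivative_linear by blast
      ultimately show ?thesis
        unfolding has_field_derivative_def by (simp add: linear_cmul mult.commute[of _ "f' _ v"])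
    qed
    have "\<exists>z. 0 < z \<and> z < t \<and> \<phi> t - \<phi> 0 = (t - 0) *
        (f' (p + (z *\<^sub>R v + t *\<^sub>R w)) v - f' (p + (z *\<^sub>R v + 0 *\<^sub>R w)) v)"
      unfolding \<phi>_def using t by (intro MVT2 DERIV_diff line) auto
    then obtain z where z: "0 < z" "z < t" and eq: "\<phi> t - \<phi> 0 = t *
        (f' (p + (z *\<^sub>R v + t *\<^sub>R w)) v - f' (p + (z *\<^sub>R v + 0 *\<^sub>R w)) v)"
      by auto
    have near: "\<bar>f' (p + (z *\<^sub>R v + \<tau> *\<^sub>R w)) v - f' p v - (z * D v + \<tau> * D w)\<bar> \<le> e' * (C * t)"
      if "0 \<le> \<tau>" "\<tau> \<le> t" for \<tau>
    proof -
      have "norm (z *\<^sub>R v + \<tau> *\<^sub>R w) \<le> C * t" "C * t < d1"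
        using small[of z t \<tau>] that z t by auto
      then have "\<bar>f' (p + (z *\<^sub>R v + \<tau> *\<^sub>R w)) v - f' p v - D (z *\<^sub>R v + \<tau> *\<^sub>R w)\<bar>
          \<le> e' * norm (z *\<^sub>R v + \<tau> *\<^sub>R w)"
        using d1(2)[of "p + (z *\<^sub>R v + \<tau> *\<^sub>R w)"] by simp
      also have "\<dots> \<le> e' * (C * t)"
        using \<open>norm _ \<le> C * t\<close> \<open>e' > 0\<close> by simp
      finally show ?thesis
        by (simp add: linear_add[OF linD] linear_cmul[OF linD])
    qed
    define X where "X = f' (p + (z *\<^sub>R v + t *\<^sub>R w)) v - f' (p + (z *\<^sub>R v + 0 *\<^sub>R w)) v"
    have "e' * (C * t) = e * t / 4" using \<open>C > 0\<close> by (simp add: e'_def)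
    moreover have "\<bar>X - t * D w\<bar> \<le> e' * (C * t) + e' * (C * t)"
      using near[of t] near[of 0] t unfolding X_def by linarith
    ultimately have "\<bar>X - t * D w\<bar> \<le> e / 2 * t"
      by linarith
    moreover have "X / t - D w = (X - t * D w) / t"
      using t by (simp add: field_simps)
    ultimately have "\<bar>X / t - D w\<bar> \<le> e / 2"
      using t by (simp add: field_simps)
    moreover have "f (p + t *\<^sub>R v + t *\<^sub>R w) - f (p + t *\<^sub>R v) - f (p + t *\<^sub>R w) + f p = t * X"
      using eq by (simp add: \<phi>_def X_def algebra_simps)
    ultimately show ?thesis
      using \<open>e > 0\<close> t by (simp add: dist_real_def power2_eq_square)
  qed
  then show "\<forall>\<^sub>F t in at_right 0. dist ((f (p + t *\<^sub>R v + t *\<^sub>R w) - f (p + t *\<^sub>R v) - f (p + t *\<^sub>R w) + f p) / t\<^sup>2) (D w) < e"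
    unfolding eventually_at_right_field using \<open>d > 0\<close> by blast
qed
lemma symmetric_second_derivative_real:
  fixes f :: "'a::real_normed_vector \<Rightarrow> real"
  assumes S: "open S" "p \<in> S"
    and f: "\<And>q. q \<in> S \<Longrightarrow> (f has_derivative f' q) (at q)"
    and D: "((\<lambda>q. f' q v) has_derivative D) (at p)"
    and E: "((\<lambda>q. f' q w) has_derivative E) (at p)"
  shows "D w = E v"
proof (rule tendsto_unique[OF _ second_difference_quotient[OF S f D]])
  show "((\<lambda>t. (f (p + t *\<^sub>R v + t *\<^sub>R w) - f (p + t *\<^sub>R v) - f (p + t *\<^sub>R w) + f p) / t\<^sup>2)
    \<longlongrightarrow> E v) (at_right 0)"
    using second_difference_quotient[OF S f E, of v] by (simp add: algebra_simps)
qed auto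

lemma symmetric_second_derivative:
  fixes f :: "'a::real_normed_vector \<Rightarrow> 'b::euclidean_space"
  assumes S: "open S" "p \<in> S"
    and f: "\<And>q. q \<in> S \<Longrightarrow> (f has_derivative f' q) (at q)"
    and D: "((\<lambda>q. f' q v) has_derivative D) (at p)"
    and E: "((\<lambda>q. f' q w) has_derivative E) (at p)"
  shows "D w = E v"
proof (rule euclidean_eqI)
  fix b :: 'b
  show "D w \<bullet> b = E v \<bullet> b"
    by (rule symmetric_second_derivative_real[OF S has_derivative_inner_left[OF f]
          has_derivative_inner_left[OF D] has_derivative_inner_left[OF E]])
qed

section \<open>Levi-Civita connection and curvature in a chart\<close>

text \<open>Alternating the two transpositions six times returns to \<open>t x y z\<close> with an
  odd number of sign changes. The same argument gives the uniqueness of the Levi-Civita connection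
  and the fact that isometries preserve it.\<close>

lemma symmetric_antisymmetric_zero:
  fixes t :: "'a \<Rightarrow> 'a \<Rightarrow> 'a \<Rightarrow> real"
  assumes "\<And>x y z. t x y z = t y x z" "\<And>x y z. t x y z = - t x z y"
  shows "t x y z = 0"
  using assms(1)[of x y z] assms(2)[of y x z] assms(1)[of y z x] assms(2)[of z y x]
    assms(1)[of z x y] assms(2)[of x z y] by linarith

lemma is_levi_civita_metric:
  assumes "is_levi_civita M g nabla" "smooth_on M X" "smooth_on M Y" "smooth_on M Z" "p \<in> M"
  shows "frechet_derivative (\<lambda>q. g q (Y q) (Z q)) (at p) (X p) =
    g p (nabla X Y p) (Z p) + g p (Y p) (nabla X Z p)"
  using assms by (simp add: is_levi_civita_def)

text \<open>The difference of the two connections is symmetric because both are torsion free, and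
  skew in its last two slots because both are metric.\<close>

lemma is_levi_civita_unique:
  assumes pr: "pseudo_riemannian M g"
    and lc: "is_levi_civita M g nabla" "is_levi_civita M g nabla'"
    and sm: "smooth_on M X" "smooth_on M Y" and p: "p \<in> M"
  shows "nabla X Y p = nabla' X Y p"
proof -
  have bil: "bilinear (g p)" and sym: "g p x y = g p y x" for x y
    using pr p by (auto simp: pseudo_riemannian_def)
  define T where "T X Y = nabla X Y p - nabla' X Y p" for X Y
  \<comment> \<open>Torsion and metric conditions hold for smooth fields only; the value 0 elsewhere
    makes the two symmetries hold for all arguments.\<close>
  define t where "t A B C = (if smooth_on M A \<and> smooth_on M B \<and> smooth_on M C then g p (T A B) (C p) else 0)"
    for A B C
  have T_sym: "T A B = T B A" if "smooth_on M A" "smooth_on M B" for A B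
  proof -
    have "nabla A B p - nabla B A p = nabla' A B p - nabla' B A p"
      using lc that p by (simp add: is_levi_civita_def)
    then show ?thesis by (simp add: T_def algebra_simps)
  qed
  have T_anti: "g p (T A B) (C p) = - g p (T A C) (B p)"
    if "smooth_on M A" "smooth_on M B" "smooth_on M C" for A B C
  proof -
    have "g p (nabla A B p) (C p) + g p (B p) (nabla A C p) =
        g p (nabla' A B p) (C p) + g p (B p) (nabla' A C p)"
      by (simp flip: is_levi_civita_metric[OF lc(1) that p] is_levi_civita_metric[OF lc(2) that p])
    then show ?thesis
      by (simp add: T_def bilinear_lsub[OF bil] sym[of "B p"])
  qed
  have "t A B C = t B A C" for A B C
    using T_sym[of A B] by (auto simp: t_def)
  moreover have "t A B C = - t A C B" for A B C
    using T_anti[of A B C] by (auto simp: t_def)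
  ultimately have "t X Y (\<lambda>_. z) = 0" for z
    by (rule symmetric_antisymmetric_zero[of t])
  then have "g p (T X Y) z = 0" for z
    using sm by (simp add: t_def smooth_on_const)
  then have "T X Y = 0"
    using pr p by (auto simp: pseudo_riemannian_def)
  then show ?thesis by (simp add: T_def)
qed

text \<open>Conditions certifying a given candidate for the Christoffel symbols, so that no Koszul
  formula or inverse metric is computed. Metric compatibility is required for constant fields only;
  the product rule extends it to all smooth ones.\<close>

locale christoffel_chart =
  fixes M :: "'a::euclidean_space set" and g :: "'a \<Rightarrow> 'a \<Rightarrow> 'a \<Rightarrow> real"
    and \<Gamma> :: "'a \<Rightarrow> 'a \<Rightarrow> 'a \<Rightarrow> 'a"
  assumes pr: "pseudo_riemannian M g"
    and bilinear_\<Gamma>: "p \<in> M \<Longrightarrow> bilinear (\<Gamma> p)"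
    and \<Gamma>_commute: "p \<in> M \<Longrightarrow> \<Gamma> p x y = \<Gamma> p y x"
    and smooth_\<Gamma>: "smooth_on M (\<lambda>p. \<Gamma> p x y)"
    and metric_derivative: "p \<in> M \<Longrightarrow>
      frechet_derivative (\<lambda>q. g q x y) (at p) z = g p (\<Gamma> p z x) y + g p x (\<Gamma> p z y)"
begin

lemma open_M: "open M" and smooth_g: "smooth_on M (\<lambda>p. g p x y)"
  and bilinear_g: "p \<in> M \<Longrightarrow> bilinear (g p)" and g_commute: "p \<in> M \<Longrightarrow> g p x y = g p y x"
  and g_nondegenerate: "p \<in> M \<Longrightarrow> (\<And>y. g p x y = 0) \<Longrightarrow> x = 0"
  using pr by (auto simp: pseudo_riemannian_def)

lemma g_has_derivative:
  assumes "p \<in> M"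
  shows "((\<lambda>q. g q x y) has_derivative (\<lambda>z. g p (\<Gamma> p z x) y + g p x (\<Gamma> p z y))) (at p)"
proof -
  have "frechet_derivative (\<lambda>q. g q x y) (at p) = (\<lambda>z. g p (\<Gamma> p z x) y + g p x (\<Gamma> p z y))"
    using metric_derivative[OF assms] by blast
  then show ?thesis
    using smooth_on_has_derivative[OF smooth_g assms, of x y] by simp
qed

lemma \<Gamma>_has_derivative:
  assumes "p \<in> M"
  shows "((\<lambda>q. \<Gamma> q x y) has_derivative frechet_derivative (\<lambda>q. \<Gamma> q x y) (at p)) (at p)"
  by (rule smooth_on_has_derivative[OF smooth_\<Gamma> assms])

definition chart_nabla :: "('a \<Rightarrow> 'a) \<Rightarrow> ('a \<Rightarrow> 'a) \<Rightarrow> 'a \<Rightarrow> 'a" where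
  "chart_nabla X Y p = frechet_derivative Y (at p) (X p) + \<Gamma> p (X p) (Y p)"

lemma smooth_chart_nabla:
  assumes "smooth_on M X" "smooth_on M Y"
  shows "smooth_on M (chart_nabla X Y)"
  unfolding chart_nabla_def
proof (rule smooth_on_add[OF open_M])
  show "smooth_on M (\<lambda>p. frechet_derivative Y (at p) (X p))"
    by (rule linear_field_smooth[OF open_M _ smooth_on_frechet_derivative[OF assms(2)] assms(1)])
      (rule has_derivative_linear[OF smooth_on_has_derivative[OF assms(2)]])
  show "smooth_on M (\<lambda>p. \<Gamma> p (X p) (Y p))"
    by (rule bilinear_field_smooth[OF open_M bilinear_\<Gamma> smooth_\<Gamma> assms])
qed

lemma chart_nabla_affine: "affine_connection M chart_nabla"
  unfolding affine_connection_def
proof (intro conjI allI impI ballI smooth_chart_nabla)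
  fix X X' Y :: "'a \<Rightarrow> 'a" and p assume sm: "smooth_on M X" "smooth_on M X'" "smooth_on M Y" and p: "p \<in> M"
  have "linear (frechet_derivative Y (at p))"
    by (rule has_derivative_linear[OF smooth_on_has_derivative[OF sm(3) p]])
  then show "chart_nabla (\<lambda>q. X q + X' q) Y p = chart_nabla X Y p + chart_nabla X' Y p"
    by (simp add: chart_nabla_def linear_add bilinear_ladd[OF bilinear_\<Gamma>[OF p]])
next
  fix \<phi> :: "'a \<Rightarrow> real" and X Y :: "'a \<Rightarrow> 'a" and p assume sm: "smooth_on M \<phi>" "smooth_on M X" "smooth_on M Y" and p: "p \<in> M"
  have "linear (frechet_derivative Y (at p))"
    by (rule has_derivative_linear[OF smooth_on_has_derivative[OF sm(3) p]])
  then show "chart_nabla (\<lambda>q. \<phi> q *\<^sub>R X q) Y p = \<phi> p *\<^sub>R chart_nabla X Y p"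
    by (simp add: chart_nabla_def linear_cmul bilinear_lmul[OF bilinear_\<Gamma>[OF p]] scaleR_add_right)
next
  fix X Y Y' :: "'a \<Rightarrow> 'a" and p assume sm: "smooth_on M X" "smooth_on M Y" "smooth_on M Y'" and p: "p \<in> M"
  have "frechet_derivative (\<lambda>q. Y q + Y' q) (at p) =
      (\<lambda>z. frechet_derivative Y (at p) z + frechet_derivative Y' (at p) z)"
    using frechet_derivative_at[OF has_derivative_add[OF smooth_on_has_derivative[OF sm(2) p]
          smooth_on_has_derivative[OF sm(3) p]]] by simp
  then show "chart_nabla X (\<lambda>q. Y q + Y' q) p = chart_nabla X Y p + chart_nabla X Y' p"
    by (simp add: chart_nabla_def bilinear_radd[OF bilinear_\<Gamma>[OF p]])
next
  fix \<phi> :: "'a \<Rightarrow> real" and X Y :: "'a \<Rightarrow> 'a" and p assume sm: "smooth_on M \<phi>" "smooth_on M X" "smooth_on M Y" and p: "p \<in> M"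
  have "frechet_derivative (\<lambda>q. \<phi> q *\<^sub>R Y q) (at p) =
      (\<lambda>z. \<phi> p *\<^sub>R frechet_derivative Y (at p) z + frechet_derivative \<phi> (at p) z *\<^sub>R Y p)"
    using frechet_derivative_at[OF has_derivative_scaleR[OF smooth_on_has_derivative[OF sm(1) p]
          smooth_on_has_derivative[OF sm(3) p]]] by simp
  then show "chart_nabla X (\<lambda>q. \<phi> q *\<^sub>R Y q) p =
      frechet_derivative \<phi> (at p) (X p) *\<^sub>R Y p + \<phi> p *\<^sub>R chart_nabla X Y p"
    by (simp add: chart_nabla_def bilinear_rmul[OF bilinear_\<Gamma>[OF p]] scaleR_add_right)
qed

lemma chart_nabla_levi_civita: "is_levi_civita M g chart_nabla"
  unfolding is_levi_civita_def
proof (intro conjI allI impI ballI chart_nabla_affine)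
  fix X Y p assume "p \<in> M"
  then show "chart_nabla X Y p - chart_nabla Y X p = lie_bracket X Y p"
    using \<Gamma>_commute[of p "X p" "Y p"] by (simp add: chart_nabla_def lie_bracket_def)
next
  fix X Y Z :: "'a \<Rightarrow> 'a" and p assume sm: "smooth_on M X" "smooth_on M Y" "smooth_on M Z" and p: "p \<in> M"
  have d: "((\<lambda>q. g q (Y q) (Z q)) has_derivative
      (\<lambda>z. (g p (\<Gamma> p z (Y p)) (Z p) + g p (Y p) (\<Gamma> p z (Z p)))
        + g p (frechet_derivative Y (at p) z) (Z p) + g p (Y p) (frechet_derivative Z (at p) z))) (at p)"
    by (rule bilinear_field_has_derivative[OF open_M p])
      (auto intro: bilinear_g g_has_derivative[OF p] smooth_on_has_derivative sm p)
  show "frechet_derivative (\<lambda>q. g q (Y q) (Z q)) (at p) (X p) =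
      g p (chart_nabla X Y p) (Z p) + g p (Y p) (chart_nabla X Z p)"
    unfolding frechet_derivative_at[OF d, symmetric]
    by (simp add: chart_nabla_def bilinear_ladd[OF bilinear_g[OF p]] bilinear_radd[OF bilinear_g[OF p]])
qed

text \<open>\<open>chart_nabla\<close> is a witness for the choice in \<open>levi_civita\<close>,
  and uniqueness identifies the chosen connection with it, on \<open>M\<close> and for smooth
  fields.\<close>

lemma levi_civita_eq:
  assumes "smooth_on M X" "smooth_on M Y" "p \<in> M"
  shows "levi_civita M g X Y p = chart_nabla X Y p"
proof -
  have "is_levi_civita M g (levi_civita M g)"
    unfolding levi_civita_def by (rule someI[of "is_levi_civita M g"]) (rule chart_nabla_levi_civita)
  then show ?thesis
    using is_levi_civita_unique[OF pr _ chart_nabla_levi_civita assms] by blast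
qed

lemma levi_civita_constants:
  assumes "p \<in> M"
  shows "levi_civita M g (\<lambda>_. x) (\<lambda>_. y) p = \<Gamma> p x y"
  using levi_civita_eq[OF smooth_on_const smooth_on_const assms]
  by (simp add: chart_nabla_def frechet_derivative_const)

lemma curvature_eq:
  assumes p: "p \<in> M"
  shows "curvature M g p x y z = frechet_derivative (\<lambda>q. \<Gamma> q y z) (at p) x
    - frechet_derivative (\<lambda>q. \<Gamma> q x z) (at p) y + \<Gamma> p x (\<Gamma> p y z) - \<Gamma> p y (\<Gamma> p x z)"
proof -
  have second: "levi_civita M g (\<lambda>_. a) (levi_civita M g (\<lambda>_. b) (\<lambda>_. c)) p =
      frechet_derivative (\<lambda>q. \<Gamma> q b c) (at p) a + \<Gamma> p a (\<Gamma> p b c)" for a b c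
  proof -
    let ?W = "levi_civita M g (\<lambda>_. b) (\<lambda>_. c)"
    have "smooth_on M ?W"
      using smooth_on_cong[OF open_M, of ?W "\<lambda>q. \<Gamma> q b c"] smooth_\<Gamma> by (simp add: levi_civita_constants)
    \<comment> \<open>The inner field is known only on \<open>M\<close>; openness of
      \<open>M\<close> lets its derivative be computed from \<Gamma>.\<close>
    moreover have "(?W has_derivative frechet_derivative (\<lambda>q. \<Gamma> q b c) (at p)) (at p)"
      by (rule has_derivative_transform_within_open[OF \<Gamma>_has_derivative[OF p] open_M p])
        (simp add: levi_civita_constants)
    ultimately show ?thesis
      using levi_civita_eq[OF smooth_on_const _ p] frechet_derivative_at
      by (metis chart_nabla_def levi_civita_constants[OF p])
  qed
  have "lie_bracket (\<lambda>_. x) (\<lambda>_. y) = (\<lambda>_. 0)"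
    by (simp add: lie_bracket_def frechet_derivative_const fun_eq_iff)
  then have "levi_civita M g (lie_bracket (\<lambda>_. x) (\<lambda>_. y)) (\<lambda>_. z) p = 0"
    by (simp add: levi_civita_constants[OF p] bilinear_lzero[OF bilinear_\<Gamma>[OF p]])
  then show ?thesis
    by (simp add: curvature_def curvature_field_def second)
qed

end

section \<open>Isometries preserve curvature\<close>

locale chart_isometry = christoffel_chart +
  fixes A :: "'a set" and \<psi> :: "'a \<Rightarrow> 'a"
  assumes open_A: "open A" and A_subset: "A \<subseteq> M" and image_\<psi>: "p \<in> A \<Longrightarrow> \<psi> p \<in> M"
    and smooth_\<psi>: "smooth_on A \<psi>"
    and isometry: "p \<in> A \<Longrightarrow> g (\<psi> p) (frechet_derivative \<psi> (at p) x) (frechet_derivative \<psi> (at p) y) = g p x y"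
begin

definition d\<psi> :: "'a \<Rightarrow> 'a \<Rightarrow> 'a" where
  "d\<psi> p = frechet_derivative \<psi> (at p)"

definition dd\<psi> :: "'a \<Rightarrow> 'a \<Rightarrow> 'a \<Rightarrow> 'a" where
  "dd\<psi> p x y = frechet_derivative (\<lambda>q. d\<psi> q y) (at p) x"

lemma A_M: "p \<in> A \<Longrightarrow> p \<in> M"
  using A_subset by blast

lemma \<psi>_has_derivative: "p \<in> A \<Longrightarrow> (\<psi> has_derivative d\<psi> p) (at p)"
  unfolding d\<psi>_def by (rule smooth_on_has_derivative[OF smooth_\<psi>])

lemma smooth_d\<psi>: "smooth_on A (\<lambda>q. d\<psi> q y)"
  unfolding d\<psi>_def by (rule smooth_on_frechet_derivative[OF smooth_\<psi>])

lemma d\<psi>_has_derivative: "p \<in> A \<Longrightarrow> ((\<lambda>q. d\<psi> q y) has_derivative (\<lambda>x. dd\<psi> p x y)) (at p)"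
  unfolding dd\<psi>_def using smooth_on_has_derivative[OF smooth_d\<psi>] by simp

lemma smooth_dd\<psi>: "smooth_on A (\<lambda>q. dd\<psi> q x y)"
  unfolding dd\<psi>_def by (rule smooth_on_frechet_derivative[OF smooth_d\<psi>])

lemma dd\<psi>_has_derivative:
  "p \<in> A \<Longrightarrow> ((\<lambda>q. dd\<psi> q x y) has_derivative frechet_derivative (\<lambda>q. dd\<psi> q x y) (at p)) (at p)"
  by (rule smooth_on_has_derivative[OF smooth_dd\<psi>])

lemma linear_d\<psi>: "p \<in> A \<Longrightarrow> linear (d\<psi> p)"
  using \<psi>_has_derivative has_derivative_linear by blast

lemma g_d\<psi>: "p \<in> A \<Longrightarrow> g (\<psi> p) (d\<psi> p x) (d\<psi> p y) = g p x y"
  by (simp add: d\<psi>_def isometry)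

lemma inj_d\<psi>:
  assumes "p \<in> A"
  shows "inj (d\<psi> p)"
proof -
  have "x = 0" if "d\<psi> p x = 0" for x
    using g_d\<psi>[OF assms, of x] that bilinear_lzero[OF bilinear_g[OF image_\<psi>[OF assms]]]
    by (intro g_nondegenerate[OF A_M[OF assms]]) metis
  then show ?thesis
    by (simp add: linear_injective_0[OF linear_d\<psi>[OF assms]])
qed

lemma surj_d\<psi>: "p \<in> A \<Longrightarrow> surj (d\<psi> p)"
  by (rule linear_injective_imp_surjective[OF linear_d\<psi> inj_d\<psi>]) simp_all

lemma dd\<psi>_commute:
  assumes "p \<in> A"
  shows "dd\<psi> p x y = dd\<psi> p y x"
  by (rule symmetric_second_derivative[OF open_A assms \<psi>_has_derivative])
    (auto intro: d\<psi>_has_derivative assms)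

lemma has_derivative_along_\<psi>:
  assumes "p \<in> A" "(h has_derivative h') (at (\<psi> p))"
  shows "((\<lambda>q. h (\<psi> q)) has_derivative (\<lambda>z. h' (d\<psi> p z))) (at p)"
  using has_derivative_compose[OF \<psi>_has_derivative assms(2)] assms(1) by blast

text \<open>Transformation law of the Christoffel symbols. Its defect \<open>T\<close> is symmetric,
  since second derivatives commute, and skew with respect to the metric, by differentiating the
  isometry equation; hence it vanishes.\<close>

lemma dd\<psi>_eq:
  assumes p: "p \<in> A"
  shows "dd\<psi> p x y = d\<psi> p (\<Gamma> p x y) - \<Gamma> (\<psi> p) (d\<psi> p x) (d\<psi> p y)"
proof -
  let ?g = "g (\<psi> p)" and ?L = "d\<psi> p"
  note bil = bilinear_g[OF image_\<psi>[OF p]]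
  define T where "T x y = dd\<psi> p x y + \<Gamma> (\<psi> p) (?L x) (?L y) - ?L (\<Gamma> p x y)" for x y
  have "((\<lambda>q. g (\<psi> q) (d\<psi> q x) (d\<psi> q y)) has_derivative
    (\<lambda>z. (?g (\<Gamma> (\<psi> p) (?L z) (?L x)) (?L y) + ?g (?L x) (\<Gamma> (\<psi> p) (?L z) (?L y)))
      + ?g (dd\<psi> p z x) (?L y) + ?g (?L x) (dd\<psi> p z y))) (at p)" for x y
    by (rule bilinear_field_has_derivative[where \<beta> = "\<lambda>q. g (\<psi> q)", OF open_A p])
      (use p in \<open>auto intro!: bilinear_g image_\<psi> has_derivative_along_\<psi> d\<psi>_has_derivative
        has_derivative_along_\<psi>[OF p g_has_derivative]\<close>)
  then have pulled: "((\<lambda>q. g q x y) has_derivative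
    (\<lambda>z. (?g (\<Gamma> (\<psi> p) (?L z) (?L x)) (?L y) + ?g (?L x) (\<Gamma> (\<psi> p) (?L z) (?L y)))
      + ?g (dd\<psi> p z x) (?L y) + ?g (?L x) (dd\<psi> p z y))) (at p)" for x y
    by (rule has_derivative_transform_within_open[OF _ open_A p]) (simp add: g_d\<psi>)
  have eq: "?g (\<Gamma> (\<psi> p) (?L z) (?L x)) (?L y) + ?g (?L x) (\<Gamma> (\<psi> p) (?L z) (?L y))
      + ?g (dd\<psi> p z x) (?L y) + ?g (?L x) (dd\<psi> p z y)
    = ?g (?L (\<Gamma> p z x)) (?L y) + ?g (?L x) (?L (\<Gamma> p z y))" for x y z
    using fun_cong[OF has_derivative_unique[OF pulled[of x y] g_has_derivative[OF A_M[OF p], of x y]], of z]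
    by (simp add: g_d\<psi>[OF p])
  have anti: "?g (T x y) (?L z) = - ?g (T x z) (?L y)" for x y z
    using eq[of x y z] g_commute[OF image_\<psi>[OF p], of "?L y" "\<Gamma> (\<psi> p) (?L x) (?L z)"]
      g_commute[OF image_\<psi>[OF p], of "?L y" "dd\<psi> p x z"]
      g_commute[OF image_\<psi>[OF p], of "?L y" "?L (\<Gamma> p x z)"]
    by (simp add: T_def bilinear_ladd[OF bil] bilinear_lsub[OF bil])
  have sym: "?g (T x z) (?L y) = ?g (T z x) (?L y)" for x y z
    using dd\<psi>_commute[OF p, of x z] \<Gamma>_commute[OF A_M[OF p], of x z]
      \<Gamma>_commute[OF image_\<psi>[OF p], of "?L x" "?L z"] by (simp add: T_def)
  have "?g (T x y) (?L z) = 0" for z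
    by (rule symmetric_antisymmetric_zero[of "\<lambda>x y z. ?g (T x y) (?L z)", OF sym anti])
  then have "?g (T x y) z = 0" for z
    using surj_d\<psi>[OF p] by (metis surjD)
  then have "T x y = 0"
    by (rule g_nondegenerate[OF image_\<psi>[OF p]])
  then show ?thesis
    by (simp add: T_def algebra_simps)
qed

text \<open>Integrability condition of \<open>dd\<psi>_eq\<close>: differentiating that law once
  more expresses the third derivatives of \<psi> by \<Gamma>, and their symmetry is exactly the
  invariance of the curvature.\<close>

lemma curvature_d\<psi>:
  assumes p: "p \<in> A"
  shows "d\<psi> p (curvature M g p x y z) = curvature M g (\<psi> p) (d\<psi> p x) (d\<psi> p y) (d\<psi> p z)"
proof -
  let ?L = "d\<psi> p" and ?\<Gamma> = "\<Gamma> (\<psi> p)"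
  define D where "D w x y = frechet_derivative (\<lambda>q. \<Gamma> q x y) (at p) w" for w x y
  define E where "E w x y = frechet_derivative (\<lambda>q. \<Gamma> q x y) (at (\<psi> p)) w" for w x y
  note lin = linear_d\<psi>[OF p] and bil = bilinear_\<Gamma>[OF image_\<psi>[OF p]]
  have third: "frechet_derivative (\<lambda>q. dd\<psi> q x y) (at p) w =
      dd\<psi> p w (\<Gamma> p x y) + ?L (D w x y)
      - (E (?L w) (?L x) (?L y) + ?\<Gamma> (dd\<psi> p w x) (?L y) + ?\<Gamma> (?L x) (dd\<psi> p w y))" for w x y
  proof -
    have "((\<lambda>q. d\<psi> q (\<Gamma> q x y)) has_derivative (\<lambda>w. dd\<psi> p w (\<Gamma> p x y) + ?L (D w x y))) (at p)"
      unfolding D_def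
      by (rule linear_field_has_derivative[OF open_A p])
        (auto intro: linear_d\<psi> d\<psi>_has_derivative[OF p] \<Gamma>_has_derivative[OF A_M[OF p]])
    moreover have "((\<lambda>q. \<Gamma> (\<psi> q) (d\<psi> q x) (d\<psi> q y)) has_derivative (\<lambda>w.
        E (?L w) (?L x) (?L y) + ?\<Gamma> (dd\<psi> p w x) (?L y) + ?\<Gamma> (?L x) (dd\<psi> p w y))) (at p)"
      unfolding E_def
      by (rule bilinear_field_has_derivative[where \<beta> = "\<lambda>q. \<Gamma> (\<psi> q)", OF open_A p])
        (use p in \<open>auto intro!: bilinear_\<Gamma> image_\<psi> has_derivative_along_\<psi>[OF p] d\<psi>_has_derivative
          \<Gamma>_has_derivative\<close>)
    ultimately have "((\<lambda>q. d\<psi> q (\<Gamma> q x y) - \<Gamma> (\<psi> q) (d\<psi> q x) (d\<psi> q y)) has_derivative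
      (\<lambda>w. dd\<psi> p w (\<Gamma> p x y) + ?L (D w x y)
      - (E (?L w) (?L x) (?L y) + ?\<Gamma> (dd\<psi> p w x) (?L y) + ?\<Gamma> (?L x) (dd\<psi> p w y)))) (at p)"
      by (rule has_derivative_diff)
    then have "((\<lambda>q. dd\<psi> q x y) has_derivative
      (\<lambda>w. dd\<psi> p w (\<Gamma> p x y) + ?L (D w x y)
      - (E (?L w) (?L x) (?L y) + ?\<Gamma> (dd\<psi> p w x) (?L y) + ?\<Gamma> (?L x) (dd\<psi> p w y)))) (at p)"
      by (rule has_derivative_transform_within_open[OF _ open_A p]) (simp add: dd\<psi>_eq)
    from has_derivative_unique[OF dd\<psi>_has_derivative[OF p] this] show ?thesis
      by (rule fun_cong)
  qed
  have "frechet_derivative (\<lambda>q. dd\<psi> q x z) (at p) y = frechet_derivative (\<lambda>q. dd\<psi> q y z) (at p) x"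
    by (rule symmetric_second_derivative[OF open_A p d\<psi>_has_derivative])
      (auto intro: dd\<psi>_has_derivative[OF p])
  moreover have "dd\<psi> p x y = dd\<psi> p y x"
    by (rule dd\<psi>_commute[OF p])
  ultimately show ?thesis
    unfolding third curvature_eq[OF A_M[OF p]] curvature_eq[OF image_\<psi>[OF p]]
    unfolding D_def[symmetric] E_def[symmetric]
    by (simp add: dd\<psi>_eq[OF p, of _ "\<Gamma> p _ _"] dd\<psi>_eq[OF p, of _ z] linear_add[OF lin] linear_diff[OF lin] bilinear_rsub[OF bil] algebra_simps)
qed

end

section \<open>Jordan normal forms of operators\<close>

notation scalar_prod (infix \<open>\<cdot>\<close> 70)

lemma basis_list: "distinct (basis_list :: 'a::euclidean_space list)" "set (basis_list :: 'a list) = Basis"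
proof -
  have "\<exists>bs. distinct bs \<and> set bs = (Basis :: 'a set)"
    using finite_distinct_list[OF finite_Basis] by blast
  then have "distinct (basis_list :: 'a list) \<and> set (basis_list :: 'a list) = Basis"
    unfolding basis_list_def by (rule someI_ex)
  then show "distinct (basis_list :: 'a list)" "set (basis_list :: 'a list) = Basis" by auto
qed

lemma length_basis_list: "length (basis_list :: 'a::euclidean_space list) = DIM('a)"
  using distinct_card[OF basis_list(1)] basis_list(2) by metis

lemma basis_list_nth: "i < DIM('a) \<Longrightarrow> (basis_list :: 'a::euclidean_space list) ! i \<in> Basis"
  using nth_mem[of i "basis_list :: 'a list"] by (simp add: basis_list(2) length_basis_list)

lemma inner_basis_list:
  assumes "i < DIM('a)" "j < DIM('a)"
  shows "(basis_list :: 'a::euclidean_space list) ! i \<bullet> basis_list ! j = (if i = j then 1 else 0)"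
  using assms nth_eq_iff_index_eq[of "basis_list :: 'a list" i j] basis_list(1)[where 'a = 'a]
  by (simp add: inner_Basis basis_list_nth length_basis_list)

lemma sum_basis_list:
  "(\<Sum>k = 0..<DIM('a). f (basis_list ! k)) = (\<Sum>b\<in>(Basis :: 'a::euclidean_space set). f b)"
  using sum.reindex_bij_betw[OF bij_betw_nth[OF basis_list(1), of "{0..<DIM('a)}" "Basis :: 'a set"], of f]
  by (simp add: length_basis_list basis_list(2) lessThan_atLeast0)

lemma operator_matrix_carrier [simp]:
  "operator_matrix (A :: 'a::euclidean_space \<Rightarrow> 'a) \<in> carrier_mat DIM('a) DIM('a)"
  by (simp add: operator_matrix_def)

lemma operator_matrix_dim [simp]:
  "dim_row (operator_matrix (A :: 'a::euclidean_space \<Rightarrow> 'a)) = DIM('a)"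
  "dim_col (operator_matrix A) = DIM('a)"
  by (simp_all add: operator_matrix_def)

lemma operator_matrix_index:
  fixes A :: "'a::euclidean_space \<Rightarrow> 'a"
  shows "i < DIM('a) \<Longrightarrow> j < DIM('a) \<Longrightarrow>
    operator_matrix A $$ (i, j) = complex_of_real (A (basis_list ! j) \<bullet> basis_list ! i)"
  by (simp add: operator_matrix_def)

lemma operator_matrix_compose:
  fixes A :: "'a::euclidean_space \<Rightarrow> 'a"
  assumes "linear A"
  shows "operator_matrix (\<lambda>x. A (B x)) = operator_matrix A * operator_matrix B"
proof (rule eq_matI)
  fix i j
  assume "i < dim_row (operator_matrix A * operator_matrix B)"
    and "j < dim_col (operator_matrix A * operator_matrix B)"
  then have ij: "i < DIM('a)" "j < DIM('a)" by auto
  let ?b = "basis_list :: 'a list"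
  have "A (B (?b ! j)) = A (\<Sum>b\<in>Basis. (B (?b ! j) \<bullet> b) *\<^sub>R b)"
    by (simp add: euclidean_representation)
  also have "\<dots> = (\<Sum>b\<in>Basis. (B (?b ! j) \<bullet> b) *\<^sub>R A b)"
    using assms by (simp only: linear_sum linear_cmul)
  finally have "A (B (?b ! j)) \<bullet> ?b ! i = (\<Sum>b\<in>Basis. (B (?b ! j) \<bullet> b) * (A b \<bullet> ?b ! i))"
    by (simp add: inner_sum_left)
  also have "\<dots> = (\<Sum>k = 0..<DIM('a). (A (?b ! k) \<bullet> ?b ! i) * (B (?b ! j) \<bullet> ?b ! k))"
    using sum_basis_list[of "\<lambda>b. (B (?b ! j) \<bullet> b) * (A b \<bullet> ?b ! i)"] by (simp add: mult.commute)
  finally show "operator_matrix (\<lambda>x. A (B x)) $$ (i, j) = (operator_matrix A * operator_matrix B) $$ (i, j)"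
    using ij by (simp add: operator_matrix_index scalar_prod_def)
qed (simp_all add: operator_matrix_def)

lemma operator_matrix_add:
  "operator_matrix (\<lambda>x. A x + B x) = operator_matrix A + operator_matrix B"
  by (rule eq_matI) (simp_all add: operator_matrix_index inner_add_left)

lemma operator_matrix_id: "operator_matrix (\<lambda>x :: 'a::euclidean_space. x) = 1\<^sub>m DIM('a)"
  by (rule eq_matI) (auto simp: operator_matrix_index inner_basis_list)

lemma operator_matrix_zero:
  "operator_matrix (\<lambda>_ :: 'a::euclidean_space. 0) = 0\<^sub>m DIM('a) DIM('a)"
  by (rule eq_matI) (auto simp: operator_matrix_index)

lemma operator_matrix_eq_zeroD:
  fixes A :: "'a::euclidean_space \<Rightarrow> 'a"
  assumes "linear A" "operator_matrix A = 0\<^sub>m DIM('a) DIM('a)"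
  shows "A x = 0"
proof -
  have "A b = 0" if "b \<in> Basis" for b
  proof (rule euclidean_eqI)
    fix c :: 'a
    assume "c \<in> Basis"
    with that obtain i j where "i < DIM('a)" "j < DIM('a)" "b = basis_list ! j" "c = basis_list ! i"
      by (metis basis_list(2) in_set_conv_nth length_basis_list)
    then show "A b \<bullet> c = 0 \<bullet> c"
      using operator_matrix_index[of i j A] assms(2) by simp
  qed
  then show ?thesis
    using linear_eq_stdbasis[OF assms(1) linear_zero] by auto
qed

definition conjugate_operators :: "('a::euclidean_space \<Rightarrow> 'a) \<Rightarrow> ('a \<Rightarrow> 'a) \<Rightarrow> bool" where
  "conjugate_operators A B \<longleftrightarrow> (\<exists>L. linear L \<and> bij L \<and> (\<forall>x. L (A x) = B (L x)))"

lemma conjugate_operators_similar: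
  fixes A B :: "'a::euclidean_space \<Rightarrow> 'a"
  assumes "linear B" "conjugate_operators A B"
  shows "similar_mat (operator_matrix A) (operator_matrix B)"
proof -
  obtain L where L: "linear L" "bij L" "\<And>x. L (A x) = B (L x)"
    using assms(2) by (auto simp: conjugate_operators_def)
  define K where "K = inv_into UNIV L"
  have K: "linear K"
    unfolding K_def by (rule inj_linear_imp_inv_linear[OF L(1) bij_is_inj[OF L(2)]])
  have KL: "K (L x) = x" "L (K x) = x" for x
    using L(2) by (simp_all add: K_def bij_is_inj bij_is_surj surj_f_inv_f)
  have "A = (\<lambda>x. K (B (L x)))"
    using L(3)[symmetric] KL(1) by simp
  then have "operator_matrix A = operator_matrix K * operator_matrix (\<lambda>x. B (L x))"
    using operator_matrix_compose[OF K, of "\<lambda>x. B (L x)"] by simp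
  also have "\<dots> = operator_matrix K * operator_matrix B * operator_matrix L"
    by (simp add: operator_matrix_compose[OF assms(1), of L]
        assoc_mult_mat[OF operator_matrix_carrier operator_matrix_carrier operator_matrix_carrier])
  finally have "operator_matrix A = operator_matrix K * operator_matrix B * operator_matrix L" .
  moreover have "operator_matrix K * operator_matrix L = 1\<^sub>m DIM('a)"
    "operator_matrix L * operator_matrix K = 1\<^sub>m DIM('a)"
    by (simp_all add: operator_matrix_compose[symmetric] L(1) K KL operator_matrix_id)
  moreover have "{operator_matrix A, operator_matrix B, operator_matrix K, operator_matrix L}
      \<subseteq> carrier_mat DIM('a) DIM('a)"
    by simp
  ultimately show ?thesis
    by (metis similar_matI)
qed

text \<open>No block list is ever computed: over the complex numbers a representative operator has
  some Jordan form, and conjugation passes it on to all the others.\<close>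

lemma jordan_nf_operator_exists:
  fixes A :: "'a::euclidean_space \<Rightarrow> 'a"
  shows "\<exists>blocks. jordan_nf (operator_matrix A) blocks"
proof -
  obtain as where "char_poly (operator_matrix A) = (\<Prod>a\<leftarrow>as. [:- a, 1:])"
    using char_poly_factorized[OF operator_matrix_carrier] by blast
  from jordan_nf_exists[OF operator_matrix_carrier this] show ?thesis
    by blast
qed

lemma jordan_nf_conjugate:
  assumes "linear B" "conjugate_operators A B" "jordan_nf (operator_matrix B) blocks"
  shows "jordan_nf (operator_matrix A) blocks"
  using conjugate_operators_similar[OF assms(1,2)] assms(3) similar_mat_trans
  unfolding jordan_nf_def by blast

lemma jordan_nf_similar:
  "jordan_nf A blocks \<Longrightarrow> jordan_nf B blocks \<Longrightarrow> similar_mat A B"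
  unfolding jordan_nf_def using similar_mat_sym similar_mat_trans by blast

lemma jordan_nf_zero_operator:
  fixes A :: "'a::euclidean_space \<Rightarrow> 'a"
  assumes "linear A" "jordan_nf (operator_matrix A) blocks"
    and "jordan_nf (operator_matrix (\<lambda>_ :: 'a. 0)) blocks"
  shows "A x = 0"
proof -
  obtain n P Q where PQ: "{operator_matrix A, 0\<^sub>m DIM('a) DIM('a), P, Q} \<subseteq> carrier_mat n n"
    "operator_matrix A = P * 0\<^sub>m DIM('a) DIM('a) * Q"
    using similar_matD[OF jordan_nf_similar[OF assms(2,3)]] unfolding operator_matrix_zero
    by (elim exE conjE) (rule that; assumption)
  then have "n = DIM('a)"
    using carrier_matD(1)[of "0\<^sub>m DIM('a) DIM('a) :: complex mat" n n] by simp
  then have "P \<in> carrier_mat DIM('a) DIM('a)" "Q \<in> carrier_mat DIM('a) DIM('a)"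
    using PQ(1) by simp_all
  then have "P * 0\<^sub>m DIM('a) DIM('a) = 0\<^sub>m DIM('a) DIM('a)"
    "0\<^sub>m DIM('a) DIM('a) * Q = 0\<^sub>m DIM('a) DIM('a)"
    by (simp_all add: right_mult_zero_mat left_mult_zero_mat)
  with PQ(2) have "operator_matrix A = 0\<^sub>m DIM('a) DIM('a)"
    by simp
  then show ?thesis
    using operator_matrix_eq_zeroD[OF assms(1)] by blast
qed

text \<open>
  The solvability of \<open>A X + Y A\<^sup>2 = 1\<close> expresses that the kernel of \<open>A\<^sup>2\<close> lies in the image of
  \<open>A\<close>; it is a similarity invariant that can be refuted by inspecting a single diagonal entry.
\<close>

lemma similar_mat_kernel_image:
  fixes B P Q X Y :: "'k::comm_ring_1 mat"
  assumes car: "B \<in> carrier_mat n n" "P \<in> carrier_mat n n" "Q \<in> carrier_mat n n"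
    "X \<in> carrier_mat n n" "Y \<in> carrier_mat n n"
    and PQ: "P * Q = 1\<^sub>m n" "Q * P = 1\<^sub>m n" and XY: "B * X + Y * (B * B) = 1\<^sub>m n"
  shows "P * B * Q * (P * X * Q) + P * Y * Q * (P * B * Q * (P * B * Q)) = 1\<^sub>m n"
proof -
  note [simp] = car mult_carrier_mat[of _ n n _ n]
  note assoc = assoc_mult_mat[of _ n n _ n _ n]
  have QP: "Q * (P * Z) = Z" if "Z \<in> carrier_mat n n" for Z
    using assoc[of Q P Z] PQ(2) that by simp
  have "1\<^sub>m n = P * (B * X + Y * (B * B)) * Q"
    unfolding XY using PQ(1) by (simp add: right_mult_one_mat[OF car(2)])
  also have "\<dots> = P * (B * X) * Q + P * (Y * (B * B)) * Q"
    by (simp add: mult_add_distrib_mat[of _ n n _ n] add_mult_distrib_mat[of _ n n _ _ n])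
  also have "P * (B * X) * Q = P * B * Q * (P * X * Q)"
    by (simp add: assoc QP)
  also have "P * (Y * (B * B)) * Q = P * Y * Q * (P * B * Q * (P * B * Q))"
    by (simp add: assoc QP)
  finally show ?thesis by simp
qed

lemma jordan_nf_kernel_image:
  fixes A B X Y :: "'a::euclidean_space \<Rightarrow> 'a"
  assumes "jordan_nf (operator_matrix A) blocks" "jordan_nf (operator_matrix B) blocks"
    and lin: "linear A" "linear B" "linear Y"
    and XY: "\<And>x. B (X x) + Y (B (B x)) = x"
    and b: "b \<in> Basis" "A (A b) = 0"
  shows "\<exists>x. A x \<bullet> b \<noteq> 0"
proof (rule ccontr)
  assume "\<not> ?thesis"
  then have A_b: "A x \<bullet> b = 0" for x by blast
  let ?n = "DIM('a)" and ?A = "operator_matrix A" and ?B = "operator_matrix B"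
    and ?X = "operator_matrix X" and ?Y = "operator_matrix Y"
  obtain m P Q where m: "{?A, ?B, P, Q} \<subseteq> carrier_mat m m"
    and PQ: "P * Q = 1\<^sub>m m" "Q * P = 1\<^sub>m m" "?A = P * ?B * Q"
    using similar_matD[OF jordan_nf_similar[OF assms(1,2)]]
    by (elim exE conjE) (rule that; assumption)
  then have [simp]: "m = ?n"
    using carrier_matD(1)[of ?B m m] by simp
  have car: "?A \<in> carrier_mat ?n ?n" "?B \<in> carrier_mat ?n ?n" "?X \<in> carrier_mat ?n ?n"
    "?Y \<in> carrier_mat ?n ?n" "P \<in> carrier_mat ?n ?n" "Q \<in> carrier_mat ?n ?n"
    using m by auto
  have "?B * ?X + ?Y * (?B * ?B) = 1\<^sub>m ?n"
    unfolding operator_matrix_compose[OF lin(2), symmetric] operator_matrix_compose[OF lin(3), symmetric]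
      operator_matrix_add[symmetric] XY operator_matrix_id ..
  from similar_mat_kernel_image[OF car(2,5,6,3,4) _ _ this] PQ
  have one: "?A * (P * ?X * Q) + P * ?Y * Q * (?A * ?A) = 1\<^sub>m ?n"
    by simp
  obtain j where j: "j < ?n" "b = basis_list ! j"
    using b(1) by (metis basis_list(2) in_set_conv_nth length_basis_list)
  \<comment> \<open>By the negated claim the image of \<open>A\<close> is orthogonal to
    \<open>b\<close>, and \<open>A (A b) = 0\<close>. So row \<open>j\<close> of the matrix of
    \<open>A\<close> and column \<open>j\<close> of its square vanish, and entry
    \<open>(j, j)\<close> of \<open>one\<close> would read 0 = 1.\<close>
  have row0: "row ?A j = 0\<^sub>v ?n"
    using j A_b by (intro eq_vecI) (simp_all add: operator_matrix_index)
  have col0: "col (?A * ?A) j = 0\<^sub>v ?n"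
    unfolding operator_matrix_compose[OF lin(1), symmetric]
    using j b(2) by (intro eq_vecI) (simp_all add: operator_matrix_index)
  define Z W S where "Z = P * ?X * Q" and "W = P * ?Y * Q" and "S = ?A * ?A"
  have ZWS: "Z \<in> carrier_mat ?n ?n" "W \<in> carrier_mat ?n ?n" "S \<in> carrier_mat ?n ?n"
    unfolding Z_def W_def S_def by (intro mult_carrier_mat[of _ ?n ?n _ ?n] car)+
  have "col Z j \<in> carrier_vec ?n" "row W j \<in> carrier_vec ?n"
    by (rule col_carrier_vec[OF j(1) ZWS(1)], rule row_carrier_vec[OF j(1) ZWS(2)])
  then have zero: "0\<^sub>v ?n \<cdot> col Z j = 0" "row W j \<cdot> 0\<^sub>v ?n = 0"
    by simp_all
  have "(?A * Z) $$ (j, j) = row ?A j \<cdot> col Z j"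
    by (rule index_mult_mat(1)) (use ZWS(1) j(1) in simp_all)
  then have "(?A * Z) $$ (j, j) = 0"
    unfolding row0 zero .
  moreover have "(W * S) $$ (j, j) = row W j \<cdot> col S j"
    by (rule index_mult_mat(1)) (use ZWS(2,3) j(1) in simp_all)
  then have "(W * S) $$ (j, j) = 0"
    unfolding S_def col0 zero .
  moreover have "(?A * Z + W * S) $$ (j, j) = (?A * Z) $$ (j, j) + (W * S) $$ (j, j)"
    by (rule index_add_mat(1)) (use ZWS(2,3) j(1) in simp_all)
  ultimately have "(?A * Z + W * S) $$ (j, j) = 0"
    by simp
  then have "(?A * (P * ?X * Q) + P * ?Y * Q * (?A * ?A)) $$ (j, j) = 0"
    by (simp only: Z_def W_def S_def)
  then show False
    using one j(1) by simp
qed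

section \<open>Nilpotent normal forms of the Jacobi operators\<close>

definition jacobi_form ::
  "('v::euclidean_space \<Rightarrow> 'v) \<Rightarrow> ('v \<Rightarrow> 'v) \<Rightarrow> 'v \<times> 'v \<times> 'v \<Rightarrow> 'v \<times> 'v \<times> 'v" where
  "jacobi_form G C y = (0, - G (fst y), C (fst y) + G (fst (snd y)))"

text \<open>Representatives of the conjugacy classes. The identity as \<open>P\<close> gives Jordan
  blocks of size 3 only; the projection along a unit vector replaces one of them by three blocks of
  size 1.\<close>

definition shift_form :: "('v::euclidean_space \<Rightarrow> 'v) \<Rightarrow> 'v \<times> 'v \<times> 'v \<Rightarrow> 'v \<times> 'v \<times> 'v" where
  "shift_form P y = (0, P (fst y), P (fst (snd y)))"

lemma linear_jacobi_form: "linear G \<Longrightarrow> linear C \<Longrightarrow> linear (jacobi_form G C)"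
  by (rule linearI) (auto simp: jacobi_form_def linear_add linear_cmul scaleR_add_right)

lemma linear_shift_form: "linear P \<Longrightarrow> linear (shift_form P)"
  by (rule linearI) (auto simp: shift_form_def linear_add linear_cmul)

lemma linear_bijI:
  fixes L :: "'a::euclidean_space \<Rightarrow> 'a"
  assumes "linear L" "\<And>x. L x = 0 \<Longrightarrow> x = 0"
  shows "bij L"
proof -
  have "inj L"
    using assms by (simp add: linear_injective_0)
  then show ?thesis
    using linear_injective_imp_surjective[OF assms(1)] by (simp add: bij_def)
qed

lemma jacobi_form_conjugate_shift:
  assumes G: "linear G" "\<And>a. G a = 0 \<Longrightarrow> a = 0" and C: "linear C"
  shows "conjugate_operators (jacobi_form G C) (shift_form (\<lambda>a. a))"
proof -
  \<comment> \<open>The entries of \<open>L y\<close> are the last entries of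
    \<open>J (J y)\<close>, \<open>J y\<close> and \<open>y\<close>, where
    \<open>J = jacobi_form G C\<close>. This makes the intertwining automatic; invertibility of
    \<open>G\<close> makes \<open>L\<close> injective.\<close>
  define L where "L y = (- G (G (fst y)), C (fst y) + G (fst (snd y)), snd (snd y))"
    for y :: "'a \<times> 'a \<times> 'a"
  have "linear L"
    by (rule linearI) (auto simp: L_def linear_add[OF G(1)] linear_add[OF C] linear_cmul[OF G(1)]
        linear_cmul[OF C] scaleR_add_right)
  moreover have "x = 0" if "L x = 0" for x
  proof -
    have "fst x = 0"
      using that G(2) by (auto simp: L_def zero_prod_def)
    moreover from this have "fst (snd x) = 0" "snd (snd x) = 0"
      using that G(2) by (auto simp: L_def zero_prod_def linear_0[OF C])
    ultimately show ?thesis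
      by (simp add: prod_eq_iff)
  qed
  moreover have "L (jacobi_form G C x) = shift_form (\<lambda>a. a) (L x)" for x
    by (simp add: L_def jacobi_form_def shift_form_def linear_0[OF G(1)] linear_0[OF C] linear_neg[OF G(1)])
  ultimately show ?thesis
    unfolding conjugate_operators_def using linear_bijI by blast
qed

text \<open>For one vector \<open>x\<close> the map \<open>G\<close> is \<open>x \<bullet> x\<close>
  times the projection off \<open>x\<close>, so last entries of iterates would lose the
  \<open>x\<close>-components of \<open>a\<close> and \<open>b\<close>. \<open>L\<close> restores
  them by using \<open>- (m * m)\<close> and \<open>m\<close> in place of \<open>- G (G a)\<close>
  and \<open>G b\<close>; the rotation \<open>q\<close> moves the distinguished line to a fixed
  one.\<close>

lemma jacobi_form_conjugate_projection:
  fixes C :: "real^'n \<Rightarrow> real^'n"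
  assumes x: "x \<noteq> 0" and C: "linear C" "\<And>a b. C a \<bullet> b = a \<bullet> C b" "x \<bullet> C x = 0" and e: "norm e = 1"
  shows "conjugate_operators (jacobi_form (\<lambda>a. (x \<bullet> x) *\<^sub>R a - (x \<bullet> a) *\<^sub>R x) C)
    (shift_form (\<lambda>a. a - (e \<bullet> a) *\<^sub>R e))"
proof -
  define m where "m = x \<bullet> x"
  have m: "m \<noteq> 0" "m = norm x * norm x" using x by (simp_all add: m_def norm_eq_sqrt_inner)
  obtain q where q: "orthogonal_transformation q" "q x = norm x *\<^sub>R e"
    using orthogonal_transformation_exists[of x "norm x *\<^sub>R e"] e by auto
  have lin_q: "linear q" and q_inner: "q a \<bullet> q b = a \<bullet> b" for a b
    using q(1) by (auto simp: orthogonal_transformation_def)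
  have e_q: "norm x * (e \<bullet> q a) = x \<bullet> a" for a
    using q_inner[of x a] q(2) by simp
  have Px: "(x \<bullet> a / m) *\<^sub>R q x = (e \<bullet> q a) *\<^sub>R e" for a
    using x by (simp add: q(2) m(2) e_q[symmetric])
  have q_inj: "q a = 0 \<Longrightarrow> a = 0" for a
    using q_inner[of a a] by simp
  \<comment> \<open>The correction in the third entry removes the \<open>x\<close>-component of \<open>C a\<close>, which need not vanish:
    only \<open>x \<bullet> C x = 0\<close> is known.\<close>
  define L where "L y = (- (m * m) *\<^sub>R q (fst y),
      q (C (fst y) - (x \<bullet> C (fst y) / m) *\<^sub>R x + m *\<^sub>R fst (snd y)),
      q (snd (snd y) + (C x \<bullet> fst (snd y) / (m * m)) *\<^sub>R x))" for y :: "(real^'n) \<times> (real^'n) \<times> (real^'n)"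
  have "linear L"
    by (rule linearI)
      (auto simp: L_def linear_add[OF lin_q] linear_diff[OF lin_q] linear_add[OF C(1)] linear_cmul[OF lin_q]
        linear_cmul[OF C(1)] inner_add_right algebra_simps add_divide_distrib)
  moreover have "y = 0" if "L y = 0" for y
  proof -
    have "q (fst y) = 0"
      using that m by (auto simp: L_def zero_prod_def)
    then have 1: "fst y = 0" by (rule q_inj)
    then have "q (m *\<^sub>R fst (snd y)) = 0"
      using that by (auto simp: L_def zero_prod_def linear_0[OF C(1)])
    then have 2: "fst (snd y) = 0"
      using q_inj m by fastforce
    then have "snd (snd y) = 0"
      using that by (auto simp: L_def zero_prod_def intro: q_inj)
    with 1 2 show ?thesis by (simp add: prod_eq_iff)
  qed
  moreover have "L (jacobi_form (\<lambda>a. (x \<bullet> x) *\<^sub>R a - (x \<bullet> a) *\<^sub>R x) C y) =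
      shift_form (\<lambda>a. a - (e \<bullet> a) *\<^sub>R e) (L y)" for y
  proof -
    obtain a b c where y: "y = (a, b, c)" by (metis prod_cases3)
    have proj: "q d - (e \<bullet> q d) *\<^sub>R e = q (d - (x \<bullet> d / m) *\<^sub>R x)" for d
      by (simp add: linear_diff[OF lin_q] linear_cmul[OF lin_q] Px)
    \<comment> \<open>The hypothesis \<open>x \<bullet> C x = 0\<close> enters here: it removes the
      term that \<open>G\<close> subtracts.\<close>
    have CxG: "C x \<bullet> (m *\<^sub>R a - (x \<bullet> a) *\<^sub>R x) = m * (x \<bullet> C a)"
      using C(3) by (simp add: C(2) inner_diff_right inner_commute[of "C x" x])
    have "x \<bullet> (C a - (x \<bullet> C a / m) *\<^sub>R x) = 0"
      using m by (simp add: inner_diff_right m_def[symmetric])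
    then have proj2: "q d - (e \<bullet> q d) *\<^sub>R e = q (C a - (x \<bullet> C a / m) *\<^sub>R x + m *\<^sub>R b - (x \<bullet> b) *\<^sub>R x)"
      if "d = C a - (x \<bullet> C a / m) *\<^sub>R x + m *\<^sub>R b" for d
      unfolding proj using m by (simp add: that inner_add_right)
    show ?thesis
      unfolding y L_def jacobi_form_def shift_form_def prod.inject fst_conv snd_conv
    proof (intro conjI)
      show "- (m * m) *\<^sub>R q 0 = 0" by (simp add: linear_0[OF lin_q])
      show "q (C 0 - (x \<bullet> C 0 / m) *\<^sub>R x + m *\<^sub>R - ((x \<bullet> x) *\<^sub>R a - (x \<bullet> a) *\<^sub>R x)) =
          - (m * m) *\<^sub>R q a - (e \<bullet> (- (m * m) *\<^sub>R q a)) *\<^sub>R e"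
      proof -
        have "- (m * m) *\<^sub>R q a - (e \<bullet> (- (m * m) *\<^sub>R q a)) *\<^sub>R e = - (m * m) *\<^sub>R (q a - (e \<bullet> q a) *\<^sub>R e)"
          by (simp add: scaleR_diff_right)
        also have "\<dots> = q (- (m * m) *\<^sub>R (a - (x \<bullet> a / m) *\<^sub>R x))"
          by (simp add: proj linear_cmul[OF lin_q] linear_neg[OF lin_q])
        also have "- (m * m) *\<^sub>R (a - (x \<bullet> a / m) *\<^sub>R x) = m *\<^sub>R - ((x \<bullet> x) *\<^sub>R a - (x \<bullet> a) *\<^sub>R x)"
          using m(1) by (simp add: m_def[symmetric] scaleR_diff_right)
        finally show ?thesis by (simp add: linear_0[OF C(1)])
      qed
      show "q (C a + ((x \<bullet> x) *\<^sub>R b - (x \<bullet> b) *\<^sub>R x) + (C x \<bullet> - ((x \<bullet> x) *\<^sub>R a - (x \<bullet> a) *\<^sub>R x) / (m * m)) *\<^sub>R x) =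
          q (C a - (x \<bullet> C a / m) *\<^sub>R x + m *\<^sub>R b) - (e \<bullet> q (C a - (x \<bullet> C a / m) *\<^sub>R x + m *\<^sub>R b)) *\<^sub>R e"
        unfolding proj2[OF refl] inner_minus_right m_def[symmetric] CxG using m(1) by (simp add: algebra_simps)
    qed
  qed
  ultimately show ?thesis
    unfolding conjugate_operators_def using linear_bijI by blast
qed

section \<open>The metric and its curvature\<close>

lemma differentiable_partial_expansion:
  fixes G :: "real^'n::finite \<Rightarrow> real"
  assumes "G differentiable at u"
  shows "frechet_derivative G (at u) x = (\<Sum>i\<in>UNIV. x $ i * partial_deriv i G u)"
proof -
  have lin: "linear (frechet_derivative G (at u))"
    by (rule linear_frechet_derivative[OF assms])
  have "x = (\<Sum>i\<in>UNIV. (x $ i) *\<^sub>R axis i 1)"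
    using basis_expansion[of x] by (simp add: scalar_mult_eq_scaleR)
  then have "frechet_derivative G (at u) x = frechet_derivative G (at u) (\<Sum>i\<in>UNIV. (x $ i) *\<^sub>R axis i 1)"
    by simp
  also have "\<dots> = (\<Sum>i\<in>UNIV. (x $ i) *\<^sub>R frechet_derivative G (at u) (axis i 1))"
    using lin by (simp only: linear_sum linear_cmul)
  finally show ?thesis by (simp add: partial_deriv_def)
qed

text \<open>Along the line through \<open>u\<close> in direction \<open>i\<close> all other summands
  are constant, so \<open>h i\<close> inherits its derivative from \<open>G\<close>.\<close>

lemma separated_partial_deriv:
  fixes G :: "real^'n::finite \<Rightarrow> real"
  assumes O: "open \<O>" "u \<in> \<O>" and G: "G differentiable at u"
    and sep: "\<And>v. v \<in> \<O> \<Longrightarrow> G v = (\<Sum>i\<in>UNIV. h i (v $ i))"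
  shows "partial_deriv i G u = deriv (h i) (u $ i)"
proof -
  define K where "K = (\<Sum>k\<in>UNIV - {i}. h k (u $ k))"
  have line: "((\<lambda>r. u + (r - u $ i) *\<^sub>R axis i 1) has_derivative (\<lambda>r. r *\<^sub>R axis i 1)) (at (u $ i))"
    by (auto intro!: derivative_eq_intros)
  have "(G has_derivative frechet_derivative G (at u)) (at u)"
    using G by (simp add: frechet_derivative_works)
  then have "((\<lambda>r. G (u + (r - u $ i) *\<^sub>R axis i 1)) has_derivative
      (\<lambda>r. frechet_derivative G (at u) (r *\<^sub>R axis i 1))) (at (u $ i))"
    using has_derivative_compose[OF line, of G] by simp
  then have D: "((\<lambda>r. G (u + (r - u $ i) *\<^sub>R axis i 1)) has_derivative
      (\<lambda>r. partial_deriv i G u * r)) (at (u $ i))"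
    by (simp add: partial_deriv_def linear_cmul[OF linear_frechet_derivative[OF G]] mult.commute)
  define N where "N = (\<lambda>r. u + (r - u $ i) *\<^sub>R axis i 1) -` \<O>"
  have "open N"
    unfolding N_def by (rule open_vimage[OF O(1)]) (intro continuous_intros)
  have "G (u + (r - u $ i) *\<^sub>R axis i 1) = h i r + K" if "r \<in> N" for r
  proof -
    have "G (u + (r - u $ i) *\<^sub>R axis i 1) =
        (\<Sum>k\<in>UNIV. h k ((u + (r - u $ i) *\<^sub>R axis i 1) $ k))"
      using that by (simp add: N_def sep)
    also have "\<dots> = h i r + (\<Sum>k\<in>UNIV - {i}. h k ((u + (r - u $ i) *\<^sub>R axis i 1) $ k))"
      by (subst sum.remove[of _ i]) (auto simp: axis_def)
    also have "(\<Sum>k\<in>UNIV - {i}. h k ((u + (r - u $ i) *\<^sub>R axis i 1) $ k)) = K"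
      unfolding K_def by (rule sum.cong) (auto simp: axis_def)
    finally show ?thesis .
  qed
  then have "((\<lambda>r. h i r + K) has_derivative (\<lambda>r. partial_deriv i G u * r)) (at (u $ i))"
    by (intro has_derivative_transform_within_open[OF D \<open>open N\<close>]) (auto simp: N_def O(2))
  then have "((\<lambda>r. h i r + K) has_real_derivative partial_deriv i G u) (at (u $ i))"
    by (simp add: has_field_derivative_def)
  from DERIV_diff[OF this DERIV_const[of K]] have "(h i has_real_derivative partial_deriv i G u) (at (u $ i))"
    by simp
  then show ?thesis
    by (simp add: DERIV_imp_deriv)
qed

lemma single_variable_derivative:
  fixes G :: "real^'n::finite \<Rightarrow> real"
  assumes O: "open \<O>" "u \<in> \<O>" and G: "smooth_on \<O> G"
    and single: "\<And>v. v \<in> \<O> \<Longrightarrow> G v = h (v $ i)"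
  shows "partial_deriv i G u = deriv h (u $ i)"
    and "(G has_derivative (\<lambda>x. partial_deriv i G u * x $ i)) (at u)"
proof -
  define k where "k j = (if j = i then h else (\<lambda>_. 0))" for j
  have d: "(G has_derivative frechet_derivative G (at u)) (at u)"
    by (rule smooth_on_has_derivative[OF G O(2)])
  then have diff: "G differentiable at u" by (auto simp: differentiable_def)
  have "G v = (\<Sum>j\<in>UNIV. k j (v $ j))" if "v \<in> \<O>" for v
  proof -
    have "(\<Sum>j\<in>UNIV. k j (v $ j)) = (\<Sum>j\<in>UNIV. if j = i then h (v $ j) else 0)"
      by (rule sum.cong) (auto simp: k_def)
    then show ?thesis
      using single[OF that] by simp
  qed
  then have partial: "partial_deriv j G u = deriv (k j) (u $ j)" for j
    by (intro separated_partial_deriv[OF O diff]) auto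
  then show "partial_deriv i G u = deriv h (u $ i)"
    by (simp add: k_def)
  have "frechet_derivative G (at u) x = partial_deriv i G u * x $ i" for x
  proof -
    have "frechet_derivative G (at u) x = (\<Sum>j\<in>UNIV. if j = i then partial_deriv i G u * x $ i else 0)"
      unfolding differentiable_partial_expansion[OF diff]
      by (rule sum.cong) (auto simp: partial k_def)
    then show ?thesis by simp
  qed
  then show "(G has_derivative (\<lambda>x. partial_deriv i G u * x $ i)) (at u)"
    using d by presburger
qed

lemma smooth_partial_deriv: "smooth_on S G \<Longrightarrow> smooth_on S (partial_deriv i G)"
  unfolding partial_deriv_def by (rule smooth_on_frechet_derivative)

text \<open>If entry \<open>i\<close> varies with coordinate \<open>i\<close> only, the Jacobian is
  diagonal and acts as the componentwise product of \<open>real^'n\<close>. This product carries all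
  later computations with second and third derivatives.\<close>

lemma has_derivative_vec_lambda_single:
  fixes G :: "'n::finite \<Rightarrow> real^'n \<Rightarrow> real"
  assumes "\<And>i. (G i has_derivative (\<lambda>x. c i * x $ i)) (at u)"
  shows "((\<lambda>v. \<chi> i. G i v) has_derivative (\<lambda>x. (\<chi> i. c i) * x)) (at u)"
  unfolding has_derivative_componentwise_within[of "\<lambda>v. \<chi> i. G i v"]
  using assms by (auto simp: Basis_vec_def inner_axis)

section \<open>The metric in coordinates, its connection and curvature\<close>

abbreviation pu :: "'a \<times> 'b \<times> 'c \<Rightarrow> 'a" where "pu \<equiv> fst"
abbreviation pt :: "'a \<times> 'b \<times> 'c \<Rightarrow> 'b" where "pt p \<equiv> fst (snd p)"
abbreviation pv :: "'a \<times> 'b \<times> 'c \<Rightarrow> 'c" where "pv p \<equiv> snd (snd p)"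

lemma g_F_eq: "g_F F p x y = (- 2 * F (pu p) - 2 * (pu p \<bullet> pt p)) * (pu x \<bullet> pu y)
    + pu x \<bullet> pv y + pv x \<bullet> pu y - pt x \<bullet> pt y"
  by (simp add: g_F_def case_prod_beta)

lemma bilinear_g_F: "bilinear (g_F F p)"
  unfolding bilinear_def
  by (auto intro!: linearI simp: g_F_eq inner_add_left inner_add_right algebra_simps)

lemma g_F_commute: "g_F F p x y = g_F F p y x"
  by (simp add: g_F_eq inner_commute)

locale separated_potential =
  fixes \<O> :: "(real^'s::finite) set" and F :: "real^'s \<Rightarrow> real" and f :: "'s \<Rightarrow> real \<Rightarrow> real"
  assumes open_\<O>: "open \<O>" and smooth_F: "smooth_on \<O> F"
    and separated: "\<And>u. u \<in> \<O> \<Longrightarrow> F u = (\<Sum>i\<in>UNIV. f i (u $ i))"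
begin

definition grad :: "real^'s \<Rightarrow> real^'s" where "grad u = (\<chi> i. partial_deriv i F u)"
text \<open>Only the diagonal of the Hessian is kept: mixed derivatives of a separated function
  vanish. The same holds for \<open>third\<close>.\<close>

definition hess :: "real^'s \<Rightarrow> real^'s" where "hess u = (\<chi> i. partial_deriv i (partial_deriv i F) u)"
definition third :: "real^'s \<Rightarrow> real^'s" where "third u = (\<chi> i. (partial_deriv i ^^ 3) F u)"

lemma F_has_derivative:
  assumes "u \<in> \<O>"
  shows "(F has_derivative (\<lambda>x. grad u \<bullet> x)) (at u)"
proof -
  have d: "(F has_derivative frechet_derivative F (at u)) (at u)"
    by (rule smooth_on_has_derivative[OF smooth_F assms])
  moreover from this have "F differentiable at u" by (auto simp: differentiable_def)
  from differentiable_partial_expansion[OF this]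
  have "frechet_derivative F (at u) = (\<lambda>x. grad u \<bullet> x)"
    by (simp add: fun_eq_iff grad_def inner_vec_def mult.commute)
  ultimately show ?thesis by simp
qed

lemma partial_deriv_F: "u \<in> \<O> \<Longrightarrow> partial_deriv i F u = deriv (f i) (u $ i)"
  using smooth_on_has_derivative[OF smooth_F]
  by (intro separated_partial_deriv[where h = f and \<O> = \<O>] open_\<O> separated) (auto simp: differentiable_def)

lemma grad_has_derivative:
  assumes "u \<in> \<O>"
  shows "(grad has_derivative (\<lambda>x. hess u * x)) (at u)"
  unfolding grad_def[abs_def] hess_def
proof (rule has_derivative_vec_lambda_single)
  show "(partial_deriv i F has_derivative (\<lambda>x. partial_deriv i (partial_deriv i F) u * x $ i)) (at u)" for i
    by (rule single_variable_derivative(2)[where h = "deriv (f i)", OF open_\<O> assms])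
      (simp_all add: smooth_partial_deriv smooth_F partial_deriv_F)
qed

lemma partial_deriv2_F:
  "u \<in> \<O> \<Longrightarrow> partial_deriv i (partial_deriv i F) u = deriv (deriv (f i)) (u $ i)"
  by (rule single_variable_derivative(1)[where h = "deriv (f i)", OF open_\<O>])
    (simp_all add: smooth_partial_deriv smooth_F partial_deriv_F)

lemma hess_has_derivative:
  assumes "u \<in> \<O>"
  shows "(hess has_derivative (\<lambda>x. third u * x)) (at u)"
  unfolding hess_def[abs_def] third_def numeral_3_eq_3 funpow.simps o_def id_def
proof (rule has_derivative_vec_lambda_single)
  show "(partial_deriv i (partial_deriv i F) has_derivative
      (\<lambda>x. partial_deriv i (partial_deriv i (partial_deriv i F)) u * x $ i)) (at u)" for i
    by (rule single_variable_derivative(2)[where h = "deriv (deriv (f i))", OF open_\<O> assms])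
      (simp_all add: smooth_partial_deriv smooth_F partial_deriv2_F)
qed

text \<open>Half the differential of the coefficient of \<open>|du|^2\<close> in the metric, the
  only coefficient that varies.\<close>

definition slope :: "'s space3 \<Rightarrow> 's space3 \<Rightarrow> real" where
  "slope p x = - (grad (pu p) \<bullet> pu x) - pu x \<bullet> pt p - pu p \<bullet> pt x"

text \<open>The Koszul formula reads \<open>g(Gam x y, z) = slope x (y . z) + slope y (x . z) -
  slope z (x . y)\<close>, the dots pairing \<open>u\<close>-parts. The \<open>t\<close>-entry and
  the last summand come from the third term.\<close>

definition Gam :: "'s space3 \<Rightarrow> 's space3 \<Rightarrow> 's space3 \<Rightarrow> 's space3" where
  "Gam p x y = (0, - (pu x \<bullet> pu y) *\<^sub>R pu p,
     slope p x *\<^sub>R pu y + slope p y *\<^sub>R pu x + (pu x \<bullet> pu y) *\<^sub>R (grad (pu p) + pt p))"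

lemma M_F_iff: "p \<in> M_F \<O> \<longleftrightarrow> pu p \<in> \<O>"
  by (cases p) (auto simp: M_F_def)

lemma open_M_F: "open (M_F \<O>)"
  unfolding M_F_def by (rule open_Times[OF open_\<O> open_UNIV])

lemma smooth_projections:
  "smooth_on (M_F \<O>) pu" "smooth_on (M_F \<O>) (\<lambda>p. pt p)" "smooth_on (M_F \<O>) (\<lambda>p. pv p)"
  by (rule smooth_on_linear[OF open_M_F];
      intro bounded_linear_compose[OF bounded_linear_fst] bounded_linear_compose[OF bounded_linear_snd]
        bounded_linear_fst bounded_linear_snd)+

lemma smooth_on_pu: "smooth_on \<O> h \<Longrightarrow> smooth_on (M_F \<O>) (\<lambda>p. h (pu p))"
  by (rule smooth_on_compose_linear[OF open_\<O> bounded_linear_fst open_M_F]) (auto simp: M_F_def)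

lemma smooth_grad: "smooth_on \<O> grad"
proof -
  have "grad u = (\<Sum>i\<in>UNIV. partial_deriv i F u *\<^sub>R axis i 1)" for u
    using basis_expansion[of "grad u"] by (simp add: scalar_mult_eq_scaleR grad_def)
  then have "grad = (\<lambda>u. \<Sum>i\<in>UNIV. partial_deriv i F u *\<^sub>R axis i 1)"
    by (rule ext)
  moreover have "smooth_on \<O> (\<lambda>u. \<Sum>i\<in>UNIV. partial_deriv i F u *\<^sub>R axis i 1)"
    by (intro smooth_on_sum smooth_on_scaleR smooth_on_const open_\<O> smooth_partial_deriv smooth_F)
  ultimately show ?thesis by simp
qed

lemma smooth_g_F: "smooth_on (M_F \<O>) (\<lambda>p. g_F F p x y)"
proof -
  have "smooth_on (M_F \<O>) (\<lambda>p. (- 2) * F (pu p) * (pu x \<bullet> pu y) + (- 2) * (pu p \<bullet> pt p) * (pu x \<bullet> pu y)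
      + (pu x \<bullet> pv y + pv x \<bullet> pu y - pt x \<bullet> pt y))"
    by (intro smooth_on_add smooth_on_mult smooth_on_const smooth_on_inner smooth_projections
        smooth_on_pu smooth_F open_M_F)
  then show ?thesis
    by (simp add: g_F_eq algebra_simps)
qed

lemma pseudo_riemannian_M_F: "pseudo_riemannian (M_F \<O>) (g_F F)"
  unfolding pseudo_riemannian_def
proof (intro conjI ballI allI impI open_M_F bilinear_g_F g_F_commute smooth_g_F)
  fix p x :: "'s space3"
  assume *: "\<forall>y. g_F F p x y = 0"
  have "pu x = 0"
    using *[rule_format, of "(0, 0, pu x)"] by (simp add: g_F_eq)
  moreover have "pt x = 0"
    using *[rule_format, of "(0, pt x, 0)"] by (simp add: g_F_eq)
  moreover have "pv x = 0"
    using *[rule_format, of "(pv x, 0, 0)"] \<open>pu x = 0\<close> by (simp add: g_F_eq)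
  ultimately show "x = 0" by (simp add: prod_eq_iff)
qed

lemma smooth_slope: "smooth_on (M_F \<O>) (\<lambda>p. slope p x)"
proof -
  have "smooth_on (M_F \<O>) (\<lambda>p. (- 1) * (grad (pu p) \<bullet> pu x) + ((- 1) * (pu x \<bullet> pt p) + (- 1) * (pu p \<bullet> pt x)))"
    by (intro smooth_on_add smooth_on_mult smooth_on_const smooth_on_inner smooth_projections
        smooth_on_pu smooth_grad open_M_F)
  moreover have "slope p x = (- 1) * (grad (pu p) \<bullet> pu x) + ((- 1) * (pu x \<bullet> pt p) + (- 1) * (pu p \<bullet> pt x))" for p
    by (simp add: slope_def)
  ultimately show ?thesis by (simp only:)
qed

lemma smooth_Gam: "smooth_on (M_F \<O>) (\<lambda>p. Gam p x y)"
  unfolding Gam_def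
  by (intro smooth_on_Pair smooth_on_add smooth_on_scaleR smooth_on_const smooth_projections smooth_slope
      smooth_on_pu smooth_grad open_M_F)

lemma g_F_has_derivative:
  assumes "p \<in> M_F \<O>"
  shows "((\<lambda>q. g_F F q x y) has_derivative (\<lambda>z. 2 * slope p z * (pu x \<bullet> pu y))) (at p)"
proof -
  have u: "pu p \<in> \<O>" using assms M_F_iff by blast
  have "((\<lambda>q. F (pu q)) has_derivative (\<lambda>z. grad (pu p) \<bullet> pu z)) (at p)"
    using has_derivative_compose[OF has_derivative_fst[OF has_derivative_ident] F_has_derivative[OF u]] by simp
  moreover have "((\<lambda>q. pu q \<bullet> pt q) has_derivative (\<lambda>z. pu p \<bullet> pt z + pu z \<bullet> pt p)) (at p)"
    by (intro has_derivative_inner has_derivative_fst has_derivative_snd has_derivative_ident)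
  ultimately show ?thesis
    unfolding g_F_eq
    by (auto intro!: derivative_eq_intros simp: slope_def algebra_simps fun_eq_iff)
qed

sublocale christoffel_chart "M_F \<O>" "g_F F" Gam
proof
  show "pseudo_riemannian (M_F \<O>) (g_F F)" by (rule pseudo_riemannian_M_F)
  show "bilinear (Gam p)" for p
    unfolding bilinear_def
    by (auto intro!: linearI simp: Gam_def slope_def inner_add_left inner_add_right algebra_simps)
  show "Gam p x y = Gam p y x" for p x y
    by (simp add: Gam_def inner_commute[of "pu x"] add.commute)
  show "smooth_on (M_F \<O>) (\<lambda>p. Gam p x y)" for x y by (rule smooth_Gam)
  show "frechet_derivative (\<lambda>q. g_F F q x y) (at p) z = g_F F p (Gam p z x) y + g_F F p x (Gam p z y)"
    if "p \<in> M_F \<O>" for p x y z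
    unfolding frechet_derivative_at[OF g_F_has_derivative[OF that], symmetric]
    by (simp add: g_F_eq Gam_def slope_def inner_add_left inner_add_right inner_commute algebra_simps)
qed

text \<open>
  \<open>sig u\<close> is the diagonal of \<open>F'' + (|u|\<^sup>2 / 2) I\<close>; the second summand comes from the terms of the
  curvature that are quadratic in the Christoffel symbols.
\<close>

definition sig :: "real^'s \<Rightarrow> real^'s" where
  "sig u = hess u + ((u \<bullet> u) / 2) *\<^sub>R 1"

definition B_form :: "real^'s \<Rightarrow> 's space3 \<Rightarrow> 's space3 \<Rightarrow> real" where
  "B_form u x y = (sig u * pu x) \<bullet> pu y + pu x \<bullet> pt y + pt x \<bullet> pu y"

text \<open>Derivative of \<open>slope q y\<close> in direction \<open>x\<close>: half the Hessian
  of the coefficient of \<open>|du|^2\<close>.\<close>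

definition slope' :: "'s space3 \<Rightarrow> 's space3 \<Rightarrow> 's space3 \<Rightarrow> real" where
  "slope' p x y = - ((hess (pu p) * pu x) \<bullet> pu y) - pu y \<bullet> pt x - pu x \<bullet> pt y"

lemma Gam_frechet_derivative:
  assumes "p \<in> M_F \<O>"
  shows "frechet_derivative (\<lambda>q. Gam q y z) (at p) x =
    (0, - (pu y \<bullet> pu z) *\<^sub>R pu x, slope' p x y *\<^sub>R pu z + slope' p x z *\<^sub>R pu y
      + (pu y \<bullet> pu z) *\<^sub>R (hess (pu p) * pu x + pt x))"
proof -
  have u: "pu p \<in> \<O>" using assms M_F_iff by blast
  have grad: "((\<lambda>q. grad (pu q)) has_derivative (\<lambda>x. hess (pu p) * pu x)) (at p)"
    using has_derivative_compose[OF has_derivative_fst[OF has_derivative_ident] grad_has_derivative[OF u]] by simp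
  have slope: "((\<lambda>q. slope q y) has_derivative (\<lambda>x. slope' p x y)) (at p)" for y
    unfolding slope_def slope'_def
    by (intro has_derivative_diff has_derivative_minus has_derivative_inner_left[OF grad]
        has_derivative_inner_right has_derivative_inner_left has_derivative_fst has_derivative_snd has_derivative_ident)
  have "((\<lambda>q. Gam q y z) has_derivative (\<lambda>x. (0, - (pu y \<bullet> pu z) *\<^sub>R pu x,
      slope' p x y *\<^sub>R pu z + slope' p x z *\<^sub>R pu y + (pu y \<bullet> pu z) *\<^sub>R (hess (pu p) * pu x + pt x)))) (at p)"
    unfolding Gam_def
    by (intro has_derivative_Pair has_derivative_add has_derivative_scaleR_right has_derivative_scaleR_left grad slope
        has_derivative_const has_derivative_fst has_derivative_snd has_derivative_ident)
  from fun_cong[OF frechet_derivative_at[OF this, symmetric], of x] show ?thesis .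
qed

lemma curvature_M_F:
  assumes "p \<in> M_F \<O>"
  shows "curvature (M_F \<O>) (g_F F) p x y z =
    (0, (pu x \<bullet> pu z) *\<^sub>R pu y - (pu y \<bullet> pu z) *\<^sub>R pu x,
     B_form (pu p) y z *\<^sub>R pu x - B_form (pu p) x z *\<^sub>R pu y
      + (pu y \<bullet> pu z) *\<^sub>R (sig (pu p) * pu x + pt x) - (pu x \<bullet> pu z) *\<^sub>R (sig (pu p) * pu y + pt y))"
proof -
  \<comment> \<open>The terms quadratic in \<open>Gam\<close> give \<open>|u|^2\<close> times
    \<open>(y . z) x - (x . z) y\<close>. Half of this is absorbed by \<open>B_form\<close>, the
    other half by the explicit multiples of \<open>sig\<close>.\<close>
  define \<kappa> where "\<kappa> = (pu p \<bullet> pu p) / 2"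
  have pp: "pu p \<bullet> pu p = \<kappa> + \<kappa>" by (simp add: \<kappa>_def)
  have sig: "sig (pu p) * a = hess (pu p) * a + \<kappa> *\<^sub>R a" for a
    by (simp add: sig_def \<kappa>_def Finite_Cartesian_Product.vec_eq_iff algebra_simps)
  have "(hess (pu p) * pu x) \<bullet> pu y = (hess (pu p) * pu y) \<bullet> pu x"
    by (simp add: inner_vec_def mult_ac)
  then show ?thesis
    unfolding curvature_eq[OF assms] Gam_frechet_derivative[OF assms] B_form_def sig
    by (simp add: Gam_def slope_def slope'_def pp prod_eq_iff Finite_Cartesian_Product.vec_eq_iff inner_add_left inner_commute algebra_simps)
qed

end

section \<open>The model, the signature and the Jacobi operators\<close>

lemma inner_vec_double_sum:
  fixes a b c d :: "real^'n"
  shows "(a \<bullet> b) * (c \<bullet> d) = (\<Sum>i\<in>UNIV. \<Sum>j\<in>UNIV. (a $ i * b $ i) * (c $ j * d $ j))"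
  by (simp add: inner_vec_def sum_product)

definition model_form :: "('s::finite) space3 \<Rightarrow> 's space3 \<Rightarrow> real" where
  "model_form x y = pu x \<bullet> pt y + pt x \<bullet> pu y"

definition kulkarni_nomizu ::
  "(('s::finite) space3 \<Rightarrow> 's space3 \<Rightarrow> real) \<Rightarrow> 's space3 \<Rightarrow> 's space3 \<Rightarrow> 's space3 \<Rightarrow> 's space3 \<Rightarrow> real" where
  "kulkarni_nomizu B x y z w = B x w * (pu y \<bullet> pu z) - B x z * (pu y \<bullet> pu w)
    - B y w * (pu x \<bullet> pu z) + B y z * (pu x \<bullet> pu w)"

lemma R_model_eq: "R_model x y z w = kulkarni_nomizu model_form x y z w"
proof -
  obtain xu xt xv where x: "x = (xu, xt, xv)" by (rule prod_cases3)
  obtain yu yt yv where y: "y = (yu, yt, yv)" by (rule prod_cases3)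
  obtain zu zt zv where z: "z = (zu, zt, zv)" by (rule prod_cases3)
  obtain wu wt wv where w: "w = (wu, wt, wv)" by (rule prod_cases3)
  note xyzw = x y z w
  define T where "T i j = (xu $ i * yu $ j - yu $ i * xu $ j) * (zu $ j * wt $ i - wu $ j * zt $ i)
    + (xu $ j * yt $ i - yu $ j * xt $ i) * (zu $ i * wu $ j - wu $ i * zu $ j)" for i j
  have "R_model x y z w = (\<Sum>i\<in>UNIV. \<Sum>j\<in>UNIV - {i}. T i j)"
    unfolding R_model_def Let_def T_def xyzw prod.case ..
  also have "\<dots> = (\<Sum>i\<in>UNIV. \<Sum>j\<in>UNIV. T i j)"
    \<comment> \<open>The diagonal terms \<open>T i i\<close> vanish, so the full double sum may be
      taken; it then factors into inner products.\<close>
    by (rule sum.cong[OF refl], rule sum.mono_neutral_left) (auto simp: T_def)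
  also have "\<dots> = (\<Sum>i\<in>UNIV. \<Sum>j\<in>UNIV.
      (xu $ i * wt $ i) * (yu $ j * zu $ j) - (xu $ i * zt $ i) * (yu $ j * wu $ j)
      - (yu $ i * wt $ i) * (xu $ j * zu $ j) + (yu $ i * zt $ i) * (xu $ j * wu $ j)
      + (yt $ i * zu $ i) * (xu $ j * wu $ j) - (yt $ i * wu $ i) * (xu $ j * zu $ j)
      - (xt $ i * zu $ i) * (yu $ j * wu $ j) + (xt $ i * wu $ i) * (yu $ j * zu $ j))"
    by (intro sum.cong refl) (simp add: T_def algebra_simps)
  also have "\<dots> = (xu \<bullet> wt) * (yu \<bullet> zu) - (xu \<bullet> zt) * (yu \<bullet> wu)
      - (yu \<bullet> wt) * (xu \<bullet> zu) + (yu \<bullet> zt) * (xu \<bullet> wu)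
      + (yt \<bullet> zu) * (xu \<bullet> wu) - (yt \<bullet> wu) * (xu \<bullet> zu)
      - (xt \<bullet> zu) * (yu \<bullet> wu) + (xt \<bullet> wu) * (yu \<bullet> zu)"
    unfolding inner_vec_double_sum sum.distrib sum_subtractf ..
  also have "\<dots> = kulkarni_nomizu model_form x y z w"
    by (simp add: xyzw kulkarni_nomizu_def model_form_def algebra_simps)
  finally show ?thesis .
qed

section \<open>Orthonormal families and kernels of summed Jacobi operators\<close>

lemma orthogonal_independent:
  fixes b :: "'a::euclidean_space \<Rightarrow> 'a \<Rightarrow> real"
  assumes b: "bilinear b" and E: "finite E" "\<And>e. e \<in> E \<Longrightarrow> b e e \<noteq> 0"
    "\<And>e e'. e \<in> E \<Longrightarrow> e' \<in> E \<Longrightarrow> e \<noteq> e' \<Longrightarrow> b e e' = 0"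
  shows "independent E"
proof
  assume "dependent E"
  then obtain c v where v: "v \<in> E" "c v \<noteq> 0" and zero: "(\<Sum>e\<in>E. c e *\<^sub>R e) = 0"
    using dependent_finite[OF E(1)] by blast
  have lin: "linear (\<lambda>x. b x v)" using b by (simp add: bilinear_def)
  have "b (\<Sum>e\<in>E. c e *\<^sub>R e) v = (\<Sum>e\<in>E. c e * b e v)"
    using linear_sum[OF lin, of "\<lambda>e. c e *\<^sub>R e" E] linear_cmul[OF lin] by simp
  also have "\<dots> = c v * b v v"
    using v(1) E by (simp add: sum.remove[of E v] sum.neutral)
  finally show False
    using v E(2) zero bilinear_lzero[OF b] by simp
qed

lemma orthonormal_span_definite:
  fixes b :: "'a::euclidean_space \<Rightarrow> 'a \<Rightarrow> real"
  assumes b: "bilinear b" and \<epsilon>: "\<bar>\<epsilon>\<bar> = 1" and E: "finite E" "\<And>e. e \<in> E \<Longrightarrow> b e e = \<epsilon>"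
    "\<And>e e'. e \<in> E \<Longrightarrow> e' \<in> E \<Longrightarrow> e \<noteq> e' \<Longrightarrow> b e e' = 0"
  shows "definite_plane \<epsilon> (card E) b (span E)" and "orthonormal_basis_of \<epsilon> b (span E) E"
proof -
  have ind: "independent E"
    using \<epsilon> by (intro orthogonal_independent[OF b E(1)]) (auto simp: E)
  then show "orthonormal_basis_of \<epsilon> b (span E) E"
    by (simp add: orthonormal_basis_of_def E)
  have "0 < \<epsilon> * b x x" if x: "x \<in> span E" "x \<noteq> 0" for x
  proof -
    obtain c where c: "x = (\<Sum>e\<in>E. c e *\<^sub>R e)"
      using x(1) by (auto simp: span_finite[OF E(1)])
    have lin: "linear (\<lambda>y. b y z)" "linear (b z)" for z using b by (simp_all add: bilinear_def)
    have be: "b x e = c e * \<epsilon>" if "e \<in> E" for e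
    proof -
      have "b x e = (\<Sum>e'\<in>E. c e' * b e' e)"
        unfolding c using linear_sum[OF lin(1)[of e], of "\<lambda>e. c e *\<^sub>R e" E] linear_cmul[OF lin(1)] by simp
      also have "\<dots> = c e * \<epsilon>"
        using that E by (simp add: sum.remove[of E e] sum.neutral)
      finally show ?thesis .
    qed
    have "b x x = b x (\<Sum>e\<in>E. c e *\<^sub>R e)" by (simp flip: c)
    also have "\<dots> = (\<Sum>e\<in>E. c e * b x e)"
      using linear_sum[OF lin(2)[of x], of "\<lambda>e. c e *\<^sub>R e" E] linear_cmul[OF lin(2)] by simp
    also have "\<dots> = \<epsilon> * (\<Sum>e\<in>E. (c e)\<^sup>2)"
      by (simp add: be sum_distrib_left power2_eq_square mult_ac)
    finally have "\<epsilon> * b x x = (\<epsilon> * \<epsilon>) * (\<Sum>e\<in>E. (c e)\<^sup>2)" by simp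
    moreover have "\<epsilon> * \<epsilon> = 1" using \<epsilon> by (metis abs_mult_self_eq mult_1)
    moreover have "(\<Sum>e\<in>E. (c e)\<^sup>2) \<noteq> 0"
    proof
      assume "(\<Sum>e\<in>E. (c e)\<^sup>2) = 0"
      then have "\<forall>e\<in>E. c e = 0" using E(1) by (simp add: sum_nonneg_eq_0_iff)
      then show False using x(2) unfolding c by simp
    qed
    moreover have "(\<Sum>e\<in>E. (c e)\<^sup>2) \<ge> 0" by (simp add: sum_nonneg)
    ultimately show ?thesis by simp
  qed
  then show "definite_plane \<epsilon> (card E) b (span E)"
    using ind by (simp add: definite_plane_def dim_eq_card_independent)
qed

lemma linear_kernel_exists:
  fixes \<Phi> :: "'a::euclidean_space \<Rightarrow> 'b::euclidean_space"
  assumes "linear \<Phi>" "Real_Vector_Spaces.subspace \<pi>" "DIM('b) < dim \<pi>"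
  shows "\<exists>x\<in>\<pi>. x \<noteq> 0 \<and> \<Phi> x = 0"
proof (rule ccontr)
  assume *: "\<not> ?thesis"
  have "inj_on \<Phi> \<pi>"
    using * linear_injective_on_subspace_0[OF assms(1,2)] by blast
  moreover have "span \<pi> = \<pi>" using assms(2) by (simp add: span_eq_iff)
  ultimately have "inj_on \<Phi> (span \<pi>)" by (simp only:)
  then have "dim (\<Phi> ` \<pi>) = dim \<pi>"
    by (rule dim_image_eq[OF assms(1)])
  then show False
    using dim_subset_UNIV[of "\<Phi> ` \<pi>"] assms(3) by simp
qed

lemma collinear_of_cauchy_schwarz_equality:
  fixes a e :: "'a::real_inner"
  assumes "(e \<bullet> e) * (a \<bullet> a) = (e \<bullet> a)\<^sup>2"
  shows "(a \<bullet> a) *\<^sub>R e = (e \<bullet> a) *\<^sub>R a"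
proof -
  let ?d = "(a \<bullet> a) *\<^sub>R e - (e \<bullet> a) *\<^sub>R a"
  have "?d \<bullet> ?d = (a \<bullet> a) * ((e \<bullet> e) * (a \<bullet> a) - (e \<bullet> a)\<^sup>2)"
    by (simp add: inner_diff_left inner_diff_right inner_commute[of a e] power2_eq_square algebra_simps)
  then show ?thesis using assms by simp
qed

definition jacobi_G :: "('s::finite) space3 \<Rightarrow> real^'s \<Rightarrow> real^'s" where
  "jacobi_G x a = (pu x \<bullet> pu x) *\<^sub>R a - (pu x \<bullet> a) *\<^sub>R pu x"

lemma linear_jacobi_G: "linear (jacobi_G x)"
  by (rule linearI) (auto simp: jacobi_G_def inner_add_right algebra_simps)

text \<open>Each \<open>jacobi_G x\<close> is positive semidefinite by Cauchy-Schwarz. If the sum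
  annihilates \<open>a\<close>, every summand has zero quadratic form at \<open>a\<close>, which is
  the case of equality.\<close>

lemma sum_jacobi_G_zero:
  assumes "finite E" "(\<Sum>x\<in>E. jacobi_G x a) = 0" "x \<in> E"
  shows "(a \<bullet> a) *\<^sub>R pu x = (pu x \<bullet> a) *\<^sub>R a"
proof -
  have eq: "a \<bullet> jacobi_G x a = (pu x \<bullet> pu x) * (a \<bullet> a) - (pu x \<bullet> a)\<^sup>2" for x
    using inner_commute[of a "pu x"] by (simp add: jacobi_G_def inner_diff_right power2_eq_square)
  have nonneg: "a \<bullet> jacobi_G x a \<ge> 0" for x
    unfolding eq using Cauchy_Schwarz_ineq[of "pu x" a] by simp
  have "(\<Sum>x\<in>E. a \<bullet> jacobi_G x a) = a \<bullet> (\<Sum>x\<in>E. jacobi_G x a)"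
    by (rule inner_sum_right[symmetric])
  then have "a \<bullet> jacobi_G x a = 0"
    using sum_nonneg_eq_0_iff[OF assms(1), of "\<lambda>x. a \<bullet> jacobi_G x a"] nonneg assms(2,3) by simp
  then show ?thesis
    unfolding eq by (intro collinear_of_cauchy_schwarz_equality) simp
qed

text \<open>If \<open>J(\<pi>)\<close> is degenerate then the projection of \<open>\<pi>\<close> to the \<open>u\<close>-directions lies in a line.\<close>

lemma sum_jacobi_G_zero_span:
  assumes "finite E" "(\<Sum>x\<in>E. jacobi_G x a) = 0" "x \<in> span E"
  shows "(a \<bullet> a) *\<^sub>R pu x = (pu x \<bullet> a) *\<^sub>R a"
  using assms(3)
proof (induction rule: span_induct_alt)
  case (step c x y)
  have "(a \<bullet> a) *\<^sub>R pu (c *\<^sub>R x + y) = c *\<^sub>R ((a \<bullet> a) *\<^sub>R pu x) + (a \<bullet> a) *\<^sub>R pu y"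
    by (simp add: scaleR_add_right mult.commute)
  also have "\<dots> = (pu (c *\<^sub>R x + y) \<bullet> a) *\<^sub>R a"
    unfolding sum_jacobi_G_zero[OF assms(1,2) step(1)] step(2) by (simp add: inner_add_left scaleR_add_left)
  finally show ?case .
qed simp

text \<open>The operator is strictly triangular with respect to the three factors.\<close>

lemma operator_trace_jacobi_form:
  assumes "linear G" "linear C"
  shows "operator_trace (jacobi_form G C) = 0"
  unfolding operator_trace_def
proof (rule sum.neutral, intro ballI)
  fix b :: "'a \<times> 'a \<times> 'a"
  assume "b \<in> Basis"
  then show "jacobi_form G C b \<bullet> b = 0"
    by (auto simp: Basis_prod_def jacobi_form_def inner_Pair_0 linear_0[OF assms(1)] linear_0[OF assms(2)])
qed

text \<open>The \<open>V\<close>-component shifts the squared length: it is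
  \<open>height p + 2 * c\<close>, so every value, in particular 1 and -1, is attained at every
  point.\<close>

definition W_vec :: "real \<Rightarrow> 's::finite \<Rightarrow> 's space3" where
  "W_vec c i = (axis i 1, 0, c *\<^sub>R axis i 1)"

context separated_potential
begin

lemma curvature_tensor_eq:
  assumes "p \<in> M_F \<O>"
  shows "curvature_tensor (M_F \<O>) (g_F F) p x y z w = kulkarni_nomizu (B_form (pu p)) x y z w"
proof -
  have "(sig (pu p) * pu x) \<bullet> pu y = (sig (pu p) * pu y) \<bullet> pu x" for x y :: "'s space3"
    by (simp add: inner_vec_def mult_ac)
  then show ?thesis
    unfolding curvature_tensor_def curvature_M_F[OF assms] g_F_eq kulkarni_nomizu_def B_form_def
    by (simp add: inner_add_left inner_diff_left inner_commute algebra_simps)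
qed

definition height :: "'s space3 \<Rightarrow> real" where
  "height p = - 2 * F (pu p) - 2 * (pu p \<bullet> pt p)"

lemma curvature_homogeneous:
  "curvature_homogeneous_with_model (M_F \<O>) (g_F F) (g_model :: 's space3 \<Rightarrow> 's space3 \<Rightarrow> real) R_model"
  unfolding curvature_homogeneous_with_model_def
proof
  fix p assume p: "p \<in> M_F \<O>"
  define \<sigma> where "\<sigma> = sig (pu p)"
  \<comment> \<open>Adding half of \<open>\<sigma> * du\<close> to \<open>dt\<close> turns
    \<open>2 du dt\<close> into \<open>B\<close>. The \<sigma>-terms of the last entry cancel the
    resulting change of \<open>-|dt|^2\<close>; the final term supplies the coefficient of
    \<open>|du|^2\<close>.\<close>
  define \<Psi> :: "'s space3 \<Rightarrow> 's space3" where
    "\<Psi> x = (pu x, pt x + (1/2) *\<^sub>R (\<sigma> * pu x),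
      pv x + (1/2) *\<^sub>R (\<sigma> * pt x) + (1/8) *\<^sub>R (\<sigma> * (\<sigma> * pu x)) + (height p / 2) *\<^sub>R pu x)" for x
  have \<sigma>_inner: "(\<sigma> * a) \<bullet> b = a \<bullet> (\<sigma> * b)" for a b
    by (simp add: inner_vec_def mult_ac)
  have "linear \<Psi>"
    by (rule linearI) (auto simp: \<Psi>_def algebra_simps mult_scaleR_right)
  moreover have "bij \<Psi>"
    using \<open>linear \<Psi>\<close> by (rule linear_bijI) (auto simp: \<Psi>_def prod_eq_iff)
  moreover have "g_model (\<Psi> x) (\<Psi> y) = g_F F p x y" for x y
    by (simp add: g_model_def \<Psi>_def g_F_eq height_def inner_add_left inner_add_right \<sigma>_inner algebra_simps)
  moreover have "R_model (\<Psi> x) (\<Psi> y) (\<Psi> z) (\<Psi> w) = curvature_tensor (M_F \<O>) (g_F F) p x y z w" for x y z w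
  proof -
    have "model_form (\<Psi> x) (\<Psi> y) = B_form (pu p) x y" for x y
      by (simp add: model_form_def B_form_def \<Psi>_def inner_add_left inner_add_right \<sigma>_inner flip: \<sigma>_def)
    then show ?thesis
      unfolding R_model_eq curvature_tensor_eq[OF p] kulkarni_nomizu_def by (simp add: \<Psi>_def)
  qed
  ultimately show "\<exists>\<Psi> :: 's space3 \<Rightarrow> 's space3. linear \<Psi> \<and> bij \<Psi> \<and> (\<forall>x y. g_model (\<Psi> x) (\<Psi> y) = g_F F p x y) \<and>
      (\<forall>x y z w. R_model (\<Psi> x) (\<Psi> y) (\<Psi> z) (\<Psi> w) = curvature_tensor (M_F \<O>) (g_F F) p x y z w)"
    by (intro exI[of _ \<Psi>]) simp
qed

definition jacobi_C :: "real^'s \<Rightarrow> 's space3 \<Rightarrow> real^'s \<Rightarrow> real^'s" where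
  "jacobi_C u x a = B_form u x x *\<^sub>R a - ((sig u * a) \<bullet> pu x + a \<bullet> pt x) *\<^sub>R pu x
    + (pu x \<bullet> pu x) *\<^sub>R (sig u * a) - (a \<bullet> pu x) *\<^sub>R (sig u * pu x + pt x)"

lemma linear_jacobi_C: "linear (jacobi_C u x)"
  by (rule linearI) (auto simp: jacobi_C_def inner_add_left algebra_simps mult_scaleR_right)

lemma jacobi_C_selfadjoint: "jacobi_C u x a \<bullet> b = a \<bullet> jacobi_C u x b"
proof -
  have "(sig u * a) \<bullet> b = a \<bullet> (sig u * b)" for a b
    by (simp add: inner_vec_def mult_ac)
  then show ?thesis
    by (simp add: jacobi_C_def inner_add_left inner_diff_left inner_add_right inner_diff_right
        inner_commute algebra_simps)
qed

text \<open>Reflects \<open>J(x) x = 0\<close>: pairing its last entry with \<open>pu x\<close>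
  removes the contribution of \<open>jacobi_G x\<close>.\<close>

lemma jacobi_C_null: "pu x \<bullet> jacobi_C u x (pu x) = 0"
  by (simp add: jacobi_C_def B_form_def inner_add_left inner_diff_left inner_add_right inner_diff_right
      inner_commute algebra_simps)

lemma jacobi_eq:
  assumes "p \<in> M_F \<O>"
  shows "jacobi (M_F \<O>) (g_F F) p x = jacobi_form (jacobi_G x) (jacobi_C (pu p) x)"
  by (rule ext) (simp add: jacobi_def curvature_M_F[OF assms] jacobi_form_def jacobi_G_def jacobi_C_def
      B_form_def inner_commute algebra_simps)

lemma ricci_flat_M_F: "ricci_flat (M_F \<O>) (g_F F)"
  by (simp add: ricci_flat_def ricci_def jacobi_eq operator_trace_jacobi_form linear_jacobi_G linear_jacobi_C)

lemma g_F_W_vec: "g_F F p (W_vec c i) (W_vec d j) = (if i = j then height p + c + d else 0)"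
  by (auto simp: g_F_eq W_vec_def height_def inner_axis_axis)

lemma g_F_T_vec: "g_F F p (T_vec i) (T_vec j) = (if i = j then -1 else 0)"
  "g_F F p (T_vec i) (W_vec c j) = 0" "g_F F p (W_vec c j) (T_vec i) = 0"
  by (auto simp: g_F_eq W_vec_def inner_axis_axis)

lemma has_signature_g_F: "has_signature (g_F F p) (2 * CARD('s)) CARD('s)"
proof -
  \<comment> \<open>\<open>c\<close> makes \<open>W_vec c i\<close> timelike and \<open>d\<close>
    makes \<open>W_vec d i\<close> spacelike; as their sum is \<open>- height p\<close>, the two
    families are orthogonal.\<close>
  define c where "c = (- 1 - height p) / 2"
  define d where "d = (1 - height p) / 2"
  define N where "N = range (\<lambda>i. T_vec i :: 's space3) \<union> range (W_vec c)"
  define P where "P = range (W_vec d :: 's \<Rightarrow> 's space3)"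
  have "c \<noteq> d" by (simp add: c_def d_def)
  have cd: "height p + c + d = 0" "height p + d + c = 0"
    by (simp_all add: c_def d_def field_simps)
  have injT: "inj (\<lambda>i. T_vec i :: 's space3)" and injW: "inj (W_vec e :: 's \<Rightarrow> 's space3)" for e
    by (auto simp: inj_def W_vec_def axis_eq_axis)
  have neq: "T_vec i \<noteq> W_vec e j" "W_vec c i \<noteq> W_vec d j" for i j :: 's and e
    using \<open>c \<noteq> d\<close> by (auto simp: W_vec_def axis_eq_axis)
  have fin: "finite N" "finite P" by (simp_all add: N_def P_def)
  have "card N = CARD('s) + CARD('s)"
    unfolding N_def using neq by (subst card_Un_disjoint) (auto simp: card_image injT injW)
  moreover have cardP: "card P = CARD('s)"
    by (simp add: P_def card_image injW)
  moreover have "N \<inter> P = {}"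
    using neq by (auto simp: N_def P_def)
  ultimately have card: "card (N \<union> P) = 3 * CARD('s)"
    using fin by (simp add: card_Un_disjoint)
  have gN: "\<forall>x\<in>N. g_F F p x x = -1" and gP: "\<forall>x\<in>P. g_F F p x x = 1"
    by (auto simp: N_def P_def g_F_T_vec g_F_W_vec c_def d_def)
  have orth: "\<forall>x\<in>N \<union> P. \<forall>y\<in>N \<union> P. x \<noteq> y \<longrightarrow> g_F F p x y = 0"
    unfolding N_def P_def
    by (intro ballI impI; elim UnE rangeE; hypsubst) (auto simp: g_F_T_vec g_F_W_vec cd)
  have ind: "independent (N \<union> P)"
    using fin gN gP orth by (intro orthogonal_independent[OF bilinear_g_F[of F p]]) auto
  have "span (N \<union> P) = UNIV"
    using card_ge_dim_independent[OF subset_UNIV ind] card by auto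
  then show ?thesis
    unfolding has_signature_def
    using fin \<open>card N = _\<close> cardP ind gN gP orth by - (rule exI[of _ N], rule exI[of _ P], simp)
qed

text \<open>Source of the asymmetry between the two signs: a spacelike vector has a nonzero
  \<open>u\<close>-part, whereas \<open>T_vec i\<close> is timelike with \<open>u\<close>-part
  0.\<close>

lemma g_F_nonpos: "pu x = 0 \<Longrightarrow> g_F F p x x \<le> 0"
  by (simp add: g_F_eq)

section \<open>The Jordan Osserman conditions\<close>

lemma spacelike_jordan_osserman_M_F: "spacelike_jordan_osserman (M_F \<O>) (g_F F)"
proof -
  define e :: "real^'s" where "e = axis undefined 1"
  have e: "norm e = 1" by (simp add: e_def)
  obtain blocks where blocks: "jordan_nf (operator_matrix (shift_form (\<lambda>a. a - (e \<bullet> a) *\<^sub>R e))) blocks"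
    using jordan_nf_operator_exists by blast
  have lin: "linear (\<lambda>a. a - (e \<bullet> a) *\<^sub>R e)"
    by (rule linearI) (auto simp: inner_add_right algebra_simps)
  have "jordan_nf (operator_matrix (jacobi (M_F \<O>) (g_F F) p x)) blocks"
    if "p \<in> M_F \<O>" "g_F F p x x = 1" for p x
  proof (rule jordan_nf_conjugate[OF linear_shift_form[OF lin] _ blocks])
    have "pu x \<noteq> 0" using that(2) g_F_nonpos[of x p] by auto
    from jacobi_form_conjugate_projection[OF this linear_jacobi_C jacobi_C_selfadjoint jacobi_C_null e]
    show "conjugate_operators (jacobi (M_F \<O>) (g_F F) p x) (shift_form (\<lambda>a. a - (e \<bullet> a) *\<^sub>R e))"
      unfolding jacobi_eq[OF that(1)] by (simp add: jacobi_G_def[abs_def])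
  qed
  then show ?thesis
    unfolding jordan_osserman_def by blast
qed

text \<open>\<open>T_vec i\<close> has Jacobi operator 0, while that of a timelike
  \<open>W_vec c i\<close> does not annihilate the other directions \<open>U_vec j\<close>.\<close>

lemma not_timelike_jordan_osserman_M_F:
  assumes "\<O> \<noteq> {}" "CARD('s) \<ge> 2"
  shows "\<not> timelike_jordan_osserman (M_F \<O>) (g_F F)"
proof
  assume "timelike_jordan_osserman (M_F \<O>) (g_F F)"
  then obtain blocks where "\<forall>p\<in>M_F \<O>. \<forall>x. g_F F p x x = -1 \<longrightarrow>
      jordan_nf (operator_matrix (jacobi (M_F \<O>) (g_F F) p x)) blocks"
    unfolding jordan_osserman_def by (rule exE)
  then have blocks: "jordan_nf (operator_matrix (jacobi (M_F \<O>) (g_F F) p x)) blocks"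
    if "p \<in> M_F \<O>" "g_F F p x x = -1" for p x
    using that by blast
  obtain u where "u \<in> \<O>" using assms(1) by blast
  then have p: "(u, 0, 0) \<in> M_F \<O>" by (simp add: M_F_iff)
  obtain i j :: 's where ij: "i \<noteq> j"
    using assms(2) by (metis card_2_iff' ex_card UNIV_I)
  define c where "c = (- 1 - height (u, 0, 0)) / 2"
  have "jacobi (M_F \<O>) (g_F F) (u, 0, 0) (T_vec i) = (\<lambda>_. 0)"
    unfolding jacobi_eq[OF p]
    by (rule ext) (simp add: jacobi_form_def jacobi_G_def jacobi_C_def B_form_def zero_prod_def)
  then have zero: "jordan_nf (operator_matrix (\<lambda>_ :: 's space3. 0)) blocks"
    using blocks[OF p, of "T_vec i"] by (simp add: g_F_T_vec)
  have W: "jordan_nf (operator_matrix (jacobi_form (jacobi_G (W_vec c i)) (jacobi_C u (W_vec c i)))) blocks"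
    using blocks[OF p, of "W_vec c i"] unfolding jacobi_eq[OF p] by (simp add: g_F_W_vec c_def)
  have "jacobi_form (jacobi_G (W_vec c i)) (jacobi_C u (W_vec c i)) (axis j 1, 0, 0) = 0"
    by (rule jordan_nf_zero_operator[OF linear_jacobi_form[OF linear_jacobi_G linear_jacobi_C] W zero])
  then have "jacobi_G (W_vec c i) (axis j 1) = 0"
    by (simp add: jacobi_form_def zero_prod_def)
  then show False
    using ij by (simp add: jacobi_G_def W_vec_def inner_axis_axis)
qed

lemma sum_jacobi_eq:
  assumes "p \<in> M_F \<O>"
  shows "(\<lambda>y. \<Sum>e\<in>E. jacobi (M_F \<O>) (g_F F) p e y) =
    jacobi_form (\<lambda>a. \<Sum>e\<in>E. jacobi_G e a) (\<lambda>a. \<Sum>e\<in>E. jacobi_C (pu p) e a)"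
  by (rule ext) (simp add: jacobi_eq[OF assms] jacobi_form_def prod_eq_iff fst_sum snd_sum sum_negf sum.distrib)

lemma linear_sum_jacobi:
  "linear (\<lambda>a. \<Sum>e\<in>E. jacobi_G e a)" "linear (\<lambda>a. \<Sum>e\<in>E. jacobi_C u e a)"
  by (intro linear_compose_sum ballI linear_jacobi_G linear_jacobi_C)+

lemma sum_jacobi_conjugate_shift:
  assumes "p \<in> M_F \<O>" "\<And>a. (\<Sum>e\<in>E. jacobi_G e a) = 0 \<Longrightarrow> a = 0"
  shows "conjugate_operators (\<lambda>y. \<Sum>e\<in>E. jacobi (M_F \<O>) (g_F F) p e y) (shift_form (\<lambda>a. a))"
  unfolding sum_jacobi_eq[OF assms(1)]
  by (rule jacobi_form_conjugate_shift[OF linear_sum_jacobi(1) assms(2) linear_sum_jacobi(2)])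

text \<open>\<open>pu x \<bullet> a = 0\<close> and \<open>\<Phi> x = 0\<close> are
  \<open>DIM('b) + 1\<close> conditions, so some nonzero \<open>x\<close> of the plane meets them.
  If \<open>a\<close> were a nonzero kernel vector, \<open>pu x\<close> would be parallel to
  \<open>a\<close>, hence 0, and \<open>null\<close> would contradict definiteness.\<close>

lemma sum_jacobi_G_nondegenerate:
  fixes \<Phi> :: "'s space3 \<Rightarrow> 'b::euclidean_space"
  assumes plane: "definite_plane \<epsilon> k b \<pi>" "orthonormal_basis_of \<epsilon> b \<pi> E"
    and \<Phi>: "DIM('b) + 1 < k" "linear \<Phi>"
    and null: "\<And>x. pu x = 0 \<Longrightarrow> \<Phi> x = 0 \<Longrightarrow> \<epsilon> * b x x \<le> 0"
    and zero: "(\<Sum>e\<in>E. jacobi_G e a) = 0"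
  shows "a = 0"
proof (rule ccontr)
  assume "a \<noteq> 0"
  have E: "finite E" "span E = \<pi>" using plane(2) by (auto simp: orthonormal_basis_of_def)
  have \<pi>: "Real_Vector_Spaces.subspace \<pi>" "dim \<pi> = k" using plane(1) by (auto simp: definite_plane_def)
  have "linear (\<lambda>x. (pu x \<bullet> a, \<Phi> x))"
    by (rule linearI) (auto simp: inner_add_left linear_add[OF \<Phi>(2)] linear_cmul[OF \<Phi>(2)])
  from linear_kernel_exists[OF this \<pi>(1)] obtain x where x: "x \<in> \<pi>" "x \<noteq> 0" "pu x \<bullet> a = 0" "\<Phi> x = 0"
    using \<Phi>(1) \<pi>(2) by (auto simp: zero_prod_def)
  then have "(a \<bullet> a) *\<^sub>R pu x = 0"
    using sum_jacobi_G_zero_span[OF E(1) zero, of x] E(2) by simp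
  then have "pu x = 0" using \<open>a \<noteq> 0\<close> by simp
  then show False
    using null[of x] x plane(1) by (force simp: definite_plane_def)
qed

lemma higher_jordan_ossermanI:
  assumes "\<And>p \<pi> E a. p \<in> M_F \<O> \<Longrightarrow> definite_plane \<epsilon> k (g_F F p) \<pi> \<Longrightarrow>
    orthonormal_basis_of \<epsilon> (g_F F p) \<pi> E \<Longrightarrow> (\<Sum>e\<in>E. jacobi_G e a) = 0 \<Longrightarrow> a = 0"
  shows "higher_jordan_osserman \<epsilon> k (M_F \<O>) (g_F F)"
proof -
  obtain blocks where blocks: "jordan_nf (operator_matrix (shift_form (\<lambda>a :: real^'s. a))) blocks"
    using jordan_nf_operator_exists by blast
  then show ?thesis
    unfolding higher_jordan_osserman_def
    by (intro exI[of _ blocks] ballI allI impI jordan_nf_conjugate[OF linear_shift_form[OF linear_ident] _ blocks]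
        sum_jacobi_conjugate_shift) (use assms in blast)+
qed

text \<open>The single condition \<open>pu x \<bullet> a = 0\<close> suffices here, since
  \<open>pu x = 0\<close> alone already excludes a spacelike vector; this needs a plane of dimension
  2.\<close>

lemma spacelike_higher_jordan_osserman_M_F:
  assumes "2 \<le> k"
  shows "spacelike_higher_jordan_osserman k (M_F \<O>) (g_F F)"
proof (rule higher_jordan_ossermanI)
  fix p \<pi> E a
  assume plane: "definite_plane 1 k (g_F F p) \<pi>" "orthonormal_basis_of 1 (g_F F p) \<pi> E"
    and zero: "(\<Sum>e\<in>E. jacobi_G e a) = 0"
  have E: "finite E" "span E = \<pi>" using plane(2) by (auto simp: orthonormal_basis_of_def)
  show "a = 0"
  proof (rule ccontr)
    assume "a \<noteq> 0"
    have "linear (\<lambda>x :: 's space3. pu x \<bullet> a)"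
      by (rule linearI) (auto simp: inner_add_left)
    from linear_kernel_exists[OF this, of \<pi>] obtain x where x: "x \<in> \<pi>" "x \<noteq> 0" "pu x \<bullet> a = 0"
      using plane(1) assms by (auto simp: definite_plane_def)
    then have "pu x = 0"
      using sum_jacobi_G_zero_span[OF E(1) zero, of x] E(2) \<open>a \<noteq> 0\<close> by simp
    then show False
      using x plane(1) g_F_nonpos[of x p] by (force simp: definite_plane_def)
  qed
qed

lemma timelike_higher_jordan_osserman_M_F:
  assumes "CARD('s) + 2 \<le> k"
  shows "timelike_higher_jordan_osserman k (M_F \<O>) (g_F F)"
proof (rule higher_jordan_ossermanI)
  fix p \<pi> E a
  assume plane: "definite_plane (-1) k (g_F F p) \<pi>" "orthonormal_basis_of (-1) (g_F F p) \<pi> E"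
    and zero: "(\<Sum>e\<in>E. jacobi_G e a) = 0"
  show "a = 0"
  proof (rule sum_jacobi_G_nondegenerate[OF plane _ _ _ zero, of "\<lambda>x. pt x"])
    show "DIM(real^'s) + 1 < k" using assms by simp
    show "linear (\<lambda>x :: 's space3. pt x)" by (rule linearI) auto
    show "- 1 * g_F F p x x \<le> 0" if "pu x = 0" "pt x = 0" for x
      using that by (simp add: g_F_eq)
  qed
qed

lemma not_timelike_higher_jordan_osserman_M_F:
  assumes "\<O> \<noteq> {}" "CARD('s) \<ge> 2" "2 \<le> k" "k \<le> CARD('s) + 1"
  shows "\<not> timelike_higher_jordan_osserman k (M_F \<O>) (g_F F)"
proof
  assume "timelike_higher_jordan_osserman k (M_F \<O>) (g_F F)"
  then obtain blocks where "\<forall>p\<in>M_F \<O>. \<forall>\<pi> E. definite_plane (-1) k (g_F F p) \<pi> \<longrightarrow>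
      orthonormal_basis_of (-1) (g_F F p) \<pi> E \<longrightarrow>
      jordan_nf (operator_matrix (\<lambda>y. \<Sum>e\<in>E. jacobi (M_F \<O>) (g_F F) p e y)) blocks"
    unfolding higher_jordan_osserman_def by (rule exE)
  then have blocks: "jordan_nf (operator_matrix (\<lambda>y. \<Sum>e\<in>E. jacobi (M_F \<O>) (g_F F) p e y)) blocks"
    if "p \<in> M_F \<O>" "definite_plane (-1) k (g_F F p) \<pi>" "orthonormal_basis_of (-1) (g_F F p) \<pi> E" for p \<pi> E
    using that by blast
  obtain u where "u \<in> \<O>" using assms(1) by blast
  define p :: "'s space3" where "p = (u, 0, 0)"
  have p: "p \<in> M_F \<O>" using \<open>u \<in> \<O>\<close> by (simp add: M_F_iff p_def)
  obtain i j :: 's where ij: "i \<noteq> j"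
    using assms(2) by (metis card_2_iff' ex_card UNIV_I)
  define c where "c = (- 1 - height p) / 2"
  let ?T = "\<lambda>i. T_vec i :: 's space3"
  have injT: "inj ?T" and injW: "inj (W_vec c :: 's \<Rightarrow> 's space3)"
    by (auto simp: inj_def W_vec_def axis_eq_axis)
  have neq: "?T i \<noteq> W_vec c j" for i j
    by (auto simp: W_vec_def)
  have family: "jordan_nf (operator_matrix (\<lambda>y. \<Sum>e\<in>W_vec c ` I \<union> ?T ` J. jacobi (M_F \<O>) (g_F F) p e y)) blocks"
    if "card I + card J = k" for I J
  proof -
    let ?E = "W_vec c ` I \<union> ?T ` J"
    have "card ?E = k"
      using that neq injT injW by (subst card_Un_disjoint) (auto simp: card_image inj_on_subset)
    moreover have "g_F F p e e = -1" if "e \<in> ?E" for e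
      using that by (auto simp: g_F_T_vec g_F_W_vec c_def)
    moreover have "g_F F p e e' = 0" if "e \<in> ?E" "e' \<in> ?E" "e \<noteq> e'" for e e'
      using that by (auto simp: g_F_T_vec g_F_W_vec split: if_splits)
    ultimately show ?thesis
      using orthonormal_span_definite[OF bilinear_g_F[of F p], of "-1" ?E] by (intro blocks[OF p, of "span ?E"]) auto
  qed
  obtain J :: "'s set" where J: "card J = k - 2"
    by (rule obtain_subset_with_card_n[of "k - 2" "UNIV :: 's set"]) (use assms(3,4) in auto)
  obtain J' :: "'s set" where J': "card J' = k - 1"
    by (rule obtain_subset_with_card_n[of "k - 1" "UNIV :: 's set"]) (use assms(3,4) in auto)
  \<comment> \<open>Two timelike planes of dimension \<open>k\<close>: the
    \<open>u\<close>-projection of the first is spanned by two axes, that of the second is a line.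
    The second takes \<open>k - 1\<close> of the \<open>T_vec\<close>, which is possible up to
    \<open>k = s + 1\<close>.\<close>
  let ?A = "W_vec c ` {i, j} \<union> ?T ` J" and ?B = "W_vec c ` {i} \<union> ?T ` J'"
  have "a = 0" if "(\<Sum>e\<in>?A. jacobi_G e a) = 0" for a
  proof -
    have "(a \<bullet> a) *\<^sub>R pu (W_vec c l) = (pu (W_vec c l) \<bullet> a) *\<^sub>R a" if "l \<in> {i, j}" for l
      using that by (intro sum_jacobi_G_zero[OF _ \<open>(\<Sum>e\<in>?A. _) = 0\<close>]) auto
    then have *: "(a \<bullet> a) *\<^sub>R axis l 1 = (a $ l) *\<^sub>R a" if "l \<in> {i, j}" for l
      using that by (simp add: W_vec_def inner_axis')
    have "a \<bullet> a = a $ i * a $ i" "a \<bullet> a = a $ j * a $ j" "0 = a $ i * a $ j"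
      using arg_cong[OF *[of i], of "\<lambda>v. v $ i"] arg_cong[OF *[of j], of "\<lambda>v. v $ j"]
        arg_cong[OF *[of i], of "\<lambda>v. v $ j"] ij by (auto simp: axis_def)
    then show ?thesis by auto
  qed
  from conjugate_operators_similar[OF linear_shift_form[OF linear_ident] sum_jacobi_conjugate_shift[OF p this]]
  have "similar_mat (operator_matrix (shift_form (\<lambda>a :: real^'s. a)))
      (operator_matrix (\<lambda>y. \<Sum>e\<in>?A. jacobi (M_F \<O>) (g_F F) p e y))"
    by (rule similar_mat_sym)
  moreover have "jordan_nf (operator_matrix (\<lambda>y. \<Sum>e\<in>?A. jacobi (M_F \<O>) (g_F F) p e y)) blocks"
    using J ij assms(3) by (intro family) simp
  ultimately have "jordan_nf (operator_matrix (shift_form (\<lambda>a :: real^'s. a))) blocks"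
    unfolding jordan_nf_def using similar_mat_trans by blast
  moreover have "jordan_nf (operator_matrix (\<lambda>y. \<Sum>e\<in>?B. jacobi (M_F \<O>) (g_F F) p e y)) blocks"
    using assms(3) J' by (intro family) simp
  moreover define G where "G a = (\<Sum>e\<in>?B. jacobi_G e a)" for a
  moreover define C where "C a = (\<Sum>e\<in>?B. jacobi_C (pu p) e a)" for a
  ultimately have nf: "jordan_nf (operator_matrix (jacobi_form G C)) blocks"
    "jordan_nf (operator_matrix (shift_form (\<lambda>a :: real^'s. a))) blocks"
    unfolding sum_jacobi_eq[OF p] G_def[abs_def] C_def[abs_def] by auto
  have lin: "linear G" "linear C"
    unfolding G_def[abs_def] C_def[abs_def] by (rule linear_sum_jacobi)+
  \<comment> \<open>The shift satisfies the kernel-image identity with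
    \<open>X (a, b, c) = (b, c, 0)\<close> and \<open>Y (a, b, c) = (c, 0, 0)\<close>. For the
    second plane \<open>U_vec i\<close> lies in the kernel of the square, yet no image vector has a
    \<open>u\<close>-part.\<close>
  have "\<exists>x. jacobi_form G C x \<bullet> (axis i 1, 0, 0) \<noteq> 0"
  proof (rule jordan_nf_kernel_image[OF nf linear_jacobi_form[OF lin] linear_shift_form[OF linear_ident]])
    show "linear (\<lambda>y :: 's space3. (pv y, 0, 0) :: 's space3)"
      by (rule linearI) auto
    show "shift_form (\<lambda>a. a) (pt x, pv x, 0) + (pv (shift_form (\<lambda>a. a) (shift_form (\<lambda>a. a) x)), 0, 0) = x"
      for x :: "'s space3"
      by (simp add: shift_form_def prod_eq_iff)
    show "(axis i 1, 0, 0) \<in> (Basis :: 's space3 set)"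
      unfolding Basis_prod_def zero_prod_def
      by (rule UnI1, rule image_eqI[of _ _ "axis i 1"]) (simp_all add: axis_in_Basis_iff)
    have "jacobi_G e (axis i 1) = 0" if "e \<in> ?B" for e
      using that by (auto simp: jacobi_G_def W_vec_def inner_axis_axis)
    then have "G (axis i 1) = 0"
      unfolding G_def by (intro sum.neutral) blast
    then show "jacobi_form G C (jacobi_form G C (axis i 1, 0, 0)) = 0"
      by (simp add: jacobi_form_def linear_0[OF lin(1)] linear_0[OF lin(2)] zero_prod_def)
  qed
  then show False
    by (simp add: jacobi_form_def)
qed

end

section \<open>The local isometry invariant\<close>

lemma orthogonal_pair_exists:
  fixes a :: "real^'s::finite"
  assumes "CARD('s) \<ge> 2"
  obtains b where "b \<noteq> 0" "a \<bullet> b = 0"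
proof -
  have "2 \<le> DIM(real^'s)" using assms by simp
  from orthogonal_to_vector_exists[OF this, of a] show thesis
    using that unfolding Linear_Algebra.orthogonal_def by blast
qed

lemma third_element_exists:
  fixes i j :: "'s::finite"
  assumes "CARD('s) \<ge> 3"
  obtains l where "l \<noteq> i" "l \<noteq> j"
proof (rule ccontr)
  assume "\<not> thesis"
  then have "UNIV = {i, j}" using that by blast
  moreover have "card {i, j} \<le> 2" by (simp add: card_insert_if)
  ultimately show False using assms by simp
qed

text \<open>In the application \<open>Q\<close> acts on \<open>u\<close>-parts, \<open>R\<close> on
  \<open>t\<close>-parts, and \<open>rel\<close> is the \<open>t\<close>-part of the invariance of
  curvature. Its left side is orthogonal to \<open>Q z\<close>, which makes \<open>Q z\<close> a
  multiple of \<open>R z\<close>. On orthogonal pairs the factors satisfy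
  \<open>c^2 d = d^2 c = 1\<close>, so both are 1.\<close>

lemma orthogonal_factor_unique:
  fixes Q R :: "real^'s::finite \<Rightarrow> real^'s"
  assumes card: "CARD('s) \<ge> 2" and R: "orthogonal_transformation R"
    and rel: "\<And>x y z. (Q x \<bullet> Q z) *\<^sub>R Q y - (Q y \<bullet> Q z) *\<^sub>R Q x = R ((x \<bullet> z) *\<^sub>R y - (y \<bullet> z) *\<^sub>R x)"
    and Q: "linear Q"
  shows "Q = R"
proof
  have R_inner: "R x \<bullet> R y = x \<bullet> y" and lin_R: "linear R" for x y
    using R by (auto simp: orthogonal_transformation_def)
  have surj_R: "surj R" by (rule orthogonal_transformation_surj[OF R])
  have eigen: "\<exists>c. Q z = c *\<^sub>R R z" if "z \<noteq> 0" for z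
  proof
    define c where "c = (R z \<bullet> Q z) / (z \<bullet> z)"
    have *: "(x \<bullet> z) * (R y \<bullet> Q z) = (y \<bullet> z) * (R x \<bullet> Q z)" for x y
    proof -
      have "((Q x \<bullet> Q z) *\<^sub>R Q y - (Q y \<bullet> Q z) *\<^sub>R Q x) \<bullet> Q z = 0"
        by (simp add: inner_diff_left)
      then show ?thesis
        unfolding rel by (simp add: linear_diff[OF lin_R] linear_cmul[OF lin_R] inner_diff_left)
    qed
    have "R y \<bullet> (Q z - c *\<^sub>R R z) = 0" for y
      using *[of z y] that by (simp add: inner_diff_right R_inner c_def field_simps)
    moreover obtain y where "R y = Q z - c *\<^sub>R R z"
      using surj_R by (metis surjD)
    ultimately have "(Q z - c *\<^sub>R R z) \<bullet> (Q z - c *\<^sub>R R z) = 0"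
      by metis
    then show "Q z = c *\<^sub>R R z" by simp
  qed
  fix z
  show "Q z = R z"
  proof (cases "z = 0")
    case True
    then show ?thesis by (simp add: linear_0[OF Q] linear_0[OF lin_R])
  next
    case False
    obtain y where y: "y \<noteq> 0" "z \<bullet> y = 0"
      using orthogonal_pair_exists[OF card] by blast
    obtain c d where c: "Q z = c *\<^sub>R R z" and d: "Q y = d *\<^sub>R R y"
      using eigen y(1) False by metis
    have eq: "c' * c' * d' = 1" if "Q z' = c' *\<^sub>R R z'" "Q y' = d' *\<^sub>R R y'" "z' \<noteq> 0" "y' \<noteq> 0" "z' \<bullet> y' = 0"
      for c' d' z' y'
    proof -
      have "(c' * c' * (z' \<bullet> z') * d') *\<^sub>R R y' = (z' \<bullet> z') *\<^sub>R R y'"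
        using rel[of z' z' y'] that(5)
        by (simp add: that(1,2) R_inner inner_commute[of y' z'] linear_cmul[OF lin_R] mult_ac)
      moreover have "R y' \<noteq> 0" using R_inner[of y' y'] that(4) by auto
      ultimately have "c' * c' * (z' \<bullet> z') * d' = z' \<bullet> z'" by simp
      then show ?thesis using that(3) by (simp add: field_simps)
    qed
    have cd: "c * c * d = 1" "d * d * c = 1"
      using eq[OF c d] eq[OF d c] y False by (simp_all add: inner_commute)
    have "c * (c * d) = d * (c * d)" using cd by (simp add: mult_ac)
    moreover have "c * d \<noteq> 0" using cd(1) by auto
    ultimately have "c = d" by simp
    then have "(c - 1) * (c * c + c + 1) = 0"
      using cd(1) by (simp add: algebra_simps)
    moreover have "0 \<le> (c + 1 / 2) * (c + 1 / 2)" by (rule zero_le_square)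
    then have "c * c + c + 1 \<noteq> 0" by (simp add: algebra_simps)
    ultimately have "c = 1" by simp
    then show ?thesis using c by simp
  qed
qed

text \<open>
  The cubic form of \<open>c * x * x * x\<close> is the associative algebra of componentwise multiplication
  scaled by \<open>c\<close>; if an orthogonal change of basis alters it only by \<open>m\<close> times the metric, then
  commutativity of multiplication operators forces \<open>m = 0\<close> in dimension at least three.
\<close>

lemma componentwise_cubic_rigid:
  fixes c c' m :: "real^'s::finite" and Q :: "real^'s \<Rightarrow> real^'s"
  assumes card: "CARD('s) \<ge> 3" and Q: "orthogonal_transformation Q"
    and cubic: "\<And>z i j. (c' * Q z * Q (axis i 1)) \<bullet> Q (axis j 1) =
      (c * z * axis i 1 + (m \<bullet> z) *\<^sub>R axis i 1 + (z $ i) *\<^sub>R m + (m $ i) *\<^sub>R z) $ j"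
  shows "m = 0"
proof -
  define V where "V z i = c * z * axis i 1 + (m \<bullet> z) *\<^sub>R axis i 1 + (z $ i) *\<^sub>R m + (m $ i) *\<^sub>R z" for z i
  have Q_inner: "Q x \<bullet> Q y = x \<bullet> y" for x y
    using Q by (auto simp: orthogonal_transformation_def)
  have product: "c' * Q z * Q (axis i 1) = Q (V z i)" for z i
  proof -
    obtain y where y: "c' * Q z * Q (axis i 1) = Q y"
      using orthogonal_transformation_surj[OF Q] by (metis surjD)
    have "y $ j = V z i $ j" for j
      using cubic[of z i j] unfolding y V_def[symmetric] Q_inner by (simp add: inner_axis)
    then have "y = V z i"
      by (simp add: Finite_Cartesian_Product.vec_eq_iff)
    then show ?thesis unfolding y by simp
  qed
  have V_commute: "V (V z k) j = V (V z j) k" for z j k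
  proof -
    have "Q (V (V z k) j) = Q (V (V z j) k)"
      unfolding product[symmetric] by (simp add: mult_ac)
    then show ?thesis
      using orthogonal_transformation_inj[OF Q] by (auto dest: injD)
  qed
  have m_axis: "m \<bullet> axis i 1 = m $ i" for i by (simp add: inner_axis)
  have axis_mult: "axis i 1 * axis k 1 = (0 :: real^'s)" if "i \<noteq> k" for i k
    using that by (simp add: Finite_Cartesian_Product.vec_eq_iff axis_def)
  have prod0: "m $ i * m $ k = 0" if "i \<noteq> k" for i k
  proof -
    obtain j where j: "j \<noteq> i" "j \<noteq> k" by (rule third_element_exists[OF card])
    \<comment> \<open>For three distinct indices the two sides are \<open>2 m_i m_k\<close> and
      \<open>m_i m_k\<close>.\<close>
    have "V (V (axis i 1) k) j $ j = V (V (axis i 1) j) k $ j" by (simp add: V_commute)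
    then show ?thesis
      using that j axis_mult[of i k] axis_mult[of i j]
      by (auto simp: V_def axis_def inner_add_right m_axis[unfolded axis_def] algebra_simps)
  qed
  have norm: "m \<bullet> m = 0" if "j \<noteq> k" "m $ j = 0" "m $ k = 0" for j k
  proof -
    \<comment> \<open>The left side vanishes because \<open>V (axis j 1) k = 0\<close>; the right
      side reduces to \<open>m \<bullet> m\<close>.\<close>
    have "V (V (axis j 1) k) j $ k = V (V (axis j 1) j) k $ k" by (simp add: V_commute)
    moreover have "c * (axis j 1 * axis j 1) = (c $ j) *\<^sub>R axis j 1"
      by (simp add: Finite_Cartesian_Product.vec_eq_iff axis_def)
    ultimately show ?thesis
      using that axis_mult[of j k]
      by (auto simp: V_def axis_def inner_add_right m_axis[unfolded axis_def] algebra_simps)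
  qed
  show ?thesis
  proof (rule ccontr)
    assume "m \<noteq> 0"
    then obtain i where i: "m $ i \<noteq> 0"
      by (auto simp: Finite_Cartesian_Product.vec_eq_iff)
    obtain j where j: "j \<noteq> i" "j \<noteq> i" by (rule third_element_exists[OF card])
    obtain k where "k \<noteq> i" "k \<noteq> j" by (rule third_element_exists[OF card])
    with j have "m \<bullet> m = 0"
      using prod0[of i j] prod0[of i k] i by (intro norm[of j k]) auto
    then show False using \<open>m \<noteq> 0\<close> by simp
  qed
qed

text \<open>
  \<open>E z a\<close> is the difference at \<open>(z, a, a)\<close> of the two cubic forms \<open>F''' + 3 (u \<bullet> du) |du|\<^sup>2\<close>; the
  hypothesis on \<open>E\<close> is all that the invariance of the derivative of the curvature provides.
\<close>

lemma alpha_rigid: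
  fixes c c' u u' :: "real^'s::finite" and Q :: "real^'s \<Rightarrow> real^'s"
  defines "E z a \<equiv> (c' * Q z * Q a) \<bullet> Q a + (u' \<bullet> Q z) * (a \<bullet> a) + 2 * (z \<bullet> a) * (Q a \<bullet> u' - a \<bullet> u)
    - (c * z * a) \<bullet> a - (u \<bullet> z) * (a \<bullet> a)"
  assumes card: "CARD('s) \<ge> 2" and Q: "orthogonal_transformation Q"
    and E: "\<And>z a b. a \<bullet> b = 0 \<Longrightarrow> (b \<bullet> b) * E z a + (a \<bullet> a) * E z b = 0"
  shows "(c + 4 *\<^sub>R u) \<bullet> (c + 4 *\<^sub>R u) = (c' + 4 *\<^sub>R u') \<bullet> (c' + 4 *\<^sub>R u')"
proof -
  have Q_inner: "Q x \<bullet> Q y = x \<bullet> y" and lin_Q: "linear Q" for x y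
    using Q by (auto simp: orthogonal_transformation_def)
  have surj_Q: "surj Q" by (rule orthogonal_transformation_surj[OF Q])
  obtain u'' where u'': "u' = Q u''" using surj_Q by (metis surjD)
  define m where "m = u - u''"
  have E_m: "E z a = (c' * Q z * Q a) \<bullet> Q a - (c * z * a) \<bullet> a - (m \<bullet> z) * (a \<bullet> a) - 2 * (z \<bullet> a) * (m \<bullet> a)" for z a
    unfolding E_def u'' Q_inner m_def inner_diff_left inner_commute[of a u''] inner_commute[of a u]
    by (simp add: algebra_simps)
  have E_axis: "E z (axis i 1) + E z (axis j 1) = 0" if "i \<noteq> j" for z i j
    using E[of "axis i 1" "axis j 1" z] that by (simp add: inner_axis_axis)
  \<comment> \<open>Three mutually orthogonal axes have pairwise opposite values of
    \<open>E z\<close>, which forces each value to be 0. With two axes only their sum, the trace, is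
    controlled.\<close>
  have big: "CARD('s) = 2 \<or> (m = 0 \<and> (\<forall>z i. E z (axis i 1) = 0))"
  proof (rule disjCI)
    assume "\<not> (m = 0 \<and> (\<forall>z i. E z (axis i 1) = 0))"
    show "CARD('s) = 2"
    proof (rule ccontr)
      assume "CARD('s) \<noteq> 2"
      then have card3: "CARD('s) \<ge> 3" using card by simp
      have diag: "E z (axis i 1) = 0" for z i
      proof -
        obtain j where j: "j \<noteq> i" "j \<noteq> i" by (rule third_element_exists[OF card3])
        obtain k where "k \<noteq> i" "k \<noteq> j" by (rule third_element_exists[OF card3])
        with j show ?thesis using E_axis[of i j z] E_axis[of i k z] E_axis[of j k z] by simp
      qed
      have off: "E z (axis i 1 + axis j 1) = 0" if "i \<noteq> j" for z i j
      proof -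
        obtain k where "k \<noteq> i" "k \<noteq> j" by (rule third_element_exists[OF card3])
        then have "(axis i 1 + axis j 1) \<bullet> (axis k 1 :: real^'s) = 0"
          by (simp add: inner_add_left inner_axis_axis)
        from E[OF this, of z] show ?thesis by (simp add: diag inner_axis_axis)
      qed
      have "m = 0"
      proof (rule componentwise_cubic_rigid[OF card3 Q])
        fix z i j
        have sym: "(c' * Q z * b) \<bullet> a = (c' * Q z * a) \<bullet> b" "(c * z * b) \<bullet> a = (c * z * a) \<bullet> b" for a b
          by (simp_all add: inner_vec_def mult_ac)
        show "(c' * Q z * Q (axis i 1)) \<bullet> Q (axis j 1) =
          (c * z * axis i 1 + (m \<bullet> z) *\<^sub>R axis i 1 + (z $ i) *\<^sub>R m + (m $ i) *\<^sub>R z) $ j"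
        proof (cases "i = j")
          case True
          then show ?thesis
            using diag[of z i] unfolding E_m by (simp add: inner_axis inner_axis_axis axis_nth algebra_simps)
        next
          case False
          then have ax: "axis i 1 $ j = (0 :: real)" "axis j 1 $ i = (0 :: real)"
            by (simp_all add: axis_def)
          \<comment> \<open>Polarization: the values on axes and on sums of two axes determine the
            off-diagonal entries of the quadratic form \<open>E z\<close>.\<close>
          have "E z (axis i 1 + axis j 1) = E z (axis i 1) + E z (axis j 1) +
            2 * ((c' * Q z * Q (axis i 1)) \<bullet> Q (axis j 1)
              - (c * z * axis i 1 + (m \<bullet> z) *\<^sub>R axis i 1 + (z $ i) *\<^sub>R m + (m $ i) *\<^sub>R z) $ j)"
            unfolding E_m linear_add[OF lin_Q] distrib_left inner_add_left inner_add_right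
              sym(1)[of "Q (axis j 1)" "Q (axis i 1)"] sym(2)[of "axis j 1" "axis i 1"]
            using False ax by (simp add: inner_axis inner_axis' inner_axis_axis algebra_simps)
          then show ?thesis using off[OF False] diag by simp
        qed
      qed
      then show False using diag \<open>\<not> (m = 0 \<and> _)\<close> by blast
    qed
  qed
  have trace: "(\<Sum>i\<in>UNIV. E z (axis i 1)) = c' \<bullet> Q z - c \<bullet> z - (real CARD('s) + 2) * (m \<bullet> z)" for z
  proof -
    \<comment> \<open>Rows of the matrix of \<open>Q\<close> are unit vectors too, because
      \<open>Q\<close> is also onto.\<close>
    have rows: "(\<Sum>i\<in>UNIV. (Q (axis i 1) $ k)\<^sup>2) = 1" for k
    proof -
      obtain r where r: "axis k 1 = Q r" using surj_Q by (metis surjD)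
      have "Q (axis i 1) $ k = r $ i" for i
        using Q_inner[of "axis i 1" r] unfolding r[symmetric] by (simp add: inner_axis inner_axis')
      then have "(\<Sum>i\<in>UNIV. (Q (axis i 1) $ k)\<^sup>2) = r \<bullet> r"
        by (simp add: inner_vec_def power2_eq_square)
      also have "\<dots> = 1" using Q_inner[of r r] unfolding r[symmetric] by (simp add: inner_axis_axis)
      finally show ?thesis .
    qed
    have "(\<Sum>i\<in>UNIV. (c' * Q z * Q (axis i 1)) \<bullet> Q (axis i 1)) =
        (\<Sum>i\<in>UNIV. \<Sum>k\<in>UNIV. c' $ k * Q z $ k * (Q (axis i 1) $ k)\<^sup>2)"
      by (simp add: inner_vec_def power2_eq_square mult_ac)
    also have "\<dots> = (\<Sum>k\<in>UNIV. c' $ k * Q z $ k * (\<Sum>i\<in>UNIV. (Q (axis i 1) $ k)\<^sup>2))"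
      unfolding sum_distrib_left by (rule sum.swap)
    also have "\<dots> = c' \<bullet> Q z"
      by (simp add: rows inner_vec_def)
    finally have 1: "(\<Sum>i\<in>UNIV. (c' * Q z * Q (axis i 1)) \<bullet> Q (axis i 1)) = c' \<bullet> Q z" .
    have 2: "(\<Sum>i\<in>UNIV. (c * z * axis i 1) \<bullet> axis i 1) = c \<bullet> z"
      by (simp add: inner_axis axis_nth inner_vec_def[of c z])
    have 3: "(\<Sum>i\<in>UNIV. 2 * (z \<bullet> axis i 1) * (m \<bullet> axis i 1)) = 2 * (m \<bullet> z)"
      by (simp add: inner_axis inner_vec_def[of m z] sum_distrib_left mult_ac)
    show ?thesis
      unfolding E_m sum_subtractf 1 2 3 by (simp add: inner_axis_axis algebra_simps)
  qed
  \<comment> \<open>The trace has the factor s + 2 in front of \<open>m \<bullet> z\<close>. This is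
    4 for s = 2, and otherwise \<open>m = 0\<close>, so 4 may be written in both cases.\<close>
  have "c' \<bullet> Q z - c \<bullet> z - 4 * (m \<bullet> z) = 0" for z
    using big
  proof
    assume two: "CARD('s) = 2"
    then obtain i j :: 's where ij: "UNIV = {i, j}" "i \<noteq> j"
      by (meson card_2_iff)
    have "(\<Sum>l\<in>{i, j}. E z (axis l 1)) = 0"
      using ij(2) E_axis[of i j z] by simp
    then have "(\<Sum>l\<in>UNIV. E z (axis l 1)) = 0"
      unfolding ij(1) .
    then show ?thesis using trace[of z] two by simp
  next
    assume "m = 0 \<and> (\<forall>z i. E z (axis i 1) = 0)"
    then show ?thesis using trace[of z] by simp
  qed
  then have eq: "(c' + 4 *\<^sub>R u') \<bullet> Q z = (c + 4 *\<^sub>R u) \<bullet> z" for z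
    by (simp add: u'' Q_inner inner_add_left m_def inner_diff_left algebra_simps)
  obtain r where r: "c' + 4 *\<^sub>R u' = Q r" using surj_Q by (metis surjD)
  have "(r - (c + 4 *\<^sub>R u)) \<bullet> z = 0" for z
    using eq[of z] unfolding r Q_inner by (simp add: inner_diff_left)
  then have "r = c + 4 *\<^sub>R u"
    using inner_eq_zero_iff[of "r - (c + 4 *\<^sub>R u)"] by simp
  then show ?thesis unfolding r Q_inner by simp
qed

lemma bounded_bilinear_vec_mult: "bounded_bilinear ((*) :: real^'n \<Rightarrow> real^'n \<Rightarrow> real^'n)"
  unfolding bilinear_conv_bounded_bilinear[symmetric] bilinear_def
  by (auto intro!: linearI simp: algebra_simps)

section \<open>The differential of a local isometry\<close>

locale potential_isometry = separated_potential \<O> F f +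
  chart_isometry "M_F \<O>" "g_F F" "separated_potential.Gam F" A \<psi>
  for \<O> :: "(real^'s::finite) set" and F f A \<psi> +
  assumes card_ge_2: "CARD('s) \<ge> 2"
begin

text \<open>Testing \<open>x\<close> against a vector orthogonal to its \<open>u\<close>-part, and
  then to its \<open>t\<close>-part, isolates each part. Such vectors exist because s is at least
  2.\<close>

lemma curvature_null_iff:
  assumes "p \<in> M_F \<O>"
  shows "(\<forall>y z. curvature (M_F \<O>) (g_F F) p x y z = 0) \<longleftrightarrow> pu x = 0 \<and> pt x = 0"
proof
  assume null: "\<forall>y z. curvature (M_F \<O>) (g_F F) p x y z = 0"
  obtain b where b: "b \<noteq> 0" "pu x \<bullet> b = 0"
    using orthogonal_pair_exists[OF card_ge_2] by blast
  have "pt (curvature (M_F \<O>) (g_F F) p x (b, 0, 0) (b, 0, 0)) = 0"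
    using null by simp
  then have "(b \<bullet> b) *\<^sub>R pu x = 0"
    using b by (simp add: curvature_M_F[OF assms])
  then have u: "pu x = 0" using b by simp
  obtain a where a: "a \<noteq> 0" "pt x \<bullet> a = 0"
    using orthogonal_pair_exists[OF card_ge_2] by blast
  have "pv (curvature (M_F \<O>) (g_F F) p x (a, 0, 0) (a, 0, 0)) = 0"
    using null by simp
  then have "(a \<bullet> a) *\<^sub>R pt x = 0"
    using a u by (simp add: curvature_M_F[OF assms] B_form_def)
  then show "pu x = 0 \<and> pt x = 0" using a u by simp
qed (simp add: curvature_M_F[OF assms] B_form_def zero_prod_def)

lemma d\<psi>_null_iff:
  assumes p: "p \<in> A"
  shows "pu (d\<psi> p x) = 0 \<and> pt (d\<psi> p x) = 0 \<longleftrightarrow> pu x = 0 \<and> pt x = 0"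
proof -
  have zero: "d\<psi> p v = 0 \<longleftrightarrow> v = 0" for v
    using linear_injective_0[OF linear_d\<psi>[OF p]] inj_d\<psi>[OF p] linear_0[OF linear_d\<psi>[OF p]] by metis
  have "(\<forall>y z. curvature (M_F \<O>) (g_F F) (\<psi> p) (d\<psi> p x) y z = 0) \<longleftrightarrow>
      (\<forall>y z. curvature (M_F \<O>) (g_F F) (\<psi> p) (d\<psi> p x) (d\<psi> p y) (d\<psi> p z) = 0)"
    using surj_d\<psi>[OF p] by (metis surjD)
  also have "\<dots> \<longleftrightarrow> (\<forall>y z. curvature (M_F \<O>) (g_F F) p x y z = 0)"
    unfolding curvature_d\<psi>[OF p, symmetric] zero ..
  finally show ?thesis
    unfolding curvature_null_iff[OF image_\<psi>[OF p]] curvature_null_iff[OF A_M[OF p]] .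
qed

text \<open>\<open>pu x = 0\<close> means that \<open>x\<close> is orthogonal to all
  \<open>V\<close>-directions; these are the kernel of the curvature and hence preserved. Pairing
  the image with \<open>?w\<close> gives the squared length of its \<open>u\<close>-part.\<close>

lemma pu_d\<psi>_zero:
  assumes p: "p \<in> A" and x: "pu x = 0"
  shows "pu (d\<psi> p x) = 0"
proof -
  let ?w = "(0, 0, pu (d\<psi> p x)) :: 's space3"
  obtain v where v: "?w = d\<psi> p v" using surj_d\<psi>[OF p] by (metis surjD)
  have "pu v = 0 \<and> pt v = 0"
    using d\<psi>_null_iff[OF p, of v] unfolding v[symmetric] by simp
  then have "g_F F p x v = 0" using x by (simp add: g_F_eq)
  then have "g_F F (\<psi> p) (d\<psi> p x) ?w = 0" unfolding v g_d\<psi>[OF p] .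
  then show ?thesis by (simp add: g_F_eq)
qed

text \<open>The map induced on the quotient by \<open>T \<oplus> V\<close>;
  \<open>pu_d\<psi>\<close> shows that it is well defined.\<close>

definition Q :: "'s space3 \<Rightarrow> real^'s \<Rightarrow> real^'s" where "Q p a = pu (d\<psi> p (a, 0, 0))"

lemma d\<psi>_split:
  assumes p: "p \<in> A"
  shows "d\<psi> p x = d\<psi> p (pu x, 0, 0) + d\<psi> p (0, pt x, 0) + d\<psi> p (0, 0, pv x)"
  unfolding linear_add[OF linear_d\<psi>[OF p], symmetric] by simp

lemma pu_d\<psi>: "p \<in> A \<Longrightarrow> pu (d\<psi> p x) = Q p (pu x)"
  by (subst d\<psi>_split) (simp_all add: Q_def pu_d\<psi>_zero)

text \<open>The metric on \<open>T \<oplus> V\<close> makes the action \<open>R\<close> on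
  \<open>t\<close>-parts orthogonal; the \<open>t\<close>-part of the invariance of curvature then
  ties \<open>Q\<close> to \<open>R\<close>.\<close>

lemma orthogonal_Q_and_pt:
  assumes p: "p \<in> A"
  shows orthogonal_Q: "orthogonal_transformation (Q p)"
    and pt_d\<psi>_vertical: "pu x = 0 \<Longrightarrow> pt (d\<psi> p x) = Q p (pt x)"
proof -
  define R where "R b = pt (d\<psi> p (0, b, 0))" for b
  note lin = linear_d\<psi>[OF p]
  have pt_R: "pt (d\<psi> p x) = R (pt x)" if "pu x = 0" for x
    using d\<psi>_null_iff[OF p, of "(0, 0, pv x)"] that
    by (subst d\<psi>_split[OF p]) (simp add: R_def linear_0[OF lin] zero_prod_def[symmetric])
  have lin_R: "linear R"
    unfolding R_def using linear_add[OF lin, of "(0, _, 0)" "(0, _, 0)"] linear_cmul[OF lin, of _ "(0, _, 0)"]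
    by (intro linearI) auto
  have lin_Q: "linear (Q p)"
    unfolding Q_def using linear_add[OF lin, of "(_, 0, 0)" "(_, 0, 0)"] linear_cmul[OF lin, of _ "(_, 0, 0)"]
    by (intro linearI) auto
  have "R a \<bullet> R b = a \<bullet> b" for a b
    using g_d\<psi>[OF p, of "(0, a, 0)" "(0, b, 0)"] pu_d\<psi>_zero[OF p, of "(0, a, 0)"] pu_d\<psi>_zero[OF p, of "(0, b, 0)"]
    by (simp add: g_F_eq R_def)
  then have R: "orthogonal_transformation R"
    using lin_R by (simp add: orthogonal_transformation_def)
  have "(Q p x \<bullet> Q p z) *\<^sub>R Q p y - (Q p y \<bullet> Q p z) *\<^sub>R Q p x = R ((x \<bullet> z) *\<^sub>R y - (y \<bullet> z) *\<^sub>R x)" for x y z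
    using arg_cong[OF curvature_d\<psi>[OF p, of "(x, 0, 0)" "(y, 0, 0)" "(z, 0, 0)"], of "\<lambda>v. pt v"]
    by (simp add: curvature_M_F[OF A_M[OF p]] curvature_M_F[OF image_\<psi>[OF p]] pt_R Q_def)
  then have "Q p = R"
    by (intro orthogonal_factor_unique[OF card_ge_2 R _ lin_Q])
  then show "orthogonal_transformation (Q p)" "pu x = 0 \<Longrightarrow> pt (d\<psi> p x) = Q p (pt x)"
    using R pt_R by simp_all
qed

lemma Q_inner: "p \<in> A \<Longrightarrow> Q p a \<bullet> Q p b = a \<bullet> b"
  using orthogonal_Q by (auto simp: orthogonal_transformation_def)

lemma linear_Q: "p \<in> A \<Longrightarrow> linear (Q p)"
  using orthogonal_Q by (auto simp: orthogonal_transformation_def)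

text \<open>\<open>Gam\<close> has no \<open>u\<close>-part, so the derivative of \<open>Q\<close>
  vanishes; its \<open>t\<close>-part is a multiple of \<open>u\<close>, and this is how the
  positions of the two points enter the invariant.\<close>

lemma dd\<psi>_components:
  assumes p: "p \<in> A"
  shows "pu (dd\<psi> p x y) = 0"
    and "pt (dd\<psi> p x y) = (pu x \<bullet> pu y) *\<^sub>R (pu (\<psi> p) - Q p (pu p))"
proof -
  show "pu (dd\<psi> p x y) = 0"
    using pu_d\<psi>_zero[OF p, of "Gam p x y"] by (simp add: dd\<psi>_eq[OF p] Gam_def)
  have "pt (d\<psi> p (Gam p x y)) = Q p (- (pu x \<bullet> pu y) *\<^sub>R pu p)"
    using pt_d\<psi>_vertical[OF p, of "Gam p x y"] by (simp add: Gam_def)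
  then show "pt (dd\<psi> p x y) = (pu x \<bullet> pu y) *\<^sub>R (pu (\<psi> p) - Q p (pu p))"
    by (simp add: dd\<psi>_eq[OF p] Gam_def[of "\<psi> p"] pu_d\<psi>[OF p] Q_inner[OF p]
        linear_cmul[OF linear_Q[OF p]] linear_neg[OF linear_Q[OF p]] algebra_simps)
qed

lemma sig_has_derivative:
  assumes "u \<in> \<O>"
  shows "(sig has_derivative (\<lambda>h. third u * h + (u \<bullet> h) *\<^sub>R 1)) (at u)"
proof -
  have "((\<lambda>u. hess u + ((1 / 2) * (u \<bullet> u)) *\<^sub>R 1) has_derivative
      (\<lambda>h. third u * h + ((1 / 2) * (u \<bullet> h + h \<bullet> u)) *\<^sub>R 1)) (at u)"
    by (intro has_derivative_add hess_has_derivative[OF assms] has_derivative_scaleR_left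
        has_derivative_mult_right has_derivative_inner has_derivative_ident)
  then show ?thesis
    by (simp add: sig_def[abs_def] inner_commute)
qed

text \<open>The base point and the vector both vary, to cover the moving frame at
  \<open>\<psi> q\<close> as well as a constant vector at \<open>q\<close>.\<close>

lemma B_form_has_derivative:
  assumes u: "\<nu> p \<in> \<O>" and \<nu>: "(\<nu> has_derivative \<nu>') (at p)" and X: "(X has_derivative X') (at p)"
  shows "((\<lambda>q. B_form (\<nu> q) (X q) (X q)) has_derivative
    (\<lambda>z. ((third (\<nu> p) * \<nu>' z) * pu (X p)) \<bullet> pu (X p) + (\<nu> p \<bullet> \<nu>' z) * (pu (X p) \<bullet> pu (X p))
      + 2 * ((sig (\<nu> p) * pu (X p)) \<bullet> pu (X' z) + pu (X' z) \<bullet> pt (X p) + pu (X p) \<bullet> pt (X' z)))) (at p)"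
proof -
  note mult = bounded_bilinear.FDERIV[OF bounded_bilinear_vec_mult]
  note sig = has_derivative_compose[OF \<nu> sig_has_derivative[OF u]]
  have sym: "(pu (X' z) * sig (\<nu> p)) \<bullet> pu (X p) = (pu (X p) * sig (\<nu> p)) \<bullet> pu (X' z)" for z
    by (simp add: inner_vec_def mult_ac)
  have "((\<lambda>q. B_form (\<nu> q) (X q) (X q)) has_derivative
    (\<lambda>z. ((sig (\<nu> p) * pu (X p)) \<bullet> pu (X' z)
        + (sig (\<nu> p) * pu (X' z) + (third (\<nu> p) * \<nu>' z + (\<nu> p \<bullet> \<nu>' z) *\<^sub>R 1) * pu (X p)) \<bullet> pu (X p))
      + (pu (X p) \<bullet> pt (X' z) + pu (X' z) \<bullet> pt (X p))
      + (pt (X p) \<bullet> pu (X' z) + pt (X' z) \<bullet> pu (X p)))) (at p)"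
    unfolding B_form_def
    by (intro has_derivative_add has_derivative_inner mult sig has_derivative_fst has_derivative_snd X)
  then show ?thesis
    by (rule has_derivative_eq_rhs)
      (simp add: fun_eq_iff distrib_right inner_add_left sym inner_commute[of "pt _"] algebra_simps)
qed

text \<open>Invariance of \<open>R(a, b, b, a)\<close>: for orthogonal \<open>a\<close> and
  \<open>b\<close> the mixed values of \<open>B\<close> drop out, leaving one relation between two
  diagonal ones.\<close>

lemma B_form_isometry:
  assumes p: "p \<in> A" and ab: "a \<bullet> b = 0"
  shows "(b \<bullet> b) * (B_form (pu (\<psi> p)) (d\<psi> p (a, 0, 0)) (d\<psi> p (a, 0, 0)) - B_form (pu p) (a, 0, 0) (a, 0, 0))
    + (a \<bullet> a) * (B_form (pu (\<psi> p)) (d\<psi> p (b, 0, 0)) (d\<psi> p (b, 0, 0)) - B_form (pu p) (b, 0, 0) (b, 0, 0)) = 0"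
proof -
  let ?a = "(a, 0, 0) :: 's space3" and ?b = "(b, 0, 0) :: 's space3"
  have "g_F F (\<psi> p) (d\<psi> p (curvature (M_F \<O>) (g_F F) p ?a ?b ?b)) (d\<psi> p ?a) =
      g_F F p (curvature (M_F \<O>) (g_F F) p ?a ?b ?b) ?a"
    by (rule g_d\<psi>[OF p])
  then have "curvature_tensor (M_F \<O>) (g_F F) (\<psi> p) (d\<psi> p ?a) (d\<psi> p ?b) (d\<psi> p ?b) (d\<psi> p ?a) =
      curvature_tensor (M_F \<O>) (g_F F) p ?a ?b ?b ?a"
    unfolding curvature_tensor_def curvature_d\<psi>[OF p] .
  then show ?thesis
    using ab inner_commute[of b a]
    by (simp add: curvature_tensor_eq[OF A_M[OF p]] curvature_tensor_eq[OF image_\<psi>[OF p]]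
        kulkarni_nomizu_def pu_d\<psi>[OF p] Q_inner[OF p] algebra_simps)
qed

lemma alpha_F_eq: "alpha_F F p = (third (pu p) + 4 *\<^sub>R pu p) \<bullet> (third (pu p) + 4 *\<^sub>R pu p)"
  by (simp add: alpha_F_def case_prod_beta third_def inner_vec_def power2_eq_square)

lemma alpha_F_invariant:
  assumes p: "p \<in> A"
  shows "alpha_F F p = alpha_F F (\<psi> p)"
proof -
  let ?u = "pu p" and ?u' = "pu (\<psi> p)" and ?L = "d\<psi> p"
  define E where "E z a = (third ?u' * Q p z * Q p a) \<bullet> Q p a + (?u' \<bullet> Q p z) * (a \<bullet> a)
    + 2 * (z \<bullet> a) * (Q p a \<bullet> ?u' - a \<bullet> ?u) - (third ?u * z * a) \<bullet> a - (?u \<bullet> z) * (a \<bullet> a)" for z a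
  define D where "D a q = B_form (pu (\<psi> q)) (d\<psi> q (a, 0, 0)) (d\<psi> q (a, 0, 0)) - B_form (pu q) (a, 0, 0) (a, 0, 0)" for a q
  have u: "?u \<in> \<O>" "?u' \<in> \<O>"
    using A_M[OF p] image_\<psi>[OF p] by (auto simp: M_F_iff)
  have "(D a has_derivative (\<lambda>z. E (pu z) a)) (at p)" for a
  proof -
    let ?a = "(a, 0, 0) :: 's space3"
    have "(D a has_derivative (\<lambda>z.
        (((third ?u' * pu (?L z)) * pu (?L ?a)) \<bullet> pu (?L ?a) + (?u' \<bullet> pu (?L z)) * (pu (?L ?a) \<bullet> pu (?L ?a))
          + 2 * ((sig ?u' * pu (?L ?a)) \<bullet> pu (dd\<psi> p z ?a) + pu (dd\<psi> p z ?a) \<bullet> pt (?L ?a) + pu (?L ?a) \<bullet> pt (dd\<psi> p z ?a)))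
        - (((third ?u * pu z) * pu ?a) \<bullet> pu ?a + (?u \<bullet> pu z) * (pu ?a \<bullet> pu ?a)
          + 2 * ((sig ?u * pu ?a) \<bullet> pu (0 :: 's space3) + pu (0 :: 's space3) \<bullet> pt ?a + pu ?a \<bullet> pt (0 :: 's space3))))) (at p)"
      unfolding D_def
      by (rule has_derivative_diff[OF
          B_form_has_derivative[where \<nu> = "\<lambda>q. pu (\<psi> q)" and X = "\<lambda>q. d\<psi> q ?a"]
          B_form_has_derivative[where \<nu> = pu and X = "\<lambda>_. ?a" and X' = "\<lambda>_. 0"]])
        (intro u has_derivative_fst \<psi>_has_derivative[OF p] d\<psi>_has_derivative[OF p]
          has_derivative_const has_derivative_ident)+
    \<comment> \<open>As \<open>pu (dd\<psi> p z ?a) = 0\<close>, all terms with \<open>sig\<close>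
      or \<open>pt (?L ?a)\<close> disappear. The remaining product gives
      \<open>2 (z . a) (Q a . u' - a . u)\<close>, because \<open>Q\<close> is orthogonal.\<close>
    then show ?thesis
      by (rule has_derivative_eq_rhs)
        (simp add: fun_eq_iff E_def pu_d\<psi>[OF p] dd\<psi>_components[OF p] Q_inner[OF p] inner_diff_right)
  qed
  note dD = this
  have E: "(b \<bullet> b) * E z a + (a \<bullet> a) * E z b = 0" if "a \<bullet> b = 0" for z a b
  proof -
    have "((\<lambda>q. (b \<bullet> b) * D a q + (a \<bullet> a) * D b q) has_derivative
        (\<lambda>z. (b \<bullet> b) * E (pu z) a + (a \<bullet> a) * E (pu z) b)) (at p)"
      by (intro has_derivative_add has_derivative_mult_right dD)
    \<comment> \<open>By \<open>B_form_isometry\<close> the combination vanishes identically on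
      \<open>A\<close>, so its derivative at \<open>p\<close> is zero in every direction.\<close>
    then have "((\<lambda>q. 0) has_derivative (\<lambda>z. (b \<bullet> b) * E (pu z) a + (a \<bullet> a) * E (pu z) b)) (at p)"
      by (rule has_derivative_transform_within_open[OF _ open_A p]) (simp add: D_def B_form_isometry that)
    from fun_cong[OF has_derivative_unique[OF this has_derivative_const], of "(z, 0, 0)"] show ?thesis
      by simp
  qed
  show ?thesis
    unfolding alpha_F_eq
    by (rule alpha_rigid[OF card_ge_2 orthogonal_Q[OF p]]) (rule E[unfolded E_def])
qed

end

context separated_potential
begin

lemma alpha_F_local_isometry:
  assumes "CARD('s) \<ge> 2" "local_isometry (M_F \<O>) (g_F F) \<psi> P Q"
  shows "alpha_F F P = alpha_F F Q"
proof -
  obtain A B \<phi> where AB: "\<psi> P = Q" "open A" "A \<subseteq> M_F \<O>" "B \<subseteq> M_F \<O>" "P \<in> A" "homeomorphism A B \<psi> \<phi>"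
    "smooth_on A \<psi>"
    "\<forall>p\<in>A. \<forall>x y. g_F F (\<psi> p) (frechet_derivative \<psi> (at p) x) (frechet_derivative \<psi> (at p) y) = g_F F p x y"
    using assms(2) unfolding local_isometry_def by (elim conjE exE) (rule that; assumption)
  have "\<psi> p \<in> M_F \<O>" if "p \<in> A" for p
    using AB(4,6) that by (auto simp: homeomorphism_def)
  then interpret I: potential_isometry \<O> F f A \<psi>
    using AB assms(1) by unfold_locales auto
  show ?thesis
    using I.alpha_F_invariant[OF AB(5)] AB(1) by simp
qed

end

theorem theorem1p3:
  fixes \<O> :: "(real^'s::finite) set"
    and F :: "real^'s \<Rightarrow> real"
    and f :: "'s \<Rightarrow> real \<Rightarrow> real"
  assumes "CARD('s) \<ge> 2"
    and "open \<O>" and "\<O> \<noteq> {}"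
    and "smooth_on \<O> F"
    and "\<And>u. u \<in> \<O> \<Longrightarrow> F u = (\<Sum>i\<in>UNIV. f i (u $ i))"
  shows "pseudo_riemannian (M_F \<O>) (g_F F)
    \<and> (\<forall>P\<in>M_F \<O>. has_signature (g_F F P) (2 * CARD('s)) CARD('s))
    \<and> ricci_flat (M_F \<O>) (g_F F)
    \<and> curvature_homogeneous_with_model (M_F \<O>) (g_F F)
        (g_model :: 's space3 \<Rightarrow> 's space3 \<Rightarrow> real) R_model
    \<and> spacelike_jordan_osserman (M_F \<O>) (g_F F)
    \<and> \<not> timelike_jordan_osserman (M_F \<O>) (g_F F)
    \<and> (\<forall>k. 2 \<le> k \<and> k \<le> CARD('s) \<longrightarrow>
          spacelike_higher_jordan_osserman k (M_F \<O>) (g_F F))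
    \<and> (\<forall>k. 2 \<le> k \<and> k \<le> 2 * CARD('s) \<longrightarrow>
          (timelike_higher_jordan_osserman k (M_F \<O>) (g_F F) \<longleftrightarrow>
             CARD('s) + 2 \<le> k \<and> k \<le> 2 * CARD('s)))
    \<and> (\<forall>P\<in>M_F \<O>. \<forall>Q\<in>M_F \<O>. \<forall>\<psi>.
          local_isometry (M_F \<O>) (g_F F) \<psi> P Q \<longrightarrow> alpha_F F P = alpha_F F Q)
    \<and> ((\<exists>P\<in>M_F \<O>. \<exists>Q\<in>M_F \<O>. alpha_F F P \<noteq> alpha_F F Q) \<longrightarrow>
          \<not> locally_homogeneous (M_F \<O>) (g_F F))"
proof -
  interpret separated_potential \<O> F f
    using assms(2,4,5) by unfold_locales
  have alpha: "alpha_F F P = alpha_F F Q" if "local_isometry (M_F \<O>) (g_F F) \<psi> P Q" for P Q \<psi>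
    by (rule alpha_F_local_isometry[OF assms(1) that])
  moreover have "\<not> locally_homogeneous (M_F \<O>) (g_F F)"
    if "P \<in> M_F \<O>" "Q \<in> M_F \<O>" "alpha_F F P \<noteq> alpha_F F Q" for P Q
    using alpha that unfolding locally_homogeneous_def by blast
  moreover have "timelike_higher_jordan_osserman k (M_F \<O>) (g_F F) \<longleftrightarrow> CARD('s) + 2 \<le> k \<and> k \<le> 2 * CARD('s)"
    if "2 \<le> k" "k \<le> 2 * CARD('s)" for k
    using that not_timelike_higher_jordan_osserman_M_F[OF assms(3,1) that(1)]
      timelike_higher_jordan_osserman_M_F[of k] by force
  ultimately show ?thesis
    using pseudo_riemannian_M_F has_signature_g_F ricci_flat_M_F curvature_homogeneous
      spacelike_jordan_osserman_M_F not_timelike_jordan_osserman_M_F[OF assms(3,1)]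
      spacelike_higher_jordan_osserman_M_F
    by (intro conjI ballI allI impI) (blast | simp)+
qed

end
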